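(* Let $f(x)=\frac1n\sum_{i=1}^nf_i(x)$, $x\in\mathbb R^d$, where each $f_i$ is twice differentiable, possibly nonconvex and $L$-smooth, $f$ is $L_2$-second-order smooth, and $\mathbb E_{i\in_R[n]}\|\nabla f(x)-\nabla f_i(x)\|^2\le\mathcal V$ for all $x\in\mathbb R^d$. Let $y_0\in\mathbb R^d$ be a starting vector and let $\Delta_f$ be any known upper bound on $f(y_0)-\min_y\{f(y)\}$. For any $\varepsilon>0$ and $\delta\in(0,L]$, under the assumptions $\mathcal V\ge\Omega(\varepsilon^2)$ and $\delta^4\le O(\mathcal V\varepsilon L_2^3/L^2)$, the output $x^{\mathsf{out}}=\mathtt{Natasha2^{full}}(f,y_0,\varepsilon,\delta)$ (for suitable absolute constants in the $\Theta(\cdot)$ parameter choices) satisfies, with probability at least $2/3$, $$\|\nabla f(x^{\mathsf{out}})\|\le\varepsilon\quad\text{and}\quad\nabla^2f(x^{\mathsf{out}})\succeq-3\delta\mathbf I,$$ and the total gradient complexity (on the same event of probability at least $2/3$) is $$T=\widetilde O\Big(\frac{\mathcal V}{\varepsilon^2}+\frac{L_2^2L^2\Delta_f}{\delta^5}+\frac{L_2\Delta_f}{\varepsilon\delta}\cdot\Big(\frac{L^2}{\delta^2}+\frac{\mathcal V}{\varepsilon^2}\Big)+\frac{L\Delta_f}{\varepsilon\mathcal V^{1/2}}\cdot\frac{L^2}{\delta^2}\Big).$$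
   Context: $\|\cdot\|$ is the Euclidean norm, $[n]=\{1,\dots,n\}$, $i\in_R[n]$ means $i$ uniform on $[n]$, and $\mathbf A\succeq-\delta\mathbf I$ means all eigenvalues of the symmetric matrix $\mathbf A$ are at least $-\delta$. A function $f$ is $L$-smooth if $\|\nabla f(x)-\nabla f(y)\|\le L\|x-y\|$ for all $x,y$; it is $L_2$-second-order smooth if $\|\nabla^2f(x)-\nabla^2f(y)\|_2\le L_2\|x-y\|$ for all $x,y$ (spectral norm). Constants in $O,\Omega,\Theta$ are absolute; $\widetilde O$ hides logarithmic factors in $n,d,L,L_2,\mathcal V,1/\varepsilon,1/\delta$. Integer parameters are rounded, $\log(\widetilde L/\widetilde\sigma)$ is read as $\max\{1,\log(\widetilde L/\widetilde\sigma)\}$, and $n$ is regarded as large (online setting) so that $B\in[n]$ below. Gradient complexity is the number of computations of stochastic gradients $\nabla f_i(x)$ plus the number of Hessian-vector products $\nabla^2f_i(x)\cdot w$. Subroutine $\mathtt{Natasha1.5^{full}}(F,x^\varnothing,B,p,1,\alpha)$ (one full epoch, no proximal term), for $F=\frac1n\sum_iF_i$ and nonconvexity parameter $\widetilde\sigma$. Set $\widehat x\leftarrow x^\varnothing$, $m\leftarrow B/p$, $\widetilde{\mathbf x}\leftarrow\widehat x$, $\mu\leftarrow\frac1B\sum_{i\in S}\nabla F_i(\widetilde{\mathbf x})$ for a uniformly random $S\subseteq[n]$ with $|S|=B$, and $X'\leftarrow[\,]$. For $s=0,\dots,p-1$: set $x_0\leftarrow\widehat x$ and append $\widehat x$ to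 $X'$; for $t=0,\dots,m-1$ draw $i\in_R[n]$ and set $x_{t+1}=x_t-\alpha\big(\nabla F_i(x_t)-\nabla F_i(\widetilde{\mathbf x})+\mu+2\widetilde\sigma(x_t-\widehat x)\big)$; then set $\widehat x$ to be a uniformly random element of $\{x_0,\dots,x_{m-1}\}$. Return $(\widehat y,y^+)$, where $\widehat y$ is a uniformly random vector in $X'$ and $y^+$ is the final $\widehat x$. Algorithm $\mathtt{Natasha2^{full}}(f,y_0,\varepsilon,\delta)$. (1) If $L_2\ge\frac{L\delta}{\mathcal V^{1/3}\varepsilon^{1/3}}$, set $\widetilde L=\widetilde\sigma\leftarrow\Theta\big(\frac{L_2\mathcal V^{1/3}\varepsilon^{1/3}}{\delta}\big)\in[L,\infty)$; otherwise set $\widetilde L\leftarrow L$ and $\widetilde\sigma\leftarrow\Theta\big(\max\{\frac{\mathcal V\varepsilon L_2^3}{L^2\delta^3},\frac{\varepsilon L}{\mathcal V^{1/2}}\}\big)\in[\delta,L]$. (2) Set $B\leftarrow\Theta(\mathcal V/\varepsilon^2)$, $p\leftarrow\Theta\big((\frac{\widetilde\sigma^2}{\widetilde L^2}B)^{1/3}\big)$, $\alpha\leftarrow\Theta\big(\frac{\widetilde\sigma}{p^2\widetilde L^2}\big)$, $X\leftarrow[\,]$, $N_1\leftarrow\Theta\big(\frac{\widetilde\sigma\Delta_f}{p\varepsilon^2}\big)$. (3) For $k=0,1,2,\dots$: apply Oja's algorithm (repeated runs on random matrices $\frac{L\mathbf I-\nabla^2f_i(y_k)}{2L}$, $i\in_R[n]$),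 using $\widetilde O(L^2/\delta^2)$ Hessian-vector products, so that with probability at least $1-\frac1{20(k+1)^2}$ it either finds a unit vector $v$ with $v^\top\nabla^2f(y_k)v\le-\frac\delta2$ or correctly concludes $\nabla^2f(y_k)\succeq-\delta\mathbf I$. If such a $v$ is found (second-order step), set $y_{k+1}\leftarrow y_k\pm\frac\delta{L_2}v$ with uniformly random sign. Otherwise (first-order step), let $F^k(x)=f(x)+L\big(\max\{0,\|x-y_k\|-\frac\delta{L_2}\}\big)^2$, viewed as the average of $f_i(x)+L(\max\{0,\|x-y_k\|-\frac\delta{L_2}\})^2$; set $(\widehat y_k,y_{k+1})\leftarrow\mathtt{Natasha1.5^{full}}(F^k,y_k,B,p,1,\alpha)$, append $(y_k,\widehat y_k)$ to $X$, and leave the loop once $N_1$ first-order steps have been performed. (4) Let $(y,\widehat y)$ be a uniformly random pair in $X$, let $G(x)=f(x)+L\big(\max\{0,\|x-y\|-\frac\delta{L_2}\}\big)^2+\widetilde\sigma\|x-\widehat y\|^2$, and return $x^{\mathsf{out}}\leftarrow\mathtt{SGD3^{sc}}(G,\widehat y,\widetilde\sigma,O(\widetilde L),T_{\mathsf{sgd}})$ with $T_{\mathsf{sgd}}=\Theta\big(\frac{\mathcal V}{\varepsilon^2}\log^3\frac{\widetilde L}{\widetilde\sigma}\big)$. The subroutine $\mathtt{SGD3^{sc}}$ is a known stochastic gradient method for convex problems with the following guarantee (stated without proximal term). Let $H=\frac1n\sum_ih_i$ be $\sigma'$-strongly convex and $L'$-smooth with minimizer $x^*$ and $\mathbb E_i\|\nabla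 H(x)-\nabla h_i(x)\|^2\le\mathcal V$ for all $x$. For $T\ge\frac{L'}{\sigma'}\log\frac{L'}{\sigma'}$, $\mathtt{SGD3^{sc}}(H,x_0,\sigma',L',T)$ computes $T$ stochastic gradients and outputs $\bar x$ with $\mathbb E\|\nabla H(\bar x)\|\le O\big(\frac{\sqrt{\mathcal V}\log^{3/2}(L'/\sigma')}{\sqrt T}\big)+\big(1-\frac{\sigma'}{L'}\big)^{\Omega(T/\log(L'/\sigma'))}\sigma'\|x_0-x^*\|$.
   Formalization: If the unrounded N_1 = Θ(σ̃Δ_f/(pε²)) is below 1 (e.g. Δ_f = 0), the term L²/δ² is added inside the Õ bound on T: one first-order step and so one Oja call is still needed, which the stated bound need not cover. *)

theory Defs
  imports "HOL-Probability.Probability"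
begin

section \<open>Euclidean spaces of variable dimension\<close>

text \<open>
  The \<open>O\<close>-constants of the theorem must not depend on the dimension, so the dimension has to be
  quantified inside the formula and cannot be a type. We use one inner product space, the finitely
  supported real sequences with the Euclidean inner product; \<open>euclid d\<close>, the sequences supported
  on \<open>{..<d}\<close>, is the space \<open>\<real>\<^sup>d\<close>. Functions on \<open>\<real>\<^sup>d\<close> are only ever evaluated on \<open>euclid d\<close>, and
  derivatives are taken within \<open>euclid d\<close>.
\<close>

typedef rvec = "{x :: nat \<Rightarrow> real. finite {i. x i \<noteq> 0}}"
  morphisms coord Abs_rvec
  by (rule exI[of _ "\<lambda>_. 0"]) simp

lemma finite_support [simp]: "finite {i. coord x i \<noteq> 0}"
  using coord[of x] by simp

lemma rvec_eqI: "(\<And>i. coord x i = coord y i) \<Longrightarrow> x = y"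
  by (simp add: coord_inject[symmetric] fun_eq_iff)

lemma coord_Abs: "finite {i. g i \<noteq> 0} \<Longrightarrow> coord (Abs_rvec g) = g"
  by (simp add: Abs_rvec_inverse)

instantiation rvec :: real_vector
begin

definition zero_rvec :: rvec where "0 = Abs_rvec (\<lambda>_. 0)"
definition plus_rvec :: "rvec \<Rightarrow> rvec \<Rightarrow> rvec" where "x + y = Abs_rvec (\<lambda>i. coord x i + coord y i)"
definition minus_rvec :: "rvec \<Rightarrow> rvec \<Rightarrow> rvec" where "x - y = Abs_rvec (\<lambda>i. coord x i - coord y i)"
definition uminus_rvec :: "rvec \<Rightarrow> rvec" where "- x = Abs_rvec (\<lambda>i. - coord x i)"
definition scaleR_rvec :: "real \<Rightarrow> rvec \<Rightarrow> rvec" where "r *\<^sub>R x = Abs_rvec (\<lambda>i. r * coord x i)"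

lemma coord_zero [simp]: "coord 0 i = 0"
  by (simp add: zero_rvec_def coord_Abs)

lemma coord_plus [simp]: "coord (x + y) i = coord x i + coord y i"
proof -
  have "finite {i. coord x i + coord y i \<noteq> 0}"
    by (rule finite_subset[of _ "{i. coord x i \<noteq> 0} \<union> {i. coord y i \<noteq> 0}"]) auto
  then show ?thesis by (simp add: plus_rvec_def coord_Abs)
qed

lemma coord_minus [simp]: "coord (x - y) i = coord x i - coord y i"
proof -
  have "finite {i. coord x i - coord y i \<noteq> 0}"
    by (rule finite_subset[of _ "{i. coord x i \<noteq> 0} \<union> {i. coord y i \<noteq> 0}"]) auto
  then show ?thesis by (simp add: minus_rvec_def coord_Abs)
qed

lemma coord_uminus [simp]: "coord (- x) i = - coord x i"
  by (simp add: uminus_rvec_def coord_Abs)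

lemma coord_scaleR [simp]: "coord (r *\<^sub>R x) i = r * coord x i"
proof -
  have "finite {i. r * coord x i \<noteq> 0}"
    by (rule finite_subset[of _ "{i. coord x i \<noteq> 0}"]) auto
  then show ?thesis by (simp add: scaleR_rvec_def coord_Abs)
qed

instance
  by standard (auto intro!: rvec_eqI simp: algebra_simps)

end

instantiation rvec :: real_inner
begin

definition inner_rvec :: "rvec \<Rightarrow> rvec \<Rightarrow> real"
  where "inner_rvec x y = (\<Sum>i | coord x i \<noteq> 0. coord x i * coord y i)"
definition norm_rvec :: "rvec \<Rightarrow> real" where "norm_rvec x = sqrt (inner x x)"
definition sgn_rvec :: "rvec \<Rightarrow> rvec" where "sgn_rvec x = x /\<^sub>R norm x"
definition dist_rvec :: "rvec \<Rightarrow> rvec \<Rightarrow> real" where "dist_rvec x y = norm (x - y)"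
definition uniformity_rvec :: "(rvec \<times> rvec) filter"
  where "uniformity_rvec = (INF e\<in>{0<..}. principal {(x, y). dist x y < e})"
definition open_rvec :: "rvec set \<Rightarrow> bool"
  where "open_rvec U \<longleftrightarrow> (\<forall>x\<in>U. \<forall>\<^sub>F (x', y) in uniformity. x' = x \<longrightarrow> y \<in> U)"

lemma inner_rvec_superset:
  assumes "finite A" "{i. coord x i \<noteq> 0} \<subseteq> A \<or> {i. coord y i \<noteq> 0} \<subseteq> A"
  shows "inner x y = (\<Sum>i\<in>A. coord x i * coord y i)"
proof -
  let ?X = "{i. coord x i \<noteq> 0}" and ?P = "\<lambda>i. coord x i * coord y i"
  have "inner x y = sum ?P ?X" by (simp add: inner_rvec_def)
  also have "\<dots> = sum ?P (?X \<inter> A)"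
    using assms by (intro sum.mono_neutral_right) auto
  also have "\<dots> = sum ?P A"
    using assms by (intro sum.mono_neutral_left) auto
  finally show ?thesis .
qed

instance
proof
  fix x y z :: rvec and r :: real
  let ?A = "{i. coord x i \<noteq> 0} \<union> {i. coord y i \<noteq> 0} \<union> {i. coord z i \<noteq> 0}"
  have fin: "finite ?A" by simp
  show "inner x y = inner y x"
    by (subst (1 2) inner_rvec_superset[of ?A]) (auto simp: mult.commute)
  show "inner (x + y) z = inner x z + inner y z"
    by (subst (1 2 3) inner_rvec_superset[of ?A]) (auto simp: algebra_simps sum.distrib)
  show "inner (r *\<^sub>R x) y = r * inner x y"
    by (subst (1 2) inner_rvec_superset[of ?A]) (auto simp: algebra_simps sum_distrib_left)
  show "0 \<le> inner x x"
    by (simp add: inner_rvec_def sum_nonneg)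
  show "inner x x = 0 \<longleftrightarrow> x = 0"
  proof
    assume "inner x x = 0"
    then have "\<forall>i\<in>{i. coord x i \<noteq> 0}. coord x i * coord x i = 0"
      unfolding inner_rvec_def by (subst (asm) sum_nonneg_eq_0_iff) auto
    then show "x = 0" by (intro rvec_eqI) auto
  qed (simp add: inner_rvec_def)
qed (rule norm_rvec_def sgn_rvec_def dist_rvec_def uniformity_rvec_def open_rvec_def)+

end

definition euclid :: "nat \<Rightarrow> rvec set"
  where "euclid d = {x. \<forall>i\<ge>d. coord x i = 0}"

lemma subspace_euclid: "subspace (euclid d)"
  by (simp add: subspace_def euclid_def)

lemma ex_euclid: "\<exists>x\<in>euclid d. \<forall>i<d. coord x i = g i"
proof -
  have "finite {i. (if i < d then g i else 0) \<noteq> 0}"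
    by (rule finite_subset[of _ "{..<d}"]) auto
  then show ?thesis
    by (intro bexI[of _ "Abs_rvec (\<lambda>i. if i < d then g i else 0)"]) (auto simp: euclid_def coord_Abs)
qed

lemma inner_euclid:
  assumes "x \<in> euclid d"
  shows "x \<bullet> y = (\<Sum>i<d. coord x i * coord y i)"
  using assms by (intro inner_rvec_superset) (auto simp: euclid_def not_le[symmetric])

lemma norm_euclid: "x \<in> euclid d \<Longrightarrow> norm x = L2_set (coord x) {..<d}"
  by (simp add: norm_eq_sqrt_inner inner_euclid L2_set_def power2_eq_square)

section \<open>Gradients, Hessians, smoothness\<close>

definition gradient :: "nat \<Rightarrow> (rvec \<Rightarrow> real) \<Rightarrow> rvec \<Rightarrow> rvec"
  where "gradient d f x =
    (THE g. g \<in> euclid d \<and> (f has_derivative (\<lambda>h. g \<bullet> h)) (at x within euclid d))"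

text \<open>The Hessian as a linear operator on \<open>euclid d\<close>; it is unspecified, hence never applied,
  outside \<open>euclid d\<close>.\<close>

definition hessian :: "nat \<Rightarrow> (rvec \<Rightarrow> real) \<Rightarrow> rvec \<Rightarrow> rvec \<Rightarrow> rvec"
  where "hessian d f x = frechet_derivative (gradient d f) (at x within euclid d)"

definition twice_differentiable :: "nat \<Rightarrow> (rvec \<Rightarrow> real) \<Rightarrow> bool"
  where "twice_differentiable d f \<longleftrightarrow> (\<forall>x\<in>euclid d.
    f differentiable (at x within euclid d) \<and> gradient d f differentiable (at x within euclid d))"

definition spectral_norm :: "nat \<Rightarrow> (rvec \<Rightarrow> rvec) \<Rightarrow> real"
  where "spectral_norm d A = (SUP v\<in>{v \<in> euclid d. norm v \<le> 1}. norm (A v))"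

definition eigenvalue :: "nat \<Rightarrow> (rvec \<Rightarrow> rvec) \<Rightarrow> real \<Rightarrow> bool"
  where "eigenvalue d A lam \<longleftrightarrow> (\<exists>v\<in>euclid d. v \<noteq> 0 \<and> A v = lam *\<^sub>R v)"

text \<open>\<open>A \<succeq> a I\<close>\<close>

definition eigenvalues_ge :: "nat \<Rightarrow> (rvec \<Rightarrow> rvec) \<Rightarrow> real \<Rightarrow> bool"
  where "eigenvalues_ge d A a \<longleftrightarrow> (\<forall>lam. eigenvalue d A lam \<longrightarrow> a \<le> lam)"

definition smooth :: "nat \<Rightarrow> real \<Rightarrow> (rvec \<Rightarrow> real) \<Rightarrow> bool"
  where "smooth d L f \<longleftrightarrow>
    (\<forall>x\<in>euclid d. \<forall>y\<in>euclid d. norm (gradient d f x - gradient d f y) \<le> L * norm (x - y))"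

definition second_order_smooth :: "nat \<Rightarrow> real \<Rightarrow> (rvec \<Rightarrow> real) \<Rightarrow> bool"
  where "second_order_smooth d L2 f \<longleftrightarrow> (\<forall>x\<in>euclid d. \<forall>y\<in>euclid d.
    spectral_norm d (\<lambda>v. hessian d f x v - hessian d f y v) \<le> L2 * norm (x - y))"

definition strongly_convex :: "nat \<Rightarrow> real \<Rightarrow> (rvec \<Rightarrow> real) \<Rightarrow> bool"
  where "strongly_convex d s f \<longleftrightarrow> convex_on (euclid d) (\<lambda>x. f x - s / 2 * (norm x)\<^sup>2)"

definition average :: "nat \<Rightarrow> (nat \<Rightarrow> rvec \<Rightarrow> real) \<Rightarrow> rvec \<Rightarrow> real"
  where "average n f x = (\<Sum>i=1..n. f i x) / real n"

definition variance_le :: "nat \<Rightarrow> nat \<Rightarrow> (nat \<Rightarrow> rvec \<Rightarrow> real) \<Rightarrow> real \<Rightarrow> bool"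
  where "variance_le n d f V \<longleftrightarrow> (\<forall>x\<in>euclid d.
    (\<Sum>i=1..n. (norm (gradient d (average n f) x - gradient d (f i) x))\<^sup>2) / real n \<le> V)"

section \<open>The two black-box subroutines\<close>

text \<open>\<open>log r\<close> is read as \<open>max {1, log r}\<close>.\<close>

definition lg :: "real \<Rightarrow> real"
  where "lg r = max 1 (ln r)"

text \<open>\<open>\<tilde>O(z)\<close> means at most \<open>C * log_factor ... ^ a * z\<close> with absolute constants \<open>C\<close>, \<open>a\<close>. The logarithm of
  the sum is, up to absolute constants and powers, the product of the logarithms of the summands.\<close>

definition log_factor :: "nat \<Rightarrow> nat \<Rightarrow> real \<Rightarrow> real \<Rightarrow> real \<Rightarrow> real \<Rightarrow> real \<Rightarrow> real"
  where "log_factor n d L L2 V eps del =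
    ln (exp 1 + real n + real d + L + L2 + V + 1 / eps + 1 / del)"

text \<open>A run of SGD3 draws finitely many indices, so its output is described by a \<open>pmf\<close>. The
  expected gradient norm is a nonnegative Lebesgue integral, so the bound includes integrability.\<close>

type_synonym sgd3 = "(nat \<Rightarrow> rvec \<Rightarrow> real) \<Rightarrow> rvec \<Rightarrow> real \<Rightarrow> real \<Rightarrow> nat \<Rightarrow> rvec pmf"

definition sgd3_guarantee ::
    "real \<Rightarrow> real \<Rightarrow> nat \<Rightarrow> nat \<Rightarrow> real \<Rightarrow> sgd3 \<Rightarrow> bool"
  where "sgd3_guarantee C c n d V sgd \<longleftrightarrow>
    (\<forall>h x0 s' L' T xstar.
      (\<forall>i\<in>{1..n}. \<forall>x\<in>euclid d. h i differentiable (at x within euclid d)) \<and>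
      0 < s' \<and> strongly_convex d s' (average n h) \<and> smooth d L' (average n h) \<and>
      variance_le n d h V \<and> x0 \<in> euclid d \<and>
      xstar \<in> euclid d \<and> (\<forall>x\<in>euclid d. average n h xstar \<le> average n h x) \<and>
      L' / s' * lg (L' / s') \<le> real T
      \<longrightarrow>
      set_pmf (sgd h x0 s' L' T) \<subseteq> euclid d \<and>
      (\<integral>\<^sup>+x. ennreal (norm (gradient d (average n h) x)) \<partial>measure_pmf (sgd h x0 s' L' T))
        \<le> ennreal (C * (sqrt V * lg (L' / s') powr (3/2) / sqrt (real T)) +
            (1 - s' / L') powr (c * (real T / lg (L' / s'))) * (s' * norm (x0 - xstar))))"

text \<open>
  Oja's algorithm may use continuous randomness (a random start vector), so its internal randomness
  is a seed distributed uniformly on \<open>[0, 1]\<close>. For iteration \<open>k\<close>, point \<open>y\<close> and seed \<open>r\<close>, the value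
  \<open>oja k y r\<close> is \<open>Some v\<close> if a direction \<open>v\<close> is reported and \<open>None\<close> if \<open>\<nabla>\<^sup>2f(y) \<succeq> -\<delta>I\<close> is
  concluded, and \<open>hvp k y r\<close> is the number of Hessian-vector products used.
\<close>

definition seed :: "real measure"
  where "seed = uniform_measure lborel {0..1}"

type_synonym oja = "nat \<Rightarrow> rvec \<Rightarrow> real \<Rightarrow> rvec option"

fun oja_correct :: "nat \<Rightarrow> (rvec \<Rightarrow> real) \<Rightarrow> real \<Rightarrow> rvec \<Rightarrow> rvec option \<Rightarrow> bool"
  where
    "oja_correct d f del y (Some v) \<longleftrightarrow> norm v = 1 \<and> v \<bullet> hessian d f y v \<le> - (del / 2)"
  | "oja_correct d f del y None \<longleftrightarrow> eigenvalues_ge d (hessian d f y) (- del)"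

text \<open>The first conjunct is joint measurability of \<open>oja k\<close>, options being coded as pairs.\<close>

definition oja_guarantee ::
    "nat \<Rightarrow> (rvec \<Rightarrow> real) \<Rightarrow> real \<Rightarrow> real \<Rightarrow> oja \<Rightarrow> (nat \<Rightarrow> rvec \<Rightarrow> real \<Rightarrow> nat) \<Rightarrow> bool"
  where "oja_guarantee d f del cost oja hvp \<longleftrightarrow>
    (\<forall>k. (\<lambda>(y, r). case oja k y r of None \<Rightarrow> (False, 0) | Some v \<Rightarrow> (True, v))
        \<in> restrict_space borel (euclid d) \<Otimes>\<^sub>M borel \<rightarrow>\<^sub>M count_space UNIV \<Otimes>\<^sub>M borel) \<and>
    (\<forall>k. \<forall>y\<in>euclid d. \<forall>r. set_option (oja k y r) \<subseteq> euclid d) \<and>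
    (\<forall>k. \<forall>y\<in>euclid d.
        1 - 1 / (20 * (real k + 1)\<^sup>2) \<le> measure seed {r. oja_correct d f del y (oja k y r)}) \<and>
    (\<forall>k. \<forall>y\<in>euclid d. \<forall>r. real (hvp k y r) \<le> cost)"

section \<open>Natasha1.5 and Natasha2\<close>

text \<open>The hidden constants of the \<open>\<Theta>\<close>-parameters of the algorithm; \<open>c_sig1\<close> and \<open>c_sig2\<close> belong to
  the two cases for \<open>\<sigma>\<close>, and \<open>c_smo\<close> is the constant in the argument \<open>O(L)\<close> of SGD3.\<close>

record theta_consts =
  c_sig1 :: real
  c_sig2 :: real
  c_bat :: real
  c_sub :: real
  c_step :: real
  c_fst :: real
  c_smo :: real
  c_sgd :: real

definition theta_consts_pos :: "theta_consts \<Rightarrow> bool"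
  where "theta_consts_pos c \<longleftrightarrow> 0 < c_sig1 c \<and> 0 < c_sig2 c \<and> 0 < c_bat c \<and> 0 < c_sub c \<and>
    0 < c_step c \<and> 0 < c_fst c \<and> 0 < c_smo c \<and> 0 < c_sgd c"

text \<open>One full epoch for \<open>F = average n F\<close>. Trajectories are functions of the step number, of which
  only the values computed so far are meaningful: \<open>inner_loop\<close> returns \<open>x\<^sub>0, \<dots>, x\<^sub>t\<close>, and \<open>sub_epochs\<close>
  returns the successive values of \<open>xhat\<close>, the value with index \<open>s\<close> being the one at the start of
  sub-epoch \<open>s\<close>.\<close>

locale natasha15 =
  fixes n d :: nat
    and F :: "nat \<Rightarrow> rvec \<Rightarrow> real"
    and x_start :: rvec
    and B p m :: nat
    and alpha sigma :: real
begin

primrec inner_loop :: "rvec \<Rightarrow> rvec \<Rightarrow> nat \<Rightarrow> (nat \<Rightarrow> rvec) pmf"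
  where
    "inner_loop mu xhat 0 = return_pmf (\<lambda>_. xhat)"
  | "inner_loop mu xhat (Suc t) = do {
       x \<leftarrow> inner_loop mu xhat t;
       i \<leftarrow> pmf_of_set {1..n};
       return_pmf (x(Suc t := x t - alpha *\<^sub>R
         (gradient d (F i) (x t) - gradient d (F i) x_start + mu + (2 * sigma) *\<^sub>R (x t - xhat))))
     }"

primrec sub_epochs :: "rvec \<Rightarrow> nat \<Rightarrow> (nat \<Rightarrow> rvec) pmf"
  where
    "sub_epochs mu 0 = return_pmf (\<lambda>_. x_start)"
  | "sub_epochs mu (Suc s) = do {
       xhat \<leftarrow> sub_epochs mu s;
       x \<leftarrow> inner_loop mu (xhat s) m;
       t \<leftarrow> pmf_of_set {..<m};
       return_pmf (xhat(Suc s := x t))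
     }"

definition full_epoch :: "(rvec \<times> rvec) pmf"
  where "full_epoch = do {
     S \<leftarrow> pmf_of_set {S. S \<subseteq> {1..n} \<and> card S = B};
     let mu = (1 / real B) *\<^sub>R (\<Sum>i\<in>S. gradient d (F i) x_start);
     xhat \<leftarrow> sub_epochs mu p;
     s \<leftarrow> pmf_of_set {..<p};
     return_pmf (xhat s, xhat p)
   }"

text \<open>An inner step computes two stochastic gradients.\<close>

definition epoch_cost :: nat
  where "epoch_cost = B + 2 * (p * m)"

end

locale natasha2 =
  fixes c :: theta_consts
    and n d :: nat
    and f :: "nat \<Rightarrow> rvec \<Rightarrow> real"
    and L L2 V Delta eps del :: real
    and oja :: oja
    and hvp :: "nat \<Rightarrow> rvec \<Rightarrow> real \<Rightarrow> nat"
    and sgd :: sgd3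
begin

definition large_L2 :: bool
  where "large_L2 \<longleftrightarrow> L2 \<ge> L * del / (V powr (1/3) * eps powr (1/3))"

definition sigma :: real
  where "sigma =
    (if large_L2 then c_sig1 c * (L2 * V powr (1/3) * eps powr (1/3) / del)
     else c_sig2 c * max (V * eps * L2 ^ 3 / (L\<^sup>2 * del ^ 3)) (eps * L / sqrt V))"

definition L_tilde :: real
  where "L_tilde = (if large_L2 then sigma else L)"

definition sigma_in_range :: bool
  where "sigma_in_range \<longleftrightarrow> (if large_L2 then L \<le> sigma else del \<le> sigma \<and> sigma \<le> L)"

text \<open>Integer parameters are rounded up. The loop always performs at least one first-order step, as
  it is only left after such a step; if \<open>N1_raw < 1\<close>, then \<open>N1 = 1\<close> is not \<open>O(N1_raw)\<close>, and the cost
  \<open>\<tilde>O(L\<^sup>2 / \<delta>\<^sup>2)\<close> of one call of Oja's algorithm need not be covered by terms proportional to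
  \<open>Delta\<close>.\<close>

definition B :: nat
  where "B = nat \<lceil>c_bat c * (V / eps\<^sup>2)\<rceil>"

definition p :: nat
  where "p = nat \<lceil>c_sub c * root 3 (sigma\<^sup>2 / L_tilde\<^sup>2 * real B)\<rceil>"

definition m :: nat
  where "m = nat \<lceil>real B / real p\<rceil>"

definition alpha :: real
  where "alpha = c_step c * (sigma / ((real p)\<^sup>2 * L_tilde\<^sup>2))"

definition N1_raw :: real
  where "N1_raw = c_fst c * (sigma * Delta / (real p * eps\<^sup>2))"

definition N1 :: nat
  where "N1 = max 1 (nat \<lceil>N1_raw\<rceil>)"

definition T_sgd :: nat
  where "T_sgd = nat \<lceil>c_sgd c * (V / eps\<^sup>2 * lg (L_tilde / sigma) ^ 3)\<rceil>"

definition penalized :: "rvec \<Rightarrow> nat \<Rightarrow> rvec \<Rightarrow> real"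
  where "penalized y i x = f i x + L * (max 0 (norm (x - y) - del / L2))\<^sup>2"

definition regularized :: "rvec \<Rightarrow> rvec \<Rightarrow> nat \<Rightarrow> rvec \<Rightarrow> real"
  where "regularized y yhat i x = penalized y i x + sigma * (norm (x - yhat))\<^sup>2"

text \<open>The state consists of the current point, the list \<open>X\<close> of pairs, and the number of stochastic
  gradients and Hessian-vector products computed so far; \<open>r\<close> is the seed for Oja's algorithm.\<close>

type_synonym state = "rvec \<times> (rvec \<times> rvec) list \<times> nat"

fun iteration :: "nat \<Rightarrow> real \<Rightarrow> state \<Rightarrow> state pmf"
  where "iteration k r (y, X, T) =
    (case oja k y r of
       Some v \<Rightarrow> do {
         s \<leftarrow> pmf_of_set {-1, 1};
         return_pmf (y + (s * (del / L2)) *\<^sub>R v, X, T + hvp k y r)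
       }
     | None \<Rightarrow> do {
         (yhat, y') \<leftarrow> natasha15.full_epoch n d (penalized y) y B p m alpha sigma;
         return_pmf (y', X @ [(y, yhat)], T + hvp k y r + natasha15.epoch_cost B p m)
       })"

text \<open>The state at the start of iteration \<open>k\<close>; it no longer changes once the loop has been left.\<close>

primrec main_loop :: "(nat \<Rightarrow> real) \<Rightarrow> rvec \<Rightarrow> nat \<Rightarrow> state pmf"
  where
    "main_loop u y0 0 = return_pmf (y0, [], 0)"
  | "main_loop u y0 (Suc k) = do {
       st \<leftarrow> main_loop u y0 k;
       if length (fst (snd st)) < N1 then iteration k (u k) st else return_pmf st
     }"

text \<open>The output and the total gradient complexity, or \<open>None\<close> if the loop has not been left within
  \<open>K\<close> iterations.\<close>

definition run :: "(nat \<Rightarrow> real) \<Rightarrow> rvec \<Rightarrow> nat \<Rightarrow> (rvec \<times> nat) option pmf"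
  where "run u y0 K = do {
     (y', X, T) \<leftarrow> main_loop u y0 K;
     if length X < N1 then return_pmf None
     else do {
       j \<leftarrow> pmf_of_set {..<length X};
       let (y, yhat) = X ! j;
       x \<leftarrow> sgd (regularized y yhat) yhat sigma (c_smo c * L_tilde) T_sgd;
       return_pmf (Some (x, T + T_sgd))
     }
   }"

text \<open>The probability, over independent seeds and all other random choices, that the loop is left
  within \<open>K\<close> iterations and that output and complexity satisfy \<open>Q\<close>. For an integrand that is not
  measurable (nothing is assumed about \<open>hvp\<close> and \<open>sgd\<close> in this respect) the integral is the lower
  integral, so that lower bounds on it are meaningful in any case.\<close>

definition success_prob :: "rvec \<Rightarrow> nat \<Rightarrow> (rvec \<Rightarrow> nat \<Rightarrow> bool) \<Rightarrow> ennreal"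
  where "success_prob y0 K Q =
    (\<integral>\<^sup>+u. emeasure (measure_pmf (run u y0 K)) {Some (x, T) | x T. Q x T}
      \<partial>(\<Pi>\<^sub>M k\<in>UNIV. seed))"

end

end

theory Submission
  imports Defs
begin

text \<open>
  Every first-order step applies Natasha1.5 to \<open>F(x) = f(x) + L (dist(x, ball(y, \<rho>)))\<^sup>2\<close> with
  \<open>\<rho> = \<delta> / L\<^sub>2\<close>. If \<open>\<nabla>\<^sup>2f(y) \<succeq> -\<delta>I\<close>, then \<open>F\<close> is convex up to \<open>\<sigma>\<close>: at distance at most \<open>2 \<rho>\<close> from \<open>y\<close> the
  Hessian of \<open>f\<close> is at least \<open>-3 \<delta>\<close>, and further out the penalty alone compensates for \<open>-L\<close>. Hence every
  sub-epoch is a variance-reduced gradient descent on a \<open>\<sigma>\<close>-strongly convex function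
  \<open>F(x) + \<sigma> \<parallel>x - xhat\<parallel>\<^sup>2\<close>, and an epoch decreases \<open>f\<close> in expectation by a multiple of the squared distances
  of \<open>yhat\<close> to \<open>y\<close> and to the minimizer of \<open>F(x) + \<sigma> \<parallel>x - yhat\<parallel>\<^sup>2\<close>, up to an error of order
  \<open>p \<V> / (\<sigma> B)\<close> caused by the minibatch. If both distances are small, then the output of SGD3 lies in the
  ball, where \<open>F\<close> agrees with \<open>f\<close>. A second-order step decreases \<open>f\<close> in expectation by \<open>\<delta>\<^sup>3 / (12 L\<^sub>2\<^sup>2)\<close>. So
  \<open>f\<close> plus suitable bookkeeping terms is a supermartingale as long as Oja's algorithm answers correctly, which
  bounds both the number of second-order steps and the average of the squared distances.
\<close>

section \<open>The spaces \<open>euclid d\<close>\<close>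

text \<open>The obstacle is measurability. The success probability is an integral over the seeds of
  Oja's algorithm whose integrand need not be measurable, because nothing of the kind is known of
  \<open>hvp\<close> and \<open>sgd\<close>, and a lower integral is not additive. So the
  supermartingale argument does not run on the algorithm but on \<open>minor\<close>, a measurable
  function of the seeds that lies below the success probability for every fixed choice of seeds: the
  counter \<open>T\<close> is replaced by its worst-case bound, SGD3 by the lower bound 9/10 -
  \<open>Psi\<close> on its success, and a wrong answer of Oja's algorithm counts as failure. For
  \<open>minor\<close> the seed of a single iteration can be integrated out separately. This is why
  continuity of the proximal point is proved: it makes \<open>Psi\<close> measurable.

  \<open>Psi\<close> is quadratic in the distances because that is what an epoch controls, whereas
  the guarantee of SGD3 is linear; an arithmetic-geometric inequality connects the two. The budget
  is 1/10 for SGD3, 1/10 for Oja's algorithm and 7/100 for \<open>Phi\<close>, which leaves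
  73/100.\<close>

definition unit_vec :: "nat \<Rightarrow> rvec"
  where "unit_vec i = Abs_rvec (\<lambda>j. if j = i then 1 else 0)"

lemma coord_unit_vec: "coord (unit_vec i) j = (if j = i then 1 else 0)"
  by (simp add: unit_vec_def coord_Abs)

lemma inner_unit_vec: "x \<bullet> unit_vec i = coord x i"
  by (subst inner_commute, subst inner_rvec_superset[of "{i}"]) (auto simp: coord_unit_vec)

lemma unit_vec_euclid: "i < d \<Longrightarrow> unit_vec i \<in> euclid d"
  by (auto simp: euclid_def coord_unit_vec)

lemma norm_unit_vec [simp]: "norm (unit_vec i) = 1"
  by (simp add: norm_eq_sqrt_inner inner_unit_vec coord_unit_vec)

lemma coord_sum: "coord (\<Sum>i\<in>A. g i) j = (\<Sum>i\<in>A. coord (g i) j)"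
  by (induction A rule: infinite_finite_induct) auto

lemma euclid_expand:
  assumes "x \<in> euclid d" shows "x = (\<Sum>i<d. coord x i *\<^sub>R unit_vec i)"
  using assms by (intro rvec_eqI) (auto simp: coord_sum coord_unit_vec euclid_def if_distrib cong: if_cong)

lemma euclid_0 [simp]: "0 \<in> euclid d"
  and euclid_add [intro]: "x \<in> euclid d \<Longrightarrow> y \<in> euclid d \<Longrightarrow> x + y \<in> euclid d"
  and euclid_diff [intro]: "x \<in> euclid d \<Longrightarrow> y \<in> euclid d \<Longrightarrow> x - y \<in> euclid d"
  and euclid_minus [intro]: "x \<in> euclid d \<Longrightarrow> - x \<in> euclid d"
  and euclid_scaleR [intro]: "x \<in> euclid d \<Longrightarrow> r *\<^sub>R x \<in> euclid d"
  and euclid_sum [intro]: "(\<And>i. i \<in> A \<Longrightarrow> g i \<in> euclid d) \<Longrightarrow> sum g A \<in> euclid d"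
  using subspace_euclid[of d]
  by (auto intro: subspace_0 subspace_add subspace_diff subspace_neg subspace_scale subspace_sum)

lemma continuous_coord: "continuous_on A (\<lambda>x. coord x i)"
  unfolding inner_unit_vec[symmetric] by (intro continuous_intros)

lemma closed_euclid: "closed (euclid d)"
proof -
  have "euclid d = (\<Inter>i\<in>{d..}. (\<lambda>x. coord x i) -` {0})"
    by (auto simp: euclid_def)
  moreover have "closed ((\<lambda>x. coord x i) -` {0})" for i
    using continuous_coord[of UNIV i] by (intro closed_vimage) auto
  ultimately show ?thesis by auto
qed

lemma convex_euclid: "convex (euclid d)"
  using subspace_euclid by (rule subspace_imp_convex)

lemma coord_le_norm: "\<bar>coord x i\<bar> \<le> norm x"
  using Cauchy_Schwarz_ineq2[of x "unit_vec i"] by (simp add: inner_unit_vec)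

text \<open>\<open>rvec\<close> is infinite-dimensional, so closedness and boundedness alone do not
  give compactness. The set is a closed part of the image of a cube under the continuous map
  \<open>\<phi>\<close>, which reads only d coordinates, and the cube is compact by
  Tychonoff.\<close>

lemma compact_cball_euclid: "compact (cball a r \<inter> euclid d)"
proof -
  define R where "R = norm a + \<bar>r\<bar>"
  define \<phi> :: "(nat \<Rightarrow> real) \<Rightarrow> rvec" where "\<phi> g = (\<Sum>i<d. g i *\<^sub>R unit_vec i)" for g
  define K :: "(nat \<Rightarrow> real) set" where "K = PiE UNIV (\<lambda>i. {-R..R})"
  have "compact K"
    unfolding K_def compactin_euclidean_iff[symmetric] euclidean_product_topology[symmetric]
    by (subst compactin_PiE) auto
  moreover have "continuous_on K \<phi>"
    unfolding \<phi>_def by (intro continuous_intros continuous_on_subset[OF continuous_on_product_coordinates]) auto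
  ultimately have "compact (\<phi> ` K)" by (rule compact_continuous_image[rotated])
  moreover have "cball a r \<inter> euclid d \<subseteq> \<phi> ` K"
  proof
    fix x assume x: "x \<in> cball a r \<inter> euclid d"
    have "norm x \<le> norm a + norm (x - a)" by norm
    then have "norm x \<le> R" using x by (auto simp: R_def dist_norm norm_minus_commute)
    then have "coord x \<in> K" using coord_le_norm[of x]
      by (auto simp: K_def abs_le_iff) (smt (verit))+
    then show "x \<in> \<phi> ` K" using euclid_expand[of x d] x by (auto simp: \<phi>_def)
  qed
  moreover have "closed (cball a r \<inter> euclid d)" by (intro closed_Int closed_euclid) auto
  ultimately show ?thesis by (metis compact_Int_closed inf.absorb_iff2)
qed

text \<open>Finitely supported sequences with rational entries are dense, so balls of rational
  radius around them form a countable basis. Second countability makes sums and pairs of Borel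
  functions into \<open>rvec\<close> measurable.\<close>

instance rvec :: second_countable_topology
proof
  define q :: "rat list \<Rightarrow> rvec"
    where "q l = Abs_rvec (\<lambda>i. if i < length l then of_rat (l ! i) else 0)" for l
  have coord_q: "coord (q l) i = (if i < length l then of_rat (l ! i) else 0)" for l i
    unfolding q_def by (subst coord_Abs) (auto intro: finite_subset[of _ "{..<length l}"])
  have dense: "\<exists>l. dist x (q l) < e" if "0 < e" for x e
  proof -
    obtain d where d: "x \<in> euclid d"
    proof -
      obtain d where "\<forall>i\<in>{i. coord x i \<noteq> 0}. i < d"
        using finite_nat_set_iff_bounded[of "{i. coord x i \<noteq> 0}"] by auto
      then show ?thesis by (intro that[of d]) (auto simp: euclid_def not_less[symmetric])
    qed
    \<comment> \<open>The d coordinate errors add up to less than \<open>e\<close>; the summand 1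
      also covers d = 0.\<close>
    have "\<exists>a. \<bar>coord x i - of_rat a\<bar> < e / (d + 1)" for i
    proof -
      obtain a where "coord x i - e / (d + 1) < of_rat a" "of_rat a < coord x i"
        using of_rat_dense[of "coord x i - e / (d + 1)" "coord x i"] \<open>0 < e\<close> by auto
      then show ?thesis by (intro exI[of _ a]) auto
    qed
    then obtain a where a: "\<And>i. \<bar>coord x i - of_rat (a i)\<bar> < e / (d + 1)" by metis
    let ?l = "map a [0..<d]"
    have E: "x - q ?l \<in> euclid d"
      using d by (auto simp: euclid_def coord_q)
    have "norm (x - q ?l) \<le> (\<Sum>i<d. \<bar>coord (x - q ?l) i\<bar>)"
      unfolding norm_euclid[OF E] by (rule L2_set_le_sum_abs)
    also have "\<dots> \<le> (\<Sum>i<d. e / (d + 1))"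
      using a by (intro sum_mono) (auto simp: coord_q less_imp_le)
    also have "\<dots> < e" using \<open>0 < e\<close> by (simp add: field_simps)
    finally show ?thesis by (auto simp: dist_norm)
  qed
  define B where "B = (\<lambda>(l, r). ball (q l) (of_rat r)) ` (UNIV :: (rat list \<times> rat) set)"
  have "topological_basis B"
  proof (rule topological_basisI)
    fix O' :: "rvec set" and x assume "open O'" "x \<in> O'"
    then obtain e where e: "0 < e" "ball x e \<subseteq> O'" by (auto simp: open_contains_ball)
    obtain r where r: "0 < (of_rat r :: real)" "of_rat r < e / 2"
      using of_rat_dense[of 0 "e/2"] e by auto
    obtain l where l: "dist x (q l) < of_rat r" using dense[of "of_rat r" x] r by auto
    have "ball (q l) (of_rat r) \<subseteq> O'"
    proof
      fix z assume "z \<in> ball (q l) (of_rat r)"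
      then have "dist x z < e" using l r dist_triangle[of x z "q l"] by auto
      then show "z \<in> O'" using e by auto
    qed
    then show "\<exists>B'\<in>B. x \<in> B' \<and> B' \<subseteq> O'"
      using l by (intro bexI[of _ "ball (q l) (of_rat r)"]) (auto simp: B_def dist_commute)
  qed (auto simp: B_def)
  then have "open = generate_topology B" by (rule topological_basis_imp_subbasis)
  moreover have "countable B" unfolding B_def by (intro countable_image) auto
  ultimately show "\<exists>B :: rvec set set. countable B \<and> open = generate_topology B" by blast
qed

section \<open>Gradients\<close>

lemma inner_eqI_euclid:
  assumes "g \<in> euclid d" "g' \<in> euclid d" "\<And>h. h \<in> euclid d \<Longrightarrow> g \<bullet> h = g' \<bullet> h"
  shows "g = g'"
proof -
  have "(g - g') \<bullet> (g - g') = 0"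
    using assms(3)[of "g - g'"] assms(1,2) by (auto simp: inner_diff_left)
  then show ?thesis by simp
qed

text \<open>A derivative within \<open>euclid d\<close> is determined only in directions of
  \<open>euclid d\<close>. Along the line through \<open>x\<close> in direction \<open>h\<close> the
  claim becomes uniqueness of an ordinary derivative at 0.\<close>

lemma derivative_unique_euclid:
  fixes f :: "rvec \<Rightarrow> 'b::real_normed_vector"
  assumes f': "(f has_derivative f') (at x within euclid d)" and f'': "(f has_derivative f'') (at x within euclid d)"
    and x: "x \<in> euclid d" and h: "h \<in> euclid d"
  shows "f' h = f'' h"
proof -
  have line: "((\<lambda>t::real. x + t *\<^sub>R h) has_derivative (\<lambda>t. t *\<^sub>R h)) (at 0)"
    by (auto intro!: derivative_eq_intros)
  have im: "range (\<lambda>t::real. x + t *\<^sub>R h) \<subseteq> euclid d" using x h by auto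
  have "((\<lambda>t. f (x + t *\<^sub>R h)) has_derivative (\<lambda>t. g (t *\<^sub>R h))) (at 0)"
    if "(f has_derivative g) (at x within euclid d)" for g
    using has_derivative_in_compose[OF line, of f g] has_derivative_subset[OF that im] by (simp add: o_def)
  from has_derivative_unique[OF this[OF f'] this[OF f'']]
  have "f' (1 *\<^sub>R h) = f'' (1 *\<^sub>R h)" by (rule fun_cong)
  then show ?thesis by simp
qed

lemma gradient_eqI:
  assumes "x \<in> euclid d" "g \<in> euclid d" "(f has_derivative (\<lambda>h. g \<bullet> h)) (at x within euclid d)"
  shows "gradient d f x = g"
  unfolding gradient_def
proof (rule the_equality)
  fix g' assume "g' \<in> euclid d \<and> (f has_derivative (\<bullet>) g') (at x within euclid d)"
  then show "g' = g" using assms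
    by (intro inner_eqI_euclid[of g' d g]) (auto dest: derivative_unique_euclid[of f "(\<bullet>) g'" x d "(\<bullet>) g"])
qed (use assms in auto)

text \<open>Riesz representation in coordinates. The derivative and the inner product with
  \<open>g\<close> agree only on \<open>euclid d\<close>, which is enough because the limit within
  \<open>euclid d\<close> sees no other increments.\<close>

lemma differentiable_imp_gradient:
  assumes "f differentiable (at x within euclid d)" "x \<in> euclid d"
  shows "gradient d f x \<in> euclid d \<and> (f has_derivative (\<lambda>h. gradient d f x \<bullet> h)) (at x within euclid d)"
proof -
  obtain f' where f': "(f has_derivative f') (at x within euclid d)"
    using assms by (auto simp: differentiable_def)
  then interpret bounded_linear f' by (rule has_derivative_bounded_linear)
  define g where "g = (\<Sum>i<d. f' (unit_vec i) *\<^sub>R unit_vec i)"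
  have g: "g \<in> euclid d" unfolding g_def by (intro euclid_sum euclid_scaleR unit_vec_euclid) auto
  have eq: "f' h = g \<bullet> h" if "h \<in> euclid d" for h
  proof -
    have "f' h = f' (\<Sum>i<d. coord h i *\<^sub>R unit_vec i)" using euclid_expand[OF that] by simp
    also have "\<dots> = (\<Sum>i<d. coord h i * f' (unit_vec i))" by (simp add: sum scaleR)
    also have "\<dots> = g \<bullet> h"
      unfolding g_def inner_sum_left
      by (intro sum.cong refl) (simp add: inner_unit_vec inner_commute[of "unit_vec _"])
    finally show ?thesis .
  qed
  have "(f has_derivative (\<lambda>h. g \<bullet> h)) (at x within euclid d)"
    unfolding has_derivative_within'
  proof (intro conjI allI impI)
    show "bounded_linear ((\<bullet>) g)" by (rule bounded_linear_inner_right)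
    fix e :: real assume "0 < e"
    then obtain \<delta> where \<delta>: "0 < \<delta>" "\<And>x'. x' \<in> euclid d \<Longrightarrow> 0 < norm (x' - x) \<Longrightarrow> norm (x' - x) < \<delta> \<Longrightarrow>
         norm (f x' - f x - f' (x' - x)) / norm (x' - x) < e"
      using f' unfolding has_derivative_within' by meson
    then show "\<exists>da>0. \<forall>x'\<in>euclid d. 0 < norm (x' - x) \<and> norm (x' - x) < da \<longrightarrow>
         norm (f x' - f x - g \<bullet> (x' - x)) / norm (x' - x) < e"
      using eq assms(2) by (intro exI[of _ \<delta>]) (auto simp: euclid_diff)
  qed
  then show ?thesis using g gradient_eqI[OF assms(2) g] by auto
qed

lemma gradient_euclid:
  "f differentiable (at x within euclid d) \<Longrightarrow> x \<in> euclid d \<Longrightarrow> gradient d f x \<in> euclid d"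
  using differentiable_imp_gradient by blast

lemma has_derivative_gradient:
  "f differentiable (at x within euclid d) \<Longrightarrow> x \<in> euclid d \<Longrightarrow>
    (f has_derivative (\<lambda>h. gradient d f x \<bullet> h)) (at x within euclid d)"
  using differentiable_imp_gradient by blast

lemma has_derivative_on_line:
  assumes "(f has_derivative f') (at (x + t *\<^sub>R w) within euclid d)" "x \<in> euclid d" "w \<in> euclid d"
  shows "((\<lambda>t. f (x + t *\<^sub>R w)) has_derivative (\<lambda>s. f' (s *\<^sub>R w))) (at t)"
proof -
  have line: "((\<lambda>t::real. x + t *\<^sub>R w) has_derivative (\<lambda>t. t *\<^sub>R w)) (at t)"
    by (auto intro!: derivative_eq_intros)
  have "range (\<lambda>t::real. x + t *\<^sub>R w) \<subseteq> euclid d" using assms by auto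
  then show ?thesis
    using has_derivative_in_compose[OF line, of f f'] has_derivative_subset[OF assms(1)] by (simp add: o_def)
qed

lemma has_field_derivative_on_line:
  assumes "f differentiable (at (x + t *\<^sub>R w) within euclid d)" "x \<in> euclid d" "w \<in> euclid d"
  shows "((\<lambda>t. f (x + t *\<^sub>R w)) has_real_derivative gradient d f (x + t *\<^sub>R w) \<bullet> w) (at t)"
proof -
  have "x + t *\<^sub>R w \<in> euclid d" using assms by auto
  from has_derivative_on_line[OF has_derivative_gradient[OF assms(1) this] assms(2,3)]
  show ?thesis by (simp add: has_field_derivative_def mult.commute[of _ "gradient d f (x + t *\<^sub>R w) \<bullet> w"])
qed

lemma gradient_add:
  assumes "f differentiable (at x within euclid d)" "g differentiable (at x within euclid d)" "x \<in> euclid d"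
  shows "gradient d (\<lambda>x. f x + g x) x = gradient d f x + gradient d g x"
  using assms by (intro gradient_eqI)
    (auto intro!: gradient_euclid derivative_eq_intros has_derivative_gradient simp: inner_add_left)

lemma has_derivative_sq_dist:
  "((\<lambda>x::rvec. s * (norm (x - c))\<^sup>2) has_derivative (\<lambda>h. ((2 * s) *\<^sub>R (x - c)) \<bullet> h)) (at x within A)"
  unfolding power2_norm_eq_inner
  by (auto intro!: derivative_eq_intros simp: inner_commute algebra_simps)

lemma sq_dist_differentiable: "(\<lambda>x::rvec. s * (norm (x - c))\<^sup>2) differentiable (at x within A)"
  unfolding differentiable_def using has_derivative_sq_dist by blast

lemma gradient_sq_dist:
  "x \<in> euclid d \<Longrightarrow> c \<in> euclid d \<Longrightarrow> gradient d (\<lambda>x. s * (norm (x - c))\<^sup>2) x = (2 * s) *\<^sub>R (x - c)"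
  by (intro gradient_eqI has_derivative_sq_dist euclid_scaleR euclid_diff)

lemma average_differentiable:
  assumes "\<And>i. i \<in> {1..n} \<Longrightarrow> F i differentiable (at x within euclid d)"
  shows "average n F differentiable (at x within euclid d)"
  unfolding average_def[abs_def] divide_inverse
  using assms by (intro differentiable_mult differentiable_sum differentiable_const) auto

lemma gradient_average:
  assumes "\<And>i. i \<in> {1..n} \<Longrightarrow> F i differentiable (at x within euclid d)" "x \<in> euclid d"
  shows "gradient d (average n F) x = (1 / real n) *\<^sub>R (\<Sum>i=1..n. gradient d (F i) x)"
proof (rule gradient_eqI)
  have "(average n F has_derivative (\<lambda>h. (\<Sum>i=1..n. gradient d (F i) x \<bullet> h) / real n)) (at x within euclid d)"
    unfolding average_def[abs_def] divide_inverse
    using assms by (auto intro!: derivative_eq_intros has_derivative_gradient)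
  then show "(average n F has_derivative (\<bullet>) ((1 / real n) *\<^sub>R (\<Sum>i = 1..n. gradient d (F i) x))) (at x within euclid d)"
    by (rule has_derivative_eq_rhs) (simp add: fun_eq_iff inner_sum_left)
qed (use assms in \<open>auto intro!: gradient_euclid euclid_scaleR euclid_sum\<close>)

section \<open>Weakly convex functions\<close>

text \<open>\<open>weak_mono\<close> is the first-order form of convexity of F + s/2 |x|^2. It is
  stated for gradients because the penalized functions, to which it will be applied, need not have a
  second derivative on the sphere where the penalty sets in.\<close>

locale weakly_convex =
  fixes d :: nat and F :: "rvec \<Rightarrow> real" and M s :: real
  assumes diff: "\<And>x. x \<in> euclid d \<Longrightarrow> F differentiable (at x within euclid d)"
    and smooth: "smooth d M F"
    and M_nonneg: "0 \<le> M"
    and s_pos: "0 < s"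
    and weak_mono: "\<And>x y. x \<in> euclid d \<Longrightarrow> y \<in> euclid d \<Longrightarrow>
      - s * (norm (x - y))\<^sup>2 \<le> (gradient d F x - gradient d F y) \<bullet> (x - y)"
begin

abbreviation "grad \<equiv> gradient d F"

lemma grad_euclid [intro]: "x \<in> euclid d \<Longrightarrow> grad x \<in> euclid d"
  using diff gradient_euclid by blast

lemma grad_lipschitz: "x \<in> euclid d \<Longrightarrow> y \<in> euclid d \<Longrightarrow> norm (grad x - grad y) \<le> M * norm (x - y)"
  using smooth by (auto simp: smooth_def)

lemma continuous: "continuous_on (euclid d) F"
  using diff by (intro differentiable_imp_continuous_on) (auto simp: differentiable_on_def)

text \<open>The mean value theorem for F (x + t (y - x)) - c t^2. With \<open>c\<close> equal to the
  quadratic term of a model, a gradient bound that is linear in t yields the sharp factor 1/2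
  without integration.\<close>

lemma mvt_line:
  assumes "x \<in> euclid d" "y \<in> euclid d"
  obtains t where "0 < t" "t < 1" "F y - F x - c = grad (x + t *\<^sub>R (y - x)) \<bullet> (y - x) - 2 * t * c"
proof -
  let ?w = "y - x"
  have "\<exists>t>0. t < 1 \<and>
      (F (x + 1 *\<^sub>R ?w) - c * 1\<^sup>2) - (F (x + 0 *\<^sub>R ?w) - c * 0\<^sup>2)
        = (1 - 0) * (grad (x + t *\<^sub>R ?w) \<bullet> ?w - 2 * t * c)"
    using assms
    by (intro MVT2) (auto intro!: derivative_eq_intros has_field_derivative_on_line diff)
  then show ?thesis using that by auto
qed

lemma lower_model:
  assumes x: "x \<in> euclid d" and y: "y \<in> euclid d"
  shows "F x + grad x \<bullet> (y - x) - s / 2 * (norm (y - x))\<^sup>2 \<le> F y"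
proof -
  obtain t where t: "0 < t" "t < 1"
    "F y - F x - (- s / 2 * (norm (y - x))\<^sup>2) =
      grad (x + t *\<^sub>R (y - x)) \<bullet> (y - x) - 2 * t * (- s / 2 * (norm (y - x))\<^sup>2)"
    using mvt_line[OF x y] by metis
  have "- s * (norm (t *\<^sub>R (y - x)))\<^sup>2 \<le> (grad (x + t *\<^sub>R (y - x)) - grad x) \<bullet> (t *\<^sub>R (y - x))"
    using weak_mono[of "x + t *\<^sub>R (y - x)" x] x y by auto
  then have "t * (- s * t * (norm (y - x))\<^sup>2) \<le> t * ((grad (x + t *\<^sub>R (y - x)) - grad x) \<bullet> (y - x))"
    using t by (simp add: power_mult_distrib power2_eq_square mult.assoc mult.left_commute)
  then have "- s * t * (norm (y - x))\<^sup>2 \<le> (grad (x + t *\<^sub>R (y - x)) - grad x) \<bullet> (y - x)"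
    by (rule mult_left_le_imp_le) (use t in simp)
  then show ?thesis using t(3) by (simp add: inner_diff_left algebra_simps)
qed

lemma upper_model:
  assumes x: "x \<in> euclid d" and y: "y \<in> euclid d"
  shows "F y \<le> F x + grad x \<bullet> (y - x) + M / 2 * (norm (y - x))\<^sup>2"
proof -
  obtain t where t: "0 < t" "t < 1"
    "F y - F x - (M / 2 * (norm (y - x))\<^sup>2) =
      grad (x + t *\<^sub>R (y - x)) \<bullet> (y - x) - 2 * t * (M / 2 * (norm (y - x))\<^sup>2)"
    using mvt_line[OF x y] by metis
  have "(grad (x + t *\<^sub>R (y - x)) - grad x) \<bullet> (y - x)
      \<le> norm (grad (x + t *\<^sub>R (y - x)) - grad x) * norm (y - x)"
    by (rule norm_cauchy_schwarz)
  also have "\<dots> \<le> (M * norm (t *\<^sub>R (y - x))) * norm (y - x)"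
    using grad_lipschitz[of "x + t *\<^sub>R (y - x)" x] x y by (intro mult_right_mono) auto
  also have "\<dots> = t * M * (norm (y - x))\<^sup>2" using t by (simp add: power2_eq_square)
  finally show ?thesis using t(3) by (simp add: inner_diff_left algebra_simps)
qed

section \<open>Strongly convex regularization and the proximal map\<close>

definition reg :: "rvec \<Rightarrow> rvec \<Rightarrow> real"
  where "reg c x = F x + s * (norm (x - c))\<^sup>2"

abbreviation "rgrad c x \<equiv> grad x + (2 * s) *\<^sub>R (x - c)"

lemma gradient_reg:
  assumes "x \<in> euclid d" "c \<in> euclid d"
  shows "gradient d (reg c) x = rgrad c x"
  unfolding reg_def[abs_def] using assms
  by (subst gradient_add) (auto simp: gradient_sq_dist intro: diff sq_dist_differentiable)

lemma rgrad_euclid [intro]: "x \<in> euclid d \<Longrightarrow> c \<in> euclid d \<Longrightarrow> rgrad c x \<in> euclid d"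
  by auto

lemma sq_dist_expand:
  "(norm (y - c))\<^sup>2 = (norm (x - c))\<^sup>2 + 2 * ((x - c) \<bullet> (y - x)) + (norm (y - x :: rvec))\<^sup>2"
  by (simp add: power2_norm_eq_inner inner_diff_left inner_diff_right inner_commute algebra_simps)

text \<open>The added term has modulus 2 s: one s cancels the weak convexity of \<open>F\<close>,
  the other remains as strong convexity.\<close>

lemma reg_lower:
  assumes "x \<in> euclid d" "y \<in> euclid d"
  shows "reg c x + rgrad c x \<bullet> (y - x) + s / 2 * (norm (y - x))\<^sup>2 \<le> reg c y"
  unfolding reg_def sq_dist_expand[of y c x] using lower_model[OF assms]
  by (simp add: inner_add_left algebra_simps)

lemma reg_upper:
  assumes "x \<in> euclid d" "y \<in> euclid d"
  shows "reg c y \<le> reg c x + rgrad c x \<bullet> (y - x) + (M + 2 * s) / 2 * (norm (y - x))\<^sup>2"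
  unfolding reg_def sq_dist_expand[of y c x] using upper_model[OF assms]
  by (simp add: inner_add_left algebra_simps add_divide_distrib)

lemma rgrad_lipschitz:
  assumes "x \<in> euclid d" "y \<in> euclid d"
  shows "norm (rgrad c x - rgrad c y) \<le> (M + 2 * s) * norm (x - y)"
proof -
  have "norm (rgrad c x - rgrad c y) = norm ((grad x - grad y) + (2 * s) *\<^sub>R (x - y))"
    by (simp add: algebra_simps)
  also have "\<dots> \<le> norm (grad x - grad y) + norm ((2 * s) *\<^sub>R (x - y))" by (rule norm_triangle_ineq)
  finally show ?thesis using grad_lipschitz[OF assms] s_pos by (simp add: distrib_right)
qed

lemma smooth_reg: "c \<in> euclid d \<Longrightarrow> Defs.smooth d (M + 2 * s) (reg c)"
  unfolding smooth_def by (auto simp: gradient_reg intro: rgrad_lipschitz)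

lemma rgrad_strong_mono:
  assumes "x \<in> euclid d" "y \<in> euclid d"
  shows "s * (norm (x - y))\<^sup>2 \<le> (rgrad c x - rgrad c y) \<bullet> (x - y)"
  using weak_mono[OF assms]
  by (simp add: power2_norm_eq_inner inner_diff_left inner_diff_right inner_add_left algebra_simps)

text \<open>Convexity follows from supporting hyperplanes: in the weighted sum of the two lower
  bounds at the intermediate point \<open>z\<close> the linear terms cancel.\<close>

lemma strongly_convex_reg: "strongly_convex d s (reg c)"
proof -
  let ?h = "\<lambda>x. reg c x - s / 2 * (norm x)\<^sup>2"
  have lower: "?h z + (rgrad c z - s *\<^sub>R z) \<bullet> (x - z) \<le> ?h x"
    if "z \<in> euclid d" "x \<in> euclid d" for x z
    using reg_lower[OF that, of c]
    by (simp add: power2_norm_eq_inner inner_diff_left inner_diff_right inner_add_left inner_commute algebra_simps)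
  have "convex_on (euclid d) ?h"
  proof (rule convex_onI[OF _ convex_euclid])
    fix t :: real and x y assume t: "0 < t" "t < 1" and xy: "x \<in> euclid d" "y \<in> euclid d"
    define z where "z = (1 - t) *\<^sub>R x + t *\<^sub>R y"
    have z: "z \<in> euclid d" using xy by (auto simp: z_def)
    let ?g = "rgrad c z - s *\<^sub>R z"
    have convex_comb: "(1 - t) * (a + b) + t * (a + b') = a + ((1 - t) * b + t * b')" for a b b' :: real
      by (simp add: algebra_simps)
    have "(1 - t) * (?h z + ?g \<bullet> (x - z)) + t * (?h z + ?g \<bullet> (y - z)) \<le> (1 - t) * ?h x + t * ?h y"
      using lower[OF z xy(1)] lower[OF z xy(2)] t by (intro add_mono mult_left_mono) auto
    moreover have "(1 - t) * (?g \<bullet> (x - z)) + t * (?g \<bullet> (y - z)) = 0"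
    proof -
      have "(1 - t) *\<^sub>R (x - z) + t *\<^sub>R (y - z) = 0" by (simp add: z_def algebra_simps)
      then have "?g \<bullet> ((1 - t) *\<^sub>R (x - z) + t *\<^sub>R (y - z)) = 0" by simp
      then show ?thesis by (simp only: inner_add_right inner_scaleR_right)
    qed
    moreover have "(1 - t) * (?h z + ?g \<bullet> (x - z)) + t * (?h z + ?g \<bullet> (y - z))
      = ?h z + ((1 - t) * (?g \<bullet> (x - z)) + t * (?g \<bullet> (y - z)))"
      by (rule convex_comb)
    ultimately show "?h ((1 - t) *\<^sub>R x + t *\<^sub>R y) \<le> (1 - t) * ?h x + t * ?h y"
      unfolding z_def by linarith
  qed
  then show ?thesis by (simp add: strongly_convex_def)
qed

lemma ex_reg_minimizer:
  assumes c: "c \<in> euclid d"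
  shows "\<exists>z\<in>euclid d. \<forall>x\<in>euclid d. reg c z \<le> reg c x"
proof -
  \<comment> \<open>Beyond this radius the quadratic term of \<open>reg_lower\<close> at
    \<open>c\<close> outweighs the linear one, so no point there lies below
    \<open>c\<close>.\<close>
  define r where "r = 2 * norm (rgrad c c) / s"
  have cont: "continuous_on (cball c r \<inter> euclid d) (reg c)"
    unfolding reg_def[abs_def]
    by (intro continuous_intros continuous_on_subset[OF continuous]) auto
  have "r \<ge> 0" using s_pos by (simp add: r_def)
  then have "c \<in> cball c r \<inter> euclid d" using c by simp
  then have "cball c r \<inter> euclid d \<noteq> {}" by blast
  then obtain z where z: "z \<in> cball c r \<inter> euclid d" "\<And>x. x \<in> cball c r \<inter> euclid d \<Longrightarrow> reg c z \<le> reg c x"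
    using continuous_attains_inf[OF compact_cball_euclid _ cont] by blast
  have "reg c z \<le> reg c x" if x: "x \<in> euclid d" for x
  proof (cases "x \<in> cball c r")
    case False
    then have *: "r < norm (x - c)" by (simp add: dist_norm norm_minus_commute)
    have "- (rgrad c c \<bullet> (x - c)) \<le> norm (rgrad c c) * norm (x - c)"
      using norm_cauchy_schwarz[of "- rgrad c c" "x - c"] by simp
    also have "\<dots> = s / 2 * r * norm (x - c)" using s_pos by (simp add: r_def)
    also have "\<dots> \<le> s / 2 * norm (x - c) * norm (x - c)"
      using * s_pos by (intro mult_right_mono mult_left_mono) auto
    finally have "reg c c \<le> reg c x" using reg_lower[OF c x, of c] by (simp add: power2_eq_square)
    moreover have "reg c z \<le> reg c c" using z(2)[of c] c \<open>r \<ge> 0\<close> by auto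
    ultimately show ?thesis by simp
  qed (use z x in auto)
  then show ?thesis using z by auto
qed

text \<open>The proximal map of \<open>F\<close> with parameter 1 / (2 s), single-valued by strong
  convexity. Its fixed points are the stationary points of \<open>F\<close>, so the distance of
  \<open>c\<close> to its image measures stationarity.\<close>

definition prox :: "rvec \<Rightarrow> rvec"
  where "prox c = (SOME z. z \<in> euclid d \<and> (\<forall>x\<in>euclid d. reg c z \<le> reg c x))"

lemma
  assumes "c \<in> euclid d"
  shows prox_euclid [intro]: "prox c \<in> euclid d"
    and prox_le: "\<And>x. x \<in> euclid d \<Longrightarrow> reg c (prox c) \<le> reg c x"
  using someI_ex[of "\<lambda>z. z \<in> euclid d \<and> (\<forall>x\<in>euclid d. reg c z \<le> reg c x)"] ex_reg_minimizer[OF assms]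
  by (auto simp: prox_def)

text \<open>A gradient step of length 1 / \<open>K\<close> decreases the function by at least |g|^2
  / (2 K), and it cannot pass below the minimum.\<close>

lemma rgrad_sq_le:
  assumes x: "x \<in> euclid d" and c: "c \<in> euclid d"
  shows "(norm (rgrad c x))\<^sup>2 \<le> 2 * (M + 2 * s) * (reg c x - reg c (prox c))"
proof -
  define K where "K = M + 2 * s"
  have K: "K > 0" using M_nonneg s_pos by (simp add: K_def)
  define g where "g = rgrad c x"
  let ?y = "x - (1 / K) *\<^sub>R g"
  have y: "?y \<in> euclid d" using x c by (auto simp: g_def)
  have "reg c (prox c) \<le> reg c ?y" by (rule prox_le[OF c y])
  also have "\<dots> \<le> reg c x + g \<bullet> (?y - x) + K / 2 * (norm (?y - x))\<^sup>2"
    unfolding K_def g_def by (rule reg_upper[OF x y[unfolded K_def g_def]])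
  also have "\<dots> = reg c x - (norm g)\<^sup>2 / (2 * K)"
    using K by (simp add: power_mult_distrib power2_norm_eq_inner[symmetric] power2_eq_square field_simps)
  finally show ?thesis unfolding K_def[symmetric] g_def[symmetric] using K by (simp add: field_simps)
qed

lemma rgrad_prox: "c \<in> euclid d \<Longrightarrow> rgrad c (prox c) = 0"
  using rgrad_sq_le[of "prox c" c] by auto

lemma reg_prox_growth:
  assumes "c \<in> euclid d" "x \<in> euclid d"
  shows "reg c (prox c) + s / 2 * (norm (x - prox c))\<^sup>2 \<le> reg c x"
  using reg_lower[of "prox c" x c] assms by (simp add: rgrad_prox prox_euclid)

lemma norm_prox_diff_le:
  assumes "c \<in> euclid d" "x \<in> euclid d"
  shows "s * norm (x - prox c) \<le> norm (rgrad c x)"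
proof (cases "x = prox c")
  case False
  have "s * (norm (x - prox c))\<^sup>2 \<le> rgrad c x \<bullet> (x - prox c)"
    using rgrad_strong_mono[of x "prox c" c] assms by (simp add: rgrad_prox prox_euclid)
  also have "\<dots> \<le> norm (rgrad c x) * norm (x - prox c)" by (rule norm_cauchy_schwarz)
  finally have "(s * norm (x - prox c)) * norm (x - prox c) \<le> norm (rgrad c x) * norm (x - prox c)"
    by (simp add: power2_eq_square mult.assoc)
  then show ?thesis using False by (subst (asm) mult_le_cancel_right) auto
qed auto

end

text \<open>The proximal point of \<open>F\<close> is tested in the optimality condition of
  \<open>G\<close>: the residual is the difference of the gradients plus the shift of the center,
  and strong monotonicity turns it into a distance. This later gives continuity of the proximal
  point in the center of the penalty.\<close>

lemma prox_perturbation: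
  assumes F: "weakly_convex d F M s" and G: "weakly_convex d G M s"
    and c: "c \<in> euclid d" and c': "c' \<in> euclid d"
    and near: "\<And>x. x \<in> euclid d \<Longrightarrow> norm (gradient d G x - gradient d F x) \<le> e"
  shows "s * norm (weakly_convex.prox d F s c - weakly_convex.prox d G s c') \<le> e + 2 * s * norm (c - c')"
proof -
  interpret F: weakly_convex d F M s by fact
  interpret G: weakly_convex d G M s by fact
  let ?z = "F.prox c"
  have z: "?z \<in> euclid d" using c by auto
  have "s * norm (?z - G.prox c') \<le> norm (G.rgrad c' ?z - F.rgrad c ?z)"
    using G.norm_prox_diff_le[OF c' z] F.rgrad_prox[OF c] by simp
  also have "G.rgrad c' ?z - F.rgrad c ?z = (gradient d G ?z - gradient d F ?z) + (2 * s) *\<^sub>R (c - c')"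
    by (simp add: algebra_simps)
  also have "norm \<dots> \<le> norm (gradient d G ?z - gradient d F ?z) + norm ((2 * s) *\<^sub>R (c - c'))"
    by (rule norm_triangle_ineq)
  finally show ?thesis using near[OF z] F.s_pos by simp
qed

section \<open>The distance penalty\<close>

text \<open>For nonnegative \<open>r\<close> this is the metric projection onto the closed ball of
  radius \<open>r\<close> around 0, and \<open>u - clip r u\<close> is half the gradient of the
  squared distance to that ball.\<close>

definition clip :: "real \<Rightarrow> 'a::real_inner \<Rightarrow> 'a"
  where "clip r u = (if norm u \<le> r then u else (r / norm u) *\<^sub>R u)"

lemma clip_euclid [intro]: "u \<in> euclid d \<Longrightarrow> clip r u \<in> euclid d"
  by (auto simp: clip_def)

lemma norm_clip_le: "0 \<le> r \<Longrightarrow> norm (clip r u) \<le> r"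
  by (auto simp: clip_def)

text \<open>The variational inequality of the projection. Outside the ball
  \<open>u - clip r u\<close> is a nonnegative multiple of \<open>u\<close>, and Cauchy-Schwarz
  bounds the inner product of \<open>u\<close> and \<open>q\<close> by its value at
  \<open>clip r u\<close>.\<close>

lemma clip_obtuse:
  assumes "0 \<le> r" "norm q \<le> r"
  shows "0 \<le> (u - clip r u) \<bullet> (clip r u - q)"
proof (cases "norm u \<le> r")
  case False
  then have u: "0 < norm u" using assms by linarith
  have "u \<bullet> q \<le> norm u * norm q" by (rule norm_cauchy_schwarz)
  also have "\<dots> \<le> norm u * r" using assms by (intro mult_left_mono) auto
  finally have "0 \<le> u \<bullet> (clip r u - q)"
    using False u by (simp add: clip_def inner_diff_right power2_norm_eq_inner[symmetric] power2_eq_square mult.commute)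
  moreover have "u - clip r u = (1 - r / norm u) *\<^sub>R u"
    using False by (simp add: clip_def algebra_simps)
  moreover have "0 \<le> 1 - r / norm u" using False u by (simp add: field_simps)
  ultimately show ?thesis by simp
qed (simp add: clip_def)

lemma norm_diff_clip: "0 \<le> r \<Longrightarrow> norm (u - clip r u) = max 0 (norm u - r)"
proof (cases "norm u \<le> r")
  case False
  assume "0 \<le> r"
  then have u: "0 < norm u" using False by linarith
  have "u - clip r u = (1 - r / norm u) *\<^sub>R u"
    using False by (simp add: clip_def algebra_simps)
  moreover have "0 \<le> 1 - r / norm u" using False u by (simp add: field_simps)
  ultimately have "norm (u - clip r u) = (1 - r / norm u) * norm u" by simp
  then show ?thesis using False u by (simp add: left_diff_distrib)
qed (simp add: clip_def)

lemma clip_firm: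
  assumes "0 \<le> r"
  shows "0 \<le> ((u - clip r u) - (v - clip r v)) \<bullet> (clip r u - clip r v)"
proof -
  have "0 \<le> (u - clip r u) \<bullet> (clip r u - clip r v)" "0 \<le> (v - clip r v) \<bullet> (clip r v - clip r u)"
    using assms by (intro clip_obtuse norm_clip_le; simp)+
  then show ?thesis by (simp add: inner_diff_left inner_diff_right)
qed

lemma
  assumes "0 \<le> r"
  shows clip_inner_le: "(clip r u - clip r v) \<bullet> (u - v) \<le> (norm (u - v))\<^sup>2"
    and clip_residual_nonexpansive: "norm ((u - clip r u) - (v - clip r v)) \<le> norm (u - v)"
    and clip_residual_mono: "0 \<le> ((u - clip r u) - (v - clip r v)) \<bullet> (u - v)"
proof -
  define a where "a = u - v"
  define b where "b = clip r u - clip r v"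
  have eq: "(u - clip r u) - (v - clip r v) = a - b" by (simp add: a_def b_def)
  have firm: "0 \<le> (a - b) \<bullet> b" using clip_firm[OF assms, of u v] by (simp add: eq b_def)
  have split: "(a - b) \<bullet> a = (a - b) \<bullet> (a - b) + (a - b) \<bullet> b" by (simp add: inner_diff_right)
  show mono: "0 \<le> ((u - clip r u) - (v - clip r v)) \<bullet> (u - v)"
    unfolding eq a_def[symmetric] using firm split by simp
  then show "(clip r u - clip r v) \<bullet> (u - v) \<le> (norm (u - v))\<^sup>2"
    unfolding eq a_def[symmetric] b_def[symmetric] by (simp add: inner_diff_left power2_norm_eq_inner)
  have "(norm (a - b))\<^sup>2 \<le> (a - b) \<bullet> a" using firm split by (simp add: power2_norm_eq_inner)
  also have "\<dots> \<le> norm (a - b) * norm a" by (rule norm_cauchy_schwarz)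
  finally show "norm ((u - clip r u) - (v - clip r v)) \<le> norm (u - v)"
    unfolding eq a_def[symmetric] by (cases "a = b") (auto simp: power2_eq_square)
qed

lemma sq_dist_ball_lower:
  assumes "0 \<le> r"
  shows "(max 0 (norm u - r))\<^sup>2 + 2 * ((u - clip r u) \<bullet> (v - u)) \<le> (max 0 (norm v - r))\<^sup>2"
proof -
  define a where "a = u - clip r u"
  define b where "b = v - clip r v"
  have "0 \<le> a \<bullet> (clip r u - clip r v)"
    unfolding a_def using assms by (intro clip_obtuse norm_clip_le)
  moreover have "b - a = (v - u) + (clip r u - clip r v)" by (simp add: a_def b_def)
  ultimately have "a \<bullet> (v - u) \<le> a \<bullet> (b - a)" by (simp only: inner_add_right)
  moreover have "(norm b)\<^sup>2 = (norm a)\<^sup>2 + 2 * (a \<bullet> (b - a)) + (norm (b - a))\<^sup>2"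
    by (simp add: power2_norm_eq_inner inner_diff_left inner_diff_right inner_commute)
  ultimately have "(norm a)\<^sup>2 + 2 * (a \<bullet> (v - u)) \<le> (norm b)\<^sup>2"
    using zero_le_power2[of "norm (b - a)"] by linarith
  then show ?thesis unfolding a_def b_def using assms by (simp add: norm_diff_clip)
qed

text \<open>The distance of \<open>v\<close> to the ball is at most its distance to the fixed point
  \<open>clip r u\<close> of the ball. Together with \<open>sq_dist_ball_lower\<close> this encloses
  the squared distance up to a quadratic error, which gives its derivative on the sphere as
  well.\<close>

lemma sq_dist_ball_upper:
  assumes "0 \<le> r"
  shows "(max 0 (norm v - r))\<^sup>2 \<le>
    (max 0 (norm u - r))\<^sup>2 + 2 * ((u - clip r u) \<bullet> (v - u)) + (norm (v - u))\<^sup>2"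
proof -
  have "norm v \<le> norm (v - clip r u) + norm (clip r u)"
    using norm_triangle_ineq[of "v - clip r u" "clip r u"] by simp
  then have "max 0 (norm v - r) \<le> norm (v - clip r u)"
    using norm_clip_le[OF assms, of u] by simp
  then have "(max 0 (norm v - r))\<^sup>2 \<le> (norm (v - clip r u))\<^sup>2" by (intro power_mono) auto
  also have "v - clip r u = (u - clip r u) + (v - u)" by simp
  also have "(norm \<dots>)\<^sup>2 = (norm (u - clip r u))\<^sup>2 + 2 * ((u - clip r u) \<bullet> (v - u)) + (norm (v - u))\<^sup>2"
    using dot_norm[of "u - clip r u" "v - u"] by (simp add: field_simps)
  finally show ?thesis using assms by (simp add: norm_diff_clip)
qed

lemma has_derivative_quadratic_remainder:
  fixes f :: "rvec \<Rightarrow> real"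
  assumes "\<And>y. \<bar>f y - f x - g \<bullet> (y - x)\<bar> \<le> K * (norm (y - x))\<^sup>2"
  shows "(f has_derivative (\<lambda>h. g \<bullet> h)) (at x within A)"
  unfolding has_derivative_within'
proof (intro conjI allI impI)
  show "bounded_linear ((\<bullet>) g)" by (rule bounded_linear_inner_right)
  fix e :: real assume "0 < e"
  have "norm (f y - f x - g \<bullet> (y - x)) / norm (y - x) < e"
    if "0 < norm (y - x)" "norm (y - x) < e / (\<bar>K\<bar> + 1)" for y
  proof -
    have "norm (f y - f x - g \<bullet> (y - x)) \<le> (\<bar>K\<bar> + 1) * norm (y - x) * norm (y - x)"
      using assms[of y] by (simp add: power2_eq_square) (smt (verit) mult_right_mono norm_ge_zero mult_nonneg_nonneg mult.assoc)
    also have "\<dots> < e * norm (y - x)"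
      using that by (intro mult_strict_right_mono) (auto simp: field_simps)
    finally show ?thesis using that by (simp add: pos_divide_less_eq)
  qed
  then show "\<exists>\<delta>>0. \<forall>y\<in>A. 0 < norm (y - x) \<and> norm (y - x) < \<delta> \<longrightarrow>
      norm (f y - f x - g \<bullet> (y - x)) / norm (y - x) < e"
    using \<open>0 < e\<close> by (intro exI[of _ "e / (\<bar>K\<bar> + 1)"]) auto
qed

lemma has_derivative_penalty:
  fixes x c :: rvec
  assumes "0 \<le> r" "0 \<le> L"
  shows "((\<lambda>x. L * (max 0 (norm (x - c) - r))\<^sup>2) has_derivative
    (\<lambda>h. ((2 * L) *\<^sub>R ((x - c) - clip r (x - c))) \<bullet> h)) (at x within A)"
proof (rule has_derivative_quadratic_remainder[where K = L])
  fix y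
  have *: "(y - c) - (x - c) = y - x" by simp
  let ?d = "\<lambda>u. (max 0 (norm (u - c) - r))\<^sup>2" and ?g = "((x - c) - clip r (x - c)) \<bullet> (y - x)"
  have "L * (?d x + 2 * ?g) \<le> L * ?d y" "L * ?d y \<le> L * (?d x + 2 * ?g + (norm (y - x))\<^sup>2)"
    using assms sq_dist_ball_lower[of r "x - c" "y - c"] sq_dist_ball_upper[of r "y - c" "x - c"]
    unfolding * by (auto intro!: mult_left_mono)
  then show "\<bar>L * ?d y - L * ?d x - (2 * L) *\<^sub>R ((x - c) - clip r (x - c)) \<bullet> (y - x)\<bar> \<le> L * (norm (y - x))\<^sup>2"
    by (simp add: abs_le_iff algebra_simps)
qed

text \<open>Lower bounds on the increments of \<open>h\<close> along a segment add up, so a pair of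
  points on different sides of the sphere of radius 2 r is split where the segment crosses it. Thus
  curvature information on \<open>g\<close> is asked for only inside.\<close>

lemma penalized_weak_mono:
  fixes g :: "rvec \<Rightarrow> rvec"
  assumes r: "0 < r" and L: "0 \<le> L" and \<kappa>: "0 \<le> \<kappa>" and c: "c \<in> euclid d"
    and x: "x \<in> euclid d" and y: "y \<in> euclid d"
    and lip: "\<And>x y. x \<in> euclid d \<Longrightarrow> y \<in> euclid d \<Longrightarrow> norm (g x - g y) \<le> L * norm (x - y)"
    and near: "\<And>x y. x \<in> euclid d \<Longrightarrow> y \<in> euclid d \<Longrightarrow> norm (x - c) \<le> 2 * r \<Longrightarrow> norm (y - c) \<le> 2 * r \<Longrightarrow>
        - \<kappa> * (norm (x - y))\<^sup>2 \<le> (g x - g y) \<bullet> (x - y)"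
  defines "h \<equiv> \<lambda>x. g x + (2 * L) *\<^sub>R ((x - c) - clip r (x - c))"
  shows "- \<kappa> * (norm (x - y))\<^sup>2 \<le> (h x - h y) \<bullet> (x - y)"
proof -
  have split: "(h x - h y) \<bullet> (x - y) = (g x - g y) \<bullet> (x - y)
      + 2 * L * (((x - c) - clip r (x - c) - ((y - c) - clip r (y - c))) \<bullet> ((x - c) - (y - c)))" for x y
    by (simp add: h_def inner_diff_left inner_diff_right inner_add_left algebra_simps)
  have inside: "- \<kappa> * (norm (x - y))\<^sup>2 \<le> (h x - h y) \<bullet> (x - y)"
    if "x \<in> euclid d" "y \<in> euclid d" "norm (x - c) \<le> 2 * r" "norm (y - c) \<le> 2 * r" for x y
  proof -
    have "0 \<le> 2 * L * (((x - c) - clip r (x - c) - ((y - c) - clip r (y - c))) \<bullet> ((x - c) - (y - c)))"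
      using L r clip_residual_mono[of r "x - c" "y - c"] by (intro mult_nonneg_nonneg) auto
    then show ?thesis unfolding split using near[OF that] by linarith
  qed
  \<comment> \<open>Outside the ball of radius \<open>2 r\<close> the penalty is \<open>L\<close>-strongly monotone, which absorbs \<open>g\<close>.\<close>
  have outside: "- \<kappa> * (norm (x - y))\<^sup>2 \<le> (h x - h y) \<bullet> (x - y)"
    if xy: "x \<in> euclid d" "y \<in> euclid d" "2 * r \<le> norm (x - c)" "2 * r \<le> norm (y - c)" for x y
  proof -
    \<comment> \<open>So outside the larger ball the projection onto the smaller one is half of a
      nonexpansive map, and \<open>u - clip r u\<close> is strongly monotone with modulus
      1/2.\<close>
    have half: "clip r u = (1 / 2) *\<^sub>R clip (2 * r) u" if "2 * r \<le> norm u" for u :: rvec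
      using that r by (auto simp: clip_def)
    let ?u = "x - c" and ?v = "y - c"
    have "(?u - clip r ?u - (?v - clip r ?v)) \<bullet> (?u - ?v)
        = (?u - ?v) \<bullet> (?u - ?v) - 1 / 2 * ((clip (2 * r) ?u - clip (2 * r) ?v) \<bullet> (?u - ?v))"
      unfolding half[OF xy(3)] half[OF xy(4)] by (simp only: inner_diff_left inner_scaleR_left) argo
    moreover have "(clip (2 * r) ?u - clip (2 * r) ?v) \<bullet> (?u - ?v) \<le> (norm (?u - ?v))\<^sup>2"
      using r by (intro clip_inner_le) auto
    ultimately have "(norm (x - y))\<^sup>2 / 2 \<le> (?u - clip r ?u - (?v - clip r ?v)) \<bullet> (?u - ?v)"
      by (simp add: power2_norm_eq_inner)
    then have "2 * L * ((norm (x - y))\<^sup>2 / 2) \<le> 2 * L * ((?u - clip r ?u - (?v - clip r ?v)) \<bullet> (?u - ?v))"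
      using L by (intro mult_left_mono) auto
    moreover have "- (L * (norm (x - y))\<^sup>2) \<le> (g x - g y) \<bullet> (x - y)"
    proof -
      have "- ((g x - g y) \<bullet> (x - y)) \<le> norm (g x - g y) * norm (x - y)"
        using norm_cauchy_schwarz[of "- (g x - g y)" "x - y"] by (simp only: inner_minus_left norm_minus_cancel)
      also have "\<dots> \<le> L * norm (x - y) * norm (x - y)" using lip[OF xy(1,2)] by (intro mult_right_mono) auto
      finally show ?thesis by (simp add: power2_eq_square)
    qed
    moreover have "0 \<le> \<kappa> * (norm (x - y))\<^sup>2" using \<kappa> by simp
    ultimately show ?thesis unfolding split by simp
  qed
  have mixed: "- \<kappa> * (norm (x - y))\<^sup>2 \<le> (h x - h y) \<bullet> (x - y)"
    if xy: "x \<in> euclid d" "y \<in> euclid d" "norm (x - c) < 2 * r" "2 * r < norm (y - c)" for x y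
  proof -
    have "\<exists>t\<ge>0. t \<le> 1 \<and> norm (x + t *\<^sub>R (y - x) - c) = 2 * r"
      using xy by (intro IVT') (auto intro!: continuous_intros)
    then obtain t where t: "0 \<le> t" "t \<le> 1" "norm (x + t *\<^sub>R (y - x) - c) = 2 * r" by auto
    have t01: "0 < t" "t < 1"
    proof -
      have "t \<noteq> 0" "t \<noteq> 1" using t(3) xy(3,4) by auto
      then show "0 < t" "t < 1" using t by auto
    qed
    let ?p = "x + t *\<^sub>R (y - x)"
    have p: "?p \<in> euclid d" using xy by auto
    have xp: "x - ?p = t *\<^sub>R (x - y)" and py: "?p - y = (1 - t) *\<^sub>R (x - y)" by (auto simp: algebra_simps)
    have 1: "t * (- \<kappa> * t * (norm (x - y))\<^sup>2) \<le> t * ((h x - h ?p) \<bullet> (x - y))"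
      using inside[OF xy(1) p] xy t t01 unfolding xp
      by (simp add: power_mult_distrib power2_eq_square mult.assoc mult.left_commute)
    have 2: "(1 - t) * (- \<kappa> * (1 - t) * (norm (x - y))\<^sup>2) \<le> (1 - t) * ((h ?p - h y) \<bullet> (x - y))"
      using outside[OF p xy(2)] xy t t01 unfolding py
      by (simp add: power_mult_distrib power2_eq_square mult.assoc mult.left_commute)
    have "- \<kappa> * t * (norm (x - y))\<^sup>2 \<le> (h x - h ?p) \<bullet> (x - y)"
      "- \<kappa> * (1 - t) * (norm (x - y))\<^sup>2 \<le> (h ?p - h y) \<bullet> (x - y)"
      using mult_left_le_imp_le[OF 1] mult_left_le_imp_le[OF 2] t01 by simp_all
    moreover have "(h x - h y) \<bullet> (x - y) = (h x - h ?p) \<bullet> (x - y) + (h ?p - h y) \<bullet> (x - y)"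
      by (simp add: inner_diff_left)
    ultimately show ?thesis by (simp add: algebra_simps)
  qed
  have sym: "(h x - h y) \<bullet> (x - y) = (h y - h x) \<bullet> (y - x)" "norm (x - y) = norm (y - x)"
    by (simp_all add: inner_diff_left inner_diff_right norm_minus_commute)
  consider "norm (x - c) \<le> 2 * r \<and> norm (y - c) \<le> 2 * r" | "2 * r \<le> norm (x - c) \<and> 2 * r \<le> norm (y - c)"
    | "norm (x - c) < 2 * r \<and> 2 * r < norm (y - c)" | "norm (y - c) < 2 * r \<and> 2 * r < norm (x - c)"
    by linarith
  then show ?thesis
    using inside[OF x y] outside[OF x y] mixed[OF x y] mixed[OF y x] sym by cases auto
qed

section \<open>Hessians\<close>

locale hessian_lipschitz =
  fixes d :: nat and f :: "rvec \<Rightarrow> real" and L2 :: real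
  assumes twice: "twice_differentiable d f"
    and second_order: "second_order_smooth d L2 f"
begin

abbreviation "grad \<equiv> gradient d f"
abbreviation "H \<equiv> hessian d f"

lemma diff: "x \<in> euclid d \<Longrightarrow> f differentiable (at x within euclid d)"
  and grad_diff: "x \<in> euclid d \<Longrightarrow> grad differentiable (at x within euclid d)"
  using twice by (auto simp: twice_differentiable_def)

lemma grad_euclid [intro]: "x \<in> euclid d \<Longrightarrow> grad x \<in> euclid d"
  using diff gradient_euclid by blast

lemma has_derivative_grad: "x \<in> euclid d \<Longrightarrow> (grad has_derivative H x) (at x within euclid d)"
  unfolding hessian_def using grad_diff frechet_derivative_works by blast

lemma bounded_linear_H: "x \<in> euclid d \<Longrightarrow> bounded_linear (H x)"
  using has_derivative_grad has_derivative_bounded_linear by blast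

lemma H_scaleR: "x \<in> euclid d \<Longrightarrow> H x (r *\<^sub>R v) = r *\<^sub>R H x v"
  and H_add: "x \<in> euclid d \<Longrightarrow> H x (v + w) = H x v + H x w"
  using bounded_linear_H[of x] by (simp_all add: bounded_linear.linear linear_scale linear_add)

text \<open>The coordinates of the gradient beyond d are constantly 0 on \<open>euclid d\<close>, so
  their derivatives along \<open>euclid d\<close> vanish.\<close>

lemma H_euclid [intro]:
  assumes "x \<in> euclid d" "v \<in> euclid d"
  shows "H x v \<in> euclid d"
proof -
  have "H x v \<bullet> unit_vec i = 0" if "d \<le> i" for i
  proof -
    have "((\<lambda>x. grad x \<bullet> unit_vec i) has_derivative (\<lambda>h. H x h \<bullet> unit_vec i)) (at x within euclid d)"
      using has_derivative_grad[OF assms(1)] by (auto intro!: derivative_eq_intros)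
    from derivative_unique_euclid[OF this _ assms]
    have "H x v \<bullet> unit_vec i = 0" if "((\<lambda>x. grad x \<bullet> unit_vec i) has_derivative (\<lambda>h. 0)) (at x within euclid d)"
      using that by simp
    moreover have "((\<lambda>x. grad x \<bullet> unit_vec i) has_derivative (\<lambda>h. 0)) (at x within euclid d)"
      using assms(1) that grad_euclid
      by (intro has_derivative_transform[OF assms(1) _ has_derivative_const[of 0]])
         (auto simp: inner_unit_vec euclid_def)
    ultimately show ?thesis by simp
  qed
  then show ?thesis by (auto simp: euclid_def inner_unit_vec)
qed

lemma H_lipschitz:
  assumes "x \<in> euclid d" "y \<in> euclid d" "v \<in> euclid d"
  shows "norm (H x v - H y v) \<le> L2 * norm (x - y) * norm v"
proof (cases "v = 0")
  case True
  then show ?thesis using H_scaleR[of _ 0 0] assms by simp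
next
  case False
  let ?A = "\<lambda>v. H x v - H y v" and ?u = "(1 / norm v) *\<^sub>R v"
  have bl: "bounded_linear ?A" by (intro bounded_linear_sub bounded_linear_H assms)
  then obtain K where K: "\<And>v. norm (?A v) \<le> norm v * K" by (auto simp: bounded_linear_def bounded_linear_axioms_def)
  \<comment> \<open>The supremum in \<open>spectral_norm\<close> is informative only for a bounded
    set, and boundedness is not part of \<open>second_order_smooth\<close>.\<close>
  have "bdd_above ((\<lambda>v. norm (?A v)) ` {v \<in> euclid d. norm v \<le> 1})"
  proof (intro bdd_aboveI2[of _ _ "\<bar>K\<bar>"])
    fix v assume "v \<in> {v \<in> euclid d. norm v \<le> 1}"
    then have "norm v * \<bar>K\<bar> \<le> 1 * \<bar>K\<bar>" by (intro mult_right_mono) auto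
    moreover have "norm v * K \<le> norm v * \<bar>K\<bar>" by (intro mult_left_mono) auto
    ultimately show "norm (?A v) \<le> \<bar>K\<bar>" using K[of v] by simp
  qed
  then have "norm (?A ?u) \<le> spectral_norm d ?A"
    unfolding spectral_norm_def using assms False by (intro cSUP_upper) auto
  also have "\<dots> \<le> L2 * norm (x - y)"
    using second_order assms by (auto simp: second_order_smooth_def)
  finally have "norm (?A ?u) * norm v \<le> L2 * norm (x - y) * norm v" by (intro mult_right_mono) auto
  moreover have "?A v = norm v *\<^sub>R ?A ?u"
    using False assms by (simp add: H_scaleR scaleR_diff_right[symmetric])
  ultimately show ?thesis by (simp add: mult.commute)
qed

lemma H_inner_lipschitz:
  assumes "x \<in> euclid d" "y \<in> euclid d" "v \<in> euclid d" "w' \<in> euclid d"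
  shows "\<bar>v \<bullet> H x w' - v \<bullet> H y w'\<bar> \<le> L2 * norm (x - y) * norm w' * norm v"
proof -
  have "\<bar>v \<bullet> (H x w' - H y w')\<bar> \<le> norm v * norm (H x w' - H y w')" by (rule Cauchy_Schwarz_ineq2)
  also have "\<dots> \<le> norm v * (L2 * norm (x - y) * norm w')"
    using H_lipschitz[OF assms(1,2,4)] by (intro mult_left_mono) auto
  finally show ?thesis by (simp add: inner_diff_right mult.commute mult.left_commute)
qed

lemma has_field_derivative_grad_line:
  assumes "x \<in> euclid d" "w \<in> euclid d"
  shows "((\<lambda>t. grad (x + t *\<^sub>R w) \<bullet> v) has_real_derivative H (x + t *\<^sub>R w) w \<bullet> v) (at t)"
proof -
  have E: "x + t *\<^sub>R w \<in> euclid d" using assms by auto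
  have "((\<lambda>t. grad (x + t *\<^sub>R w) \<bullet> v) has_derivative (\<lambda>s. H (x + t *\<^sub>R w) (s *\<^sub>R w) \<bullet> v)) (at t)"
    by (intro has_derivative_inner_left has_derivative_on_line[OF has_derivative_grad[OF E] assms])
  then show ?thesis
    by (simp add: has_field_derivative_def H_scaleR[OF E] mult.commute[of _ "H _ _ \<bullet> _"])
qed

lemma grad_mono_of_hessian:
  assumes x: "x \<in> euclid d" and y: "y \<in> euclid d"
    and H: "\<And>t. 0 < t \<Longrightarrow> t < 1 \<Longrightarrow>
      - \<kappa> * (norm (x - y))\<^sup>2 \<le> (x - y) \<bullet> H (y + t *\<^sub>R (x - y)) (x - y)"
  shows "- \<kappa> * (norm (x - y))\<^sup>2 \<le> (grad x - grad y) \<bullet> (x - y)"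
proof -
  let ?w = "x - y"
  have "\<exists>t>0. t < 1 \<and> grad (y + 1 *\<^sub>R ?w) \<bullet> ?w - grad (y + 0 *\<^sub>R ?w) \<bullet> ?w
      = (1 - 0) * (H (y + t *\<^sub>R ?w) ?w \<bullet> ?w)"
    using x y by (intro MVT2 has_field_derivative_grad_line) auto
  then show ?thesis using H by (auto simp: inner_diff_left inner_commute[of "H _ _"])
qed

text \<open>The mean value theorem is applied first along \<open>v\<close>, to the difference of two
  parallel lines, and then along \<open>w\<close>, to the gradient. The second difference itself is
  symmetric in \<open>v\<close> and \<open>w\<close>.\<close>

lemma second_difference:
  assumes x: "x \<in> euclid d" and v: "v \<in> euclid d" and w: "w \<in> euclid d" and t: "0 < (t::real)"
  shows "\<exists>a\<in>euclid d. norm (a - x) \<le> t * (norm v + norm w) \<and>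
    f (x + t *\<^sub>R w + t *\<^sub>R v) - f (x + t *\<^sub>R w) - (f (x + t *\<^sub>R v) - f x) = t\<^sup>2 * (H a w \<bullet> v)"
proof -
  let ?g = "\<lambda>s. f ((x + t *\<^sub>R w) + s *\<^sub>R v) - f (x + s *\<^sub>R v)"
  have "\<exists>s>0. s < t \<and> ?g t - ?g 0 = (t - 0) * (grad ((x + t *\<^sub>R w) + s *\<^sub>R v) \<bullet> v - grad (x + s *\<^sub>R v) \<bullet> v)"
    using x v w t by (intro MVT2 DERIV_diff has_field_derivative_on_line diff) auto
  then obtain s where s: "0 < s" "s < t"
    "?g t - ?g 0 = t * (grad ((x + t *\<^sub>R w) + s *\<^sub>R v) \<bullet> v - grad (x + s *\<^sub>R v) \<bullet> v)" by auto
  let ?y = "x + s *\<^sub>R v"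
  have y: "?y \<in> euclid d" using x v by auto
  have "\<exists>r>0. r < t \<and> grad (?y + t *\<^sub>R w) \<bullet> v - grad (?y + 0 *\<^sub>R w) \<bullet> v = (t - 0) * (H (?y + r *\<^sub>R w) w \<bullet> v)"
    using y w t by (intro MVT2 has_field_derivative_grad_line) auto
  then obtain r where r: "0 < r" "r < t"
    "grad (?y + t *\<^sub>R w) \<bullet> v - grad ?y \<bullet> v = t * (H (?y + r *\<^sub>R w) w \<bullet> v)" by auto
  let ?a = "?y + r *\<^sub>R w"
  have "norm (?a - x) \<le> norm (s *\<^sub>R v) + norm (r *\<^sub>R w)"
    using norm_triangle_ineq[of "s *\<^sub>R v" "r *\<^sub>R w"] by (simp add: algebra_simps)
  also have "\<dots> \<le> t * norm v + t * norm w" using s r by (auto intro!: add_mono mult_right_mono)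
  finally have "norm (?a - x) \<le> t * (norm v + norm w)" by (simp add: algebra_simps)
  moreover have comm: "(x + t *\<^sub>R w) + s *\<^sub>R v = ?y + t *\<^sub>R w" by (simp add: algebra_simps)
  have "?g t - ?g 0 = t * (t * (H ?a w \<bullet> v))" using s(3) unfolding comm r(3) .
  then have "f (x + t *\<^sub>R w + t *\<^sub>R v) - f (x + t *\<^sub>R w) - (f (x + t *\<^sub>R v) - f x) = t\<^sup>2 * (H ?a w \<bullet> v)"
    by (simp add: power2_eq_square)
  ultimately show ?thesis using y w by (intro bexI[of _ ?a]) auto
qed

text \<open>Second differences in either order agree, so the two Hessian entries coincide when taken
  at suitable points within distance O(t) of \<open>x\<close>; the Lipschitz bound carries this over
  to \<open>x\<close> as t tends to 0.\<close>

lemma H_symmetric: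
  assumes x: "x \<in> euclid d" and v: "v \<in> euclid d" and w: "w \<in> euclid d"
  shows "H x v \<bullet> w = v \<bullet> H x w"
proof -
  define C where "C = 2 * (\<bar>L2\<bar> * (norm v + norm w) * norm w * norm v)"
  have C: "0 \<le> C" by (simp add: C_def)
  have "\<bar>v \<bullet> H x w - w \<bullet> H x v\<bar> \<le> t * C" if t: "0 < t" for t
  proof -
    obtain a where a: "a \<in> euclid d" "norm (a - x) \<le> t * (norm v + norm w)"
      "f (x + t *\<^sub>R w + t *\<^sub>R v) - f (x + t *\<^sub>R w) - (f (x + t *\<^sub>R v) - f x) = t\<^sup>2 * (H a w \<bullet> v)"
      using second_difference[OF x v w t] by auto
    obtain b where b: "b \<in> euclid d" "norm (b - x) \<le> t * (norm w + norm v)"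
      "f (x + t *\<^sub>R v + t *\<^sub>R w) - f (x + t *\<^sub>R v) - (f (x + t *\<^sub>R w) - f x) = t\<^sup>2 * (H b v \<bullet> w)"
      using second_difference[OF x w v t] by auto
    have comm: "x + t *\<^sub>R w + t *\<^sub>R v = x + t *\<^sub>R v + t *\<^sub>R w" by simp
    have "t\<^sup>2 * (H a w \<bullet> v) = t\<^sup>2 * (H b v \<bullet> w)" using a(3) b(3) unfolding comm by linarith
    then have ab: "v \<bullet> H a w = w \<bullet> H b v" using t by (simp add: inner_commute)
    have le: "L2 * q * norm p * norm p' \<le> \<bar>L2\<bar> * (t * (norm v + norm w)) * norm w * norm v"
      if "q \<le> t * (norm v + norm w)" "0 \<le> q" "norm p * norm p' = norm w * norm v" for q and p p' :: rvec
    proof -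
      have "L2 * q * (norm w * norm v) \<le> \<bar>L2\<bar> * (t * (norm v + norm w)) * (norm w * norm v)"
        using that t by (intro mult_right_mono mult_mono) auto
      then show ?thesis using that by (simp add: mult.assoc)
    qed
    have "\<bar>v \<bullet> H a w - v \<bullet> H x w\<bar> \<le> \<bar>L2\<bar> * (t * (norm v + norm w)) * norm w * norm v"
      using H_inner_lipschitz[OF a(1) x v w] le[OF a(2), of w v] by simp
    moreover have "\<bar>w \<bullet> H b v - w \<bullet> H x v\<bar> \<le> \<bar>L2\<bar> * (t * (norm v + norm w)) * norm w * norm v"
      using H_inner_lipschitz[OF b(1) x w v] le[of "norm (b - x)" v w] b(2) by (simp add: add.commute mult.commute)
    ultimately have "\<bar>v \<bullet> H x w - w \<bullet> H x v\<bar> \<le> 2 * (\<bar>L2\<bar> * (t * (norm v + norm w)) * norm w * norm v)"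
      using ab by linarith
    then show ?thesis by (simp add: C_def algebra_simps)
  qed
  note bound = this
  have "\<bar>v \<bullet> H x w - w \<bullet> H x v\<bar> \<le> 0"
  proof (rule field_le_epsilon)
    fix e :: real assume "0 < e"
    then have "\<bar>v \<bullet> H x w - w \<bullet> H x v\<bar> \<le> e / (C + 1) * C" using C by (intro bound) auto
    also have "\<dots> \<le> e" using C \<open>0 < e\<close> by (simp add: field_simps)
    finally show "\<bar>v \<bullet> H x w - w \<bullet> H x v\<bar> \<le> 0 + e" by simp
  qed
  then show ?thesis by (simp add: inner_commute)
qed

text \<open>The quadratic form attains its minimum \<open>lam\<close> over the unit sphere at some
  \<open>v\<close>. Then \<open>Q\<close> is nonnegative and vanishes at \<open>v\<close>, so its
  derivative there in the direction of the residual \<open>g\<close> vanishes, which makes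
  \<open>v\<close> an eigenvector for \<open>lam\<close>. Symmetry of the Hessian enters in
  \<open>exp\<close>.\<close>

lemma eigenvalues_ge_iff:
  assumes x: "x \<in> euclid d"
  shows "eigenvalues_ge d (H x) a \<longleftrightarrow> (\<forall>v\<in>euclid d. a * (norm v)\<^sup>2 \<le> v \<bullet> H x v)"
proof
  assume *: "\<forall>v\<in>euclid d. a * (norm v)\<^sup>2 \<le> v \<bullet> H x v"
  show "eigenvalues_ge d (H x) a"
    unfolding eigenvalues_ge_def eigenvalue_def
  proof (intro allI impI)
    fix lam assume "\<exists>v\<in>euclid d. v \<noteq> 0 \<and> H x v = lam *\<^sub>R v"
    then obtain v where v: "v \<in> euclid d" "v \<noteq> 0" "H x v = lam *\<^sub>R v" by auto
    then have "a * (norm v)\<^sup>2 \<le> lam * (norm v)\<^sup>2" using * by (auto simp: power2_norm_eq_inner)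
    then show "a \<le> lam" using v by simp
  qed
next
  assume eig: "eigenvalues_ge d (H x) a"
  show "\<forall>v\<in>euclid d. a * (norm v)\<^sup>2 \<le> v \<bullet> H x v"
  proof (rule ccontr)
    assume "\<not> ?thesis"
    then obtain v0 where v0: "v0 \<in> euclid d" "v0 \<bullet> H x v0 < a * (norm v0)\<^sup>2" by force
    then have nz: "v0 \<noteq> 0" using H_scaleR[OF x, of 0 0] by auto
    let ?S = "sphere 0 1 \<inter> euclid d"
    have "compact ((cball 0 1 \<inter> euclid d) \<inter> sphere 0 1)"
      unfolding sphere_def
      by (intro compact_Int_closed[OF compact_cball_euclid] closed_Collect_eq continuous_intros)
    moreover have "(cball 0 1 \<inter> euclid d) \<inter> sphere 0 1 = ?S" by auto
    ultimately have "compact ?S" by simp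
    moreover have "(1 / norm v0) *\<^sub>R v0 \<in> ?S" using v0 nz by auto
    moreover have "continuous_on ?S (\<lambda>v. v \<bullet> H x v)"
      using bounded_linear.continuous_on[OF bounded_linear_H[OF x] continuous_on_id, of ?S]
      by (intro continuous_intros) (simp add: id_def)
    ultimately obtain v where v: "v \<in> ?S" "\<And>w. w \<in> ?S \<Longrightarrow> v \<bullet> H x v \<le> w \<bullet> H x w"
      using continuous_attains_inf[of ?S "\<lambda>v. v \<bullet> H x v"] by blast
    define lam where "lam = v \<bullet> H x v"
    define Q where "Q w = w \<bullet> H x w - lam * (norm w)\<^sup>2" for w
    have Q: "0 \<le> Q w" if w: "w \<in> euclid d" for w
    proof (cases "w = 0")
      case False
      then have "lam \<le> ((1 / norm w) *\<^sub>R w) \<bullet> H x ((1 / norm w) *\<^sub>R w)"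
        unfolding lam_def using w by (intro v(2)) auto
      also have "\<dots> = (w \<bullet> H x w) / (norm w)\<^sup>2" by (simp add: H_scaleR[OF x] power2_eq_square)
      finally show ?thesis using False by (simp add: Q_def field_simps)
    qed (simp add: Q_def)
    have vE: "v \<in> euclid d" and nv: "norm v = 1" using v by auto
    have Qv: "Q v = 0" using nv by (simp add: Q_def lam_def)
    define g where "g = H x v - lam *\<^sub>R v"
    have g: "g \<in> euclid d" using vE x by (auto simp: g_def)
    have exp: "Q (v + t *\<^sub>R g) = 2 * t * (norm g)\<^sup>2 + t\<^sup>2 * Q g" for t
    proof -
      have "Q (v + t *\<^sub>R g) = Q v + t * (v \<bullet> H x g + g \<bullet> H x v - 2 * lam * (v \<bullet> g)) + t\<^sup>2 * Q g"
        unfolding Q_def power2_norm_eq_inner H_add[OF x] H_scaleR[OF x]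
        by (simp add: inner_add_left inner_add_right algebra_simps power2_eq_square inner_commute)
      also have "v \<bullet> H x g = g \<bullet> H x v" using H_symmetric[OF x vE g] by (simp add: inner_commute)
      also have "g \<bullet> H x v + g \<bullet> H x v - 2 * lam * (v \<bullet> g) = 2 * (g \<bullet> (H x v - lam *\<^sub>R v))"
        by (simp add: inner_diff_right inner_commute)
      also have "\<dots> = 2 * (norm g)\<^sup>2" by (simp add: g_def[symmetric] power2_norm_eq_inner)
      finally show ?thesis by (simp add: Qv)
    qed
    have "g = 0"
    proof (rule ccontr)
      assume "g \<noteq> 0"
      \<comment> \<open>Small enough for t Q(g) \<le> |g|^2, so that moving by -t g would make
        \<open>Q\<close> negative; the summand 1 keeps the denominator positive.\<close>
      define t where "t = (norm g)\<^sup>2 / (Q g + 1)"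
      have "0 < t" using \<open>g \<noteq> 0\<close> Q[OF g] by (auto simp: t_def)
      have "0 \<le> Q (v + (- t) *\<^sub>R g)" using vE g by (intro Q euclid_add euclid_scaleR)
      then have "t * (2 * (norm g)\<^sup>2) \<le> t * (t * Q g)" unfolding exp by (simp add: power2_eq_square)
      then have "2 * (norm g)\<^sup>2 \<le> t * Q g" using \<open>0 < t\<close> by simp
      also have "\<dots> \<le> (norm g)\<^sup>2" using Q[OF g] by (simp add: t_def field_simps)
      finally show False using \<open>g \<noteq> 0\<close> by simp
    qed
    then have "eigenvalue d (H x) lam" using vE nv
      by (auto simp: eigenvalue_def g_def intro!: bexI[of _ v])
    then have "a \<le> lam" using eig by (simp add: eigenvalues_ge_def)
    then have "a * (norm v0)\<^sup>2 \<le> lam * (norm v0)\<^sup>2" by (intro mult_right_mono) auto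
    then show False using Q[OF v0(1)] v0(2) by (simp add: Q_def)
  qed
qed

lemma eigenvalues_ge_transport:
  assumes x: "x \<in> euclid d" and y: "y \<in> euclid d" and eig: "eigenvalues_ge d (H y) a"
    and le: "L2 * norm (x - y) \<le> b"
  shows "eigenvalues_ge d (H x) (a - b)"
  unfolding eigenvalues_ge_iff[OF x]
proof
  fix v assume v: "v \<in> euclid d"
  have "a * (norm v)\<^sup>2 \<le> v \<bullet> H y v" using eig v by (simp add: eigenvalues_ge_iff[OF y])
  moreover have "\<bar>v \<bullet> H x v - v \<bullet> H y v\<bar> \<le> L2 * norm (x - y) * norm v * norm v"
    by (rule H_inner_lipschitz[OF x y v v])
  moreover have "L2 * norm (x - y) * norm v * norm v \<le> b * norm v * norm v"
    using le by (intro mult_right_mono) auto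
  ultimately show "(a - b) * (norm v)\<^sup>2 \<le> v \<bullet> H x v" by (simp add: power2_eq_square algebra_simps)
qed

text \<open>Averaging over the two signs cancels the first-order term. Along the line the curvature
  is at most -del/2 + L2 |s|; integrated twice up to del / L2, this changes the sum of the two
  values by at most -del^3 / (2 L2^2) + del^3 / (3 L2^2).\<close>

lemma negative_curvature_step:
  assumes y: "y \<in> euclid d" and v: "v \<in> euclid d" "norm v = 1" and neg: "v \<bullet> H y v \<le> - (del / 2)"
    and pos: "0 < del" "0 < L2"
  shows "(f (y + (del / L2) *\<^sub>R v) + f (y - (del / L2) *\<^sub>R v)) / 2 \<le> f y - del ^ 3 / (12 * L2\<^sup>2)"
proof -
  define r where "r = del / L2"
  define q where "q = v \<bullet> H y v"
  have r: "0 < r" using pos by (simp add: r_def)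
  have curv: "H (y + s *\<^sub>R v) v \<bullet> v \<le> q + L2 * \<bar>s\<bar>" for s
  proof -
    have "y + s *\<^sub>R v \<in> euclid d" using y v by auto
    then show ?thesis using H_inner_lipschitz[of "y + s *\<^sub>R v" y v v] y v
      by (auto simp: q_def inner_commute[of "H _ _"])
  qed
  \<comment> \<open>Both integrations are done by monotonicity: \<open>h\<close> has derivative
    \<open>g\<close>, and the derivative of \<open>g\<close> is nonpositive for nonnegative
    arguments by \<open>curv\<close>.\<close>
  define g where "g t = (grad (y + t *\<^sub>R v) \<bullet> v - grad (y + t *\<^sub>R (- v)) \<bullet> v) - (2 * q * t + L2 * t\<^sup>2)" for t
  define h where "h t = f (y + t *\<^sub>R v) + f (y + t *\<^sub>R (- v)) - (q * t\<^sup>2 + L2 * t ^ 3 / 3)" for t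
  have g_deriv: "(g has_real_derivative
      H (y + t *\<^sub>R v) v \<bullet> v - H (y + t *\<^sub>R (- v)) (- v) \<bullet> v - (2 * q + 2 * L2 * t)) (at t)" for t
    unfolding g_def using y v
    by (auto intro!: derivative_eq_intros has_field_derivative_grad_line simp del: scaleR_minus_right)
  have "g t \<le> g 0" if "0 \<le> t" for t
  proof (rule DERIV_nonpos_imp_nonincreasing[OF that])
    fix s :: real assume s: "0 \<le> s" "s \<le> t"
    have "H (y + s *\<^sub>R (- v)) (- v) = - H (y + s *\<^sub>R (- v)) v"
      using H_scaleR[of "y + s *\<^sub>R (- v)" "-1" v] y v by (auto simp del: scaleR_minus_right)
    moreover have "H (y + s *\<^sub>R v) v \<bullet> v \<le> q + L2 * s" "H (y + s *\<^sub>R (- v)) v \<bullet> v \<le> q + L2 * s"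
      using curv[of s] curv[of "- s"] s by auto
    ultimately have "H (y + s *\<^sub>R v) v \<bullet> v - H (y + s *\<^sub>R (- v)) (- v) \<bullet> v - (2 * q + 2 * L2 * s) \<le> 0"
      by simp
    then show "\<exists>z. (g has_real_derivative z) (at s) \<and> z \<le> 0" using g_deriv by blast
  qed
  then have g: "g t \<le> 0" if "0 \<le> t" for t using that by (simp add: g_def)
  have line: "((\<lambda>t. f (y + t *\<^sub>R w)) has_real_derivative grad (y + t *\<^sub>R w) \<bullet> w) (at t)"
    if "w \<in> euclid d" for w t
    using y that by (intro has_field_derivative_on_line diff) auto
  have "((\<lambda>t. q * t\<^sup>2 + L2 * t ^ 3 / 3) has_real_derivative 2 * q * t + L2 * t\<^sup>2) (at t)" for t
    by (auto intro!: derivative_eq_intros)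
  from DERIV_diff[OF DERIV_add[OF line[OF v(1)] line[OF euclid_minus[OF v(1)]]] this]
  have h_deriv: "(h has_real_derivative g t) (at t)" for t
    by (simp add: h_def[abs_def] g_def)
  have "h r \<le> h 0"
  proof (rule DERIV_nonpos_imp_nonincreasing[of 0 r h])
    fix s :: real assume "0 \<le> s" "s \<le> r"
    then show "\<exists>z. (h has_real_derivative z) (at s) \<and> z \<le> 0" using h_deriv g by blast
  qed (use r in simp)
  then have "f (y + r *\<^sub>R v) + f (y - r *\<^sub>R v) \<le> 2 * f y + (q * r\<^sup>2 + L2 * r ^ 3 / 3)" by (simp add: h_def)
  also have "\<dots> \<le> 2 * f y + (- (del / 2) * r\<^sup>2 + L2 * r ^ 3 / 3)"
    using mult_right_mono[OF neg, of "r\<^sup>2"] by (simp add: q_def)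
  also have "- (del / 2) * r\<^sup>2 + L2 * r ^ 3 / 3 = - (del ^ 3 / (6 * L2\<^sup>2))"
    using pos by (simp add: r_def field_simps power2_eq_square power3_eq_cube)
  finally show ?thesis by (simp add: r_def)
qed

end

section \<open>Expectations over finite distributions\<close>

abbreviation expect :: "'a pmf \<Rightarrow> ('a \<Rightarrow> real) \<Rightarrow> real"
  where "expect q h \<equiv> measure_pmf.expectation q h"

lemma expect_sum: "finite (set_pmf q) \<Longrightarrow> expect q h = (\<Sum>x\<in>set_pmf q. pmf q x * h x)"
  by (subst integral_measure_pmf[of "set_pmf q"]) (auto simp: set_pmf_iff)

lemma expect_bind:
  assumes "finite (set_pmf q)" "\<And>x. x \<in> set_pmf q \<Longrightarrow> finite (set_pmf (f x))"
  shows "expect (q \<bind> f) h = expect q (\<lambda>x. expect (f x) h)"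
  using assms by (subst pmf_expectation_bind[of "set_pmf q"]) (auto simp: expect_sum)

lemma expect_mono:
  assumes "finite (set_pmf q)" "\<And>x. x \<in> set_pmf q \<Longrightarrow> g x \<le> h x"
  shows "expect q g \<le> expect q h"
  using assms by (auto simp: expect_sum intro!: sum_mono mult_left_mono)

lemma expect_cong:
  assumes "finite (set_pmf q)" "\<And>x. x \<in> set_pmf q \<Longrightarrow> g x = h x"
  shows "expect q g = expect q h"
  using assms by (auto simp: expect_sum)

lemma expect_add: "finite (set_pmf q) \<Longrightarrow> expect q (\<lambda>x. g x + h x) = expect q g + expect q h"
  by (simp add: expect_sum sum.distrib algebra_simps)

lemma expect_diff: "finite (set_pmf q) \<Longrightarrow> expect q (\<lambda>x. g x - h x) = expect q g - expect q h"
  by (simp add: expect_sum sum_subtractf algebra_simps)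

lemma expect_cmult: "finite (set_pmf q) \<Longrightarrow> expect q (\<lambda>x. c * g x) = c * expect q g"
  by simp

lemma expect_of_set:
  "finite A \<Longrightarrow> A \<noteq> {} \<Longrightarrow> expect (pmf_of_set A) h = (\<Sum>x\<in>A. h x) / real (card A)"
  by (simp add: integral_pmf_of_set)

section \<open>Sampling without replacement\<close>

lemma card_supersets:
  assumes "finite A" "T \<subseteq> A"
  shows "card {S. S \<subseteq> A \<and> card S = B \<and> T \<subseteq> S}
    = (if card T \<le> B then (card A - card T) choose (B - card T) else 0)"
proof (cases "card T \<le> B")
  case True
  have finT: "finite T" using assms finite_subset by auto
  have fin: "finite S" if "S \<subseteq> A" for S using that assms finite_subset by auto
  have "bij_betw (\<lambda>S. S - T) {S. S \<subseteq> A \<and> card S = B \<and> T \<subseteq> S} {S. S \<subseteq> A - T \<and> card S = B - card T}"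
  proof (rule bij_betwI[where g = "\<lambda>S. S \<union> T"])
    show "(\<lambda>S. S - T) \<in> {S. S \<subseteq> A \<and> card S = B \<and> T \<subseteq> S} \<rightarrow> {S. S \<subseteq> A - T \<and> card S = B - card T}"
      using finT by (auto simp: card_Diff_subset)
    show "(\<lambda>S. S \<union> T) \<in> {S. S \<subseteq> A - T \<and> card S = B - card T} \<rightarrow> {S. S \<subseteq> A \<and> card S = B \<and> T \<subseteq> S}"
    proof (intro funcsetI CollectI conjI)
      fix S assume "S \<in> {S. S \<subseteq> A - T \<and> card S = B - card T}"
      then have S: "S \<subseteq> A - T" "card S = B - card T" by auto
      then show "card (S \<union> T) = B" using True finT fin[of S]
        by (subst card_Un_disjoint) auto
      show "S \<union> T \<subseteq> A" using S assms by auto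
    qed auto
  qed auto
  then have "card {S. S \<subseteq> A \<and> card S = B \<and> T \<subseteq> S} = card {S. S \<subseteq> A - T \<and> card S = B - card T}"
    by (rule bij_betw_same_card)
  then show ?thesis using assms True finT by (simp add: n_subsets card_Diff_subset)
next
  case False
  moreover have "card T \<le> card S" if "S \<subseteq> A" "T \<subseteq> S" for S
    using card_mono[OF finite_subset[OF that(1) assms(1)] that(2)] .
  ultimately have empty: "{S. S \<subseteq> A \<and> card S = B \<and> T \<subseteq> S} = {}" by auto
  show ?thesis unfolding empty using False by simp
qed

text \<open>In the expanded square a pair of distinct indices occurs in \<open>N2\<close> of the
  subsets, an index with itself in \<open>N1\<close>. Since the vectors sum to 0, the terms with
  weight \<open>N2\<close> cancel and the weight N1 - N2 is left. So sampling without replacement is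
  no worse than independent sampling.\<close>

lemma sum_subsets_norm_sq_le:
  fixes \<xi> :: "'i \<Rightarrow> 'a::real_inner"
  assumes A: "finite A" and zero: "(\<Sum>i\<in>A. \<xi> i) = 0" and B: "1 \<le> B" "B \<le> card A"
  shows "(\<Sum>S | S \<subseteq> A \<and> card S = B. (norm (\<Sum>i\<in>S. \<xi> i))\<^sup>2)
    \<le> real (card A choose B) * real B / real (card A) * (\<Sum>i\<in>A. (norm (\<xi> i))\<^sup>2)"
proof -
  define P where "P = {S. S \<subseteq> A \<and> card S = B}"
  define N1 where "N1 = (card A - 1) choose (B - 1)"
  \<comment> \<open>For B = 1 truncated subtraction would make the binomial coefficient 1, although
    no subset contains two distinct indices.\<close>
  define N2 where "N2 = (if 2 \<le> B then (card A - 2) choose (B - 2) else 0)"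
  have finP: "finite P" using A by (simp add: P_def)
  have count: "card {S\<in>P. i \<in> S \<and> j \<in> S} = (if i = j then N1 else N2)" if "i \<in> A" "j \<in> A" for i j
  proof -
    have "{S\<in>P. i \<in> S \<and> j \<in> S} = {S. S \<subseteq> A \<and> card S = B \<and> {i, j} \<subseteq> S}" by (auto simp: P_def)
    then show ?thesis using card_supersets[OF A, of "{i, j}" B] that B
      by (auto simp: N1_def N2_def numeral_2_eq_2)
  qed
  have "(\<Sum>S\<in>P. (norm (\<Sum>i\<in>S. \<xi> i))\<^sup>2) = (\<Sum>S\<in>P. \<Sum>i\<in>A. \<Sum>j\<in>A. (if i \<in> S \<and> j \<in> S then \<xi> i \<bullet> \<xi> j else 0))"
  proof (rule sum.cong[OF refl])
    fix S assume "S \<in> P"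
    then have S: "S \<subseteq> A" by (simp add: P_def)
    have "(norm (\<Sum>i\<in>S. \<xi> i))\<^sup>2 = (\<Sum>i\<in>S. \<Sum>j\<in>S. \<xi> i \<bullet> \<xi> j)"
      unfolding power2_norm_eq_inner inner_sum_left inner_sum_right by (rule sum.swap)
    also have "\<dots> = (\<Sum>i\<in>S. \<Sum>j\<in>A. if i \<in> S \<and> j \<in> S then \<xi> i \<bullet> \<xi> j else 0)"
      using A S by (intro sum.cong sum.mono_neutral_cong_left) auto
    also have "\<dots> = (\<Sum>i\<in>A. \<Sum>j\<in>A. if i \<in> S \<and> j \<in> S then \<xi> i \<bullet> \<xi> j else 0)"
      using A S by (intro sum.mono_neutral_left) auto
    finally show "(norm (\<Sum>i\<in>S. \<xi> i))\<^sup>2 = (\<Sum>i\<in>A. \<Sum>j\<in>A. if i \<in> S \<and> j \<in> S then \<xi> i \<bullet> \<xi> j else 0)" .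
  qed
  also have "\<dots> = (\<Sum>i\<in>A. \<Sum>j\<in>A. \<Sum>S\<in>P. (if i \<in> S \<and> j \<in> S then \<xi> i \<bullet> \<xi> j else 0))"
    by (subst sum.swap, intro sum.cong refl, rule sum.swap)
  also have "\<dots> = (\<Sum>i\<in>A. \<Sum>j\<in>A. real (card {S\<in>P. i \<in> S \<and> j \<in> S}) * (\<xi> i \<bullet> \<xi> j))"
    using finP by (simp add: sum.If_cases Int_def conj_commute)
  also have "\<dots> = (\<Sum>i\<in>A. \<Sum>j\<in>A. real N2 * (\<xi> i \<bullet> \<xi> j) + (if i = j then (real N1 - real N2) * (\<xi> i \<bullet> \<xi> j) else 0))"
    by (intro sum.cong refl) (auto simp: count left_diff_distrib)
  also have "\<dots> = real N2 * ((\<Sum>i\<in>A. \<xi> i) \<bullet> (\<Sum>i\<in>A. \<xi> i)) + (real N1 - real N2) * (\<Sum>i\<in>A. \<xi> i \<bullet> \<xi> i)"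
  proof -
    have "(\<Sum>i\<in>A. \<xi> i) \<bullet> (\<Sum>i\<in>A. \<xi> i) = (\<Sum>i\<in>A. \<Sum>j\<in>A. \<xi> i \<bullet> \<xi> j)"
      unfolding inner_sum_left inner_sum_right by (rule sum.swap)
    then show ?thesis using A by (simp add: sum.distrib sum_distrib_left)
  qed
  also have "\<dots> = (real N1 - real N2) * (\<Sum>i\<in>A. (norm (\<xi> i))\<^sup>2)" by (simp add: zero power2_norm_eq_inner)
  also have "\<dots> \<le> real N1 * (\<Sum>i\<in>A. (norm (\<xi> i))\<^sup>2)" by (intro mult_right_mono sum_nonneg) auto
  also have "real N1 = real (card A choose B) * real B / real (card A)"
  proof -
    obtain a b where ab: "card A = Suc a" "B = Suc b" using B by (cases "card A"; cases B) auto
    have "real (Suc b) * real (Suc a choose Suc b) = real (Suc a) * real (a choose b)"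
      by (metis Suc_times_binomial of_nat_mult)
    then show ?thesis
      by (simp add: N1_def ab nonzero_eq_divide_eq mult.commute del: of_nat_Suc binomial_Suc_Suc)
  qed
  finally show ?thesis by (simp add: P_def)
qed

section \<open>One full epoch of Natasha1.5\<close>

lemma sum_norm_sq_centered:
  fixes a :: "'i \<Rightarrow> 'a::real_inner"
  assumes "finite I" "I \<noteq> {}"
  defines "m \<equiv> (1 / real (card I)) *\<^sub>R (\<Sum>i\<in>I. a i)"
  shows "(\<Sum>i\<in>I. (norm (a i - m))\<^sup>2) = (\<Sum>i\<in>I. (norm (a i))\<^sup>2) - real (card I) * (norm m)\<^sup>2"
proof -
  have m: "(\<Sum>i\<in>I. a i) = real (card I) *\<^sub>R m" using assms by (simp add: m_def)
  have "(\<Sum>i\<in>I. (norm (a i - m))\<^sup>2) = (\<Sum>i\<in>I. (norm (a i))\<^sup>2 - 2 * (a i \<bullet> m) + (norm m)\<^sup>2)"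
    by (intro sum.cong refl)
       (simp add: power2_norm_eq_inner inner_diff_left inner_diff_right inner_commute)
  also have "\<dots> = (\<Sum>i\<in>I. (norm (a i))\<^sup>2) - 2 * ((\<Sum>i\<in>I. a i) \<bullet> m) + real (card I) * (norm m)\<^sup>2"
    by (simp add: sum.distrib sum_subtractf inner_sum_left sum_distrib_left)
  finally show ?thesis by (simp add: m power2_norm_eq_inner)
qed

lemma norm_add_sq_le: "(norm (a + b :: 'a::real_inner))\<^sup>2 \<le> 2 * (norm a)\<^sup>2 + 2 * (norm b)\<^sup>2"
proof -
  have "0 \<le> (norm (a - b))\<^sup>2" by simp
  then show ?thesis
    by (simp add: power2_norm_eq_inner inner_diff_left inner_diff_right inner_add_left inner_add_right inner_commute)
qed

lemma norm_diff_sq_le_path: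
  fixes x :: "nat \<Rightarrow> 'a::real_inner"
  shows "(norm (x s - x 0))\<^sup>2 \<le> real s * (\<Sum>j<s. (norm (x (Suc j) - x j))\<^sup>2)"
proof -
  have "x s - x 0 = (\<Sum>j<s. x (Suc j) - x j)" by (simp add: sum_lessThan_telescope)
  then have "norm (x s - x 0) \<le> (\<Sum>j<s. norm (x (Suc j) - x j))" by (simp add: norm_sum)
  then have "(norm (x s - x 0))\<^sup>2 \<le> (\<Sum>j<s. norm (x (Suc j) - x j))\<^sup>2" by (intro power_mono) auto
  also have "\<dots> \<le> (\<Sum>j<s. (norm (x (Suc j) - x j))\<^sup>2) * real (card {..<s})"
    by (rule sum_squared_le_sum_of_squares)
  finally show ?thesis by (simp add: mult.commute)
qed

text \<open>\<open>step_small\<close> lets the decrease of one step absorb the squared gradient, and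
  \<open>sub_long\<close> makes a sub-epoch long enough to forget its starting distance.
  \<open>step_small_sub\<close> controls the variance due to moves within a sub-epoch,
  \<open>step_small_epoch\<close> the variance due to the drift from the snapshot over all
  sub-epochs.\<close>

locale epoch = natasha15 n d F x_start B p m alpha sigma + W: weakly_convex d "average n F" M sigma
  for n d F x_start B p m alpha sigma M +
  fixes V :: real
  assumes n_pos: "1 \<le> n" and B_range: "B \<in> {1..n}" and p_pos: "1 \<le> p" and m_pos: "1 \<le> m"
    and x_start: "x_start \<in> euclid d"
    and F_diff: "\<And>i x. i \<in> {1..n} \<Longrightarrow> x \<in> euclid d \<Longrightarrow> F i differentiable (at x within euclid d)"
    and F_smooth: "\<And>i. i \<in> {1..n} \<Longrightarrow> smooth d M (F i)"
    and F_var: "variance_le n d F V"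
    and alpha_pos: "0 < alpha"
    and step_small: "4 * alpha * (M + 2 * sigma) \<le> 1"
    and sub_long: "16 \<le> alpha * real m * sigma"
    and step_small_sub: "64 * alpha * M\<^sup>2 \<le> sigma"
    and step_small_epoch: "4 * (real p)\<^sup>2 * alpha * M\<^sup>2 \<le> sigma"
begin

abbreviation "Fa \<equiv> average n F"
abbreviation "G i x \<equiv> gradient d (F i) x"
abbreviation "dist_prox x \<equiv> norm (x - W.prox x)"

lemma G_euclid [intro]: "i \<in> {1..n} \<Longrightarrow> x \<in> euclid d \<Longrightarrow> G i x \<in> euclid d"
  using F_diff gradient_euclid by blast

lemma grad_Fa: "x \<in> euclid d \<Longrightarrow> W.grad x = (1 / real n) *\<^sub>R (\<Sum>i=1..n. G i x)"
  using F_diff by (intro gradient_average) auto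

abbreviation "next_point mu xhat x i \<equiv> x - alpha *\<^sub>R (G i x - G i x_start + mu + (2 * sigma) *\<^sub>R (x - xhat))"

lemma next_point_euclid:
  "i \<in> {1..n} \<Longrightarrow> mu \<in> euclid d \<Longrightarrow> xhat \<in> euclid d \<Longrightarrow> x \<in> euclid d \<Longrightarrow> next_point mu xhat x i \<in> euclid d"
  using x_start by (intro euclid_diff euclid_scaleR euclid_add) auto

text \<open>The mean of the update direction is the regularized gradient plus the bias
  \<open>e\<close>. The snapshot gradient serves as control variate: the direction varies only
  through \<open>u\<close>, and centering lowers the second moment, so the variance is at most M^2
  |x - x_start|^2. The squared mean is absorbed by the decrease through \<open>rgrad_sq_le\<close>
  and \<open>step_small\<close>.\<close>

lemma one_step:
  assumes mu: "mu \<in> euclid d" and xhat: "xhat \<in> euclid d" and x: "x \<in> euclid d"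
  defines "e \<equiv> mu - W.grad x_start" and "z \<equiv> W.prox xhat"
  shows "(\<Sum>i=1..n. (norm (next_point mu xhat x i - z))\<^sup>2) / real n \<le>
    (norm (x - z))\<^sup>2 - alpha * (W.reg xhat x - W.reg xhat z) - alpha * sigma / 2 * (norm (x - z))\<^sup>2
    + 4 * alpha / sigma * (norm e)\<^sup>2 + alpha\<^sup>2 * M\<^sup>2 * (norm (x - x_start))\<^sup>2"
proof -
  define u where "u i = G i x - G i x_start" for i
  define g where "g i = u i + mu + (2 * sigma) *\<^sub>R (x - xhat)" for i
  define r where "r = W.rgrad xhat x"
  define D where "D = W.reg xhat x - W.reg xhat z"
  have z: "z \<in> euclid d" using xhat by (auto simp: z_def)
  have D: "0 \<le> D" unfolding D_def z_def using W.prox_le[OF xhat x] by simp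
  have n: "0 < real n" using n_pos by simp
  have card: "card {1..n} = n" by simp
  have u_mean: "(1 / real n) *\<^sub>R (\<Sum>i=1..n. u i) = W.grad x - W.grad x_start"
    using grad_Fa x x_start by (simp add: u_def sum_subtractf scaleR_diff_right)
  have "(1 / real n) *\<^sub>R (\<Sum>i=1..n. g i) = (1 / real n) *\<^sub>R (\<Sum>i=1..n. u i) + mu + (2 * sigma) *\<^sub>R (x - xhat)"
    using n by (simp add: g_def sum.distrib scaleR_add_right sum_constant_scaleR)
  then have g_mean: "(1 / real n) *\<^sub>R (\<Sum>i=1..n. g i) = r + e"
    unfolding u_mean by (simp add: r_def e_def)
  have g_sum: "(\<Sum>i=1..n. g i) = real n *\<^sub>R (r + e)" unfolding g_mean[symmetric] using n by simp
  have "(\<Sum>i=1..n. (norm (g i - (r + e)))\<^sup>2) = (\<Sum>i=1..n. (norm (u i - (W.grad x - W.grad x_start)))\<^sup>2)"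
    by (intro sum.cong refl arg_cong[where f = "\<lambda>v. (norm v)\<^sup>2"]) (simp add: g_def r_def e_def)
  also have "\<dots> \<le> (\<Sum>i=1..n. (norm (u i))\<^sup>2)"
    using sum_norm_sq_centered[of "{1..n}" u] n_pos by (simp add: u_mean[symmetric])
  finally have "(\<Sum>i=1..n. (norm (g i - (r + e)))\<^sup>2) \<le> (\<Sum>i=1..n. (norm (u i))\<^sup>2)" .
  also have "\<dots> \<le> (\<Sum>i=1..n. M\<^sup>2 * (norm (x - x_start))\<^sup>2)"
  proof (intro sum_mono)
    fix i assume "i \<in> {1..n}"
    then have "norm (u i) \<le> M * norm (x - x_start)"
      using F_smooth x x_start by (auto simp: smooth_def u_def)
    then have "(norm (u i))\<^sup>2 \<le> (M * norm (x - x_start))\<^sup>2" by (intro power_mono) auto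
    then show "(norm (u i))\<^sup>2 \<le> M\<^sup>2 * (norm (x - x_start))\<^sup>2" by (simp add: power_mult_distrib)
  qed
  finally have "(\<Sum>i=1..n. (norm (g i - (r + e)))\<^sup>2) \<le> real n * (M\<^sup>2 * (norm (x - x_start))\<^sup>2)" by simp
  moreover have "(\<Sum>i=1..n. (norm (g i - (r + e)))\<^sup>2) = (\<Sum>i=1..n. (norm (g i))\<^sup>2) - real n * (norm (r + e))\<^sup>2"
    using sum_norm_sq_centered[of "{1..n}" g] n_pos unfolding card g_mean by simp
  ultimately have var: "(\<Sum>i=1..n. (norm (g i))\<^sup>2) \<le> real n * ((norm (r + e))\<^sup>2 + M\<^sup>2 * (norm (x - x_start))\<^sup>2)"
    by (simp add: algebra_simps)
  have "(\<Sum>i=1..n. (norm (next_point mu xhat x i - z))\<^sup>2)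
      = (\<Sum>i=1..n. (norm (x - z))\<^sup>2 - 2 * alpha * ((x - z) \<bullet> g i) + alpha\<^sup>2 * (norm (g i))\<^sup>2)"
  proof (intro sum.cong refl)
    fix i
    have "next_point mu xhat x i - z = (x - z) - alpha *\<^sub>R g i" by (simp add: g_def u_def)
    then show "(norm (next_point mu xhat x i - z))\<^sup>2 = (norm (x - z))\<^sup>2 - 2 * alpha * ((x - z) \<bullet> g i) + alpha\<^sup>2 * (norm (g i))\<^sup>2"
      by (simp only: power2_norm_eq_inner)
         (simp add: inner_diff_left inner_diff_right inner_commute power2_eq_square algebra_simps)
  qed
  also have "\<dots> = real n * (norm (x - z))\<^sup>2 - 2 * alpha * ((x - z) \<bullet> (\<Sum>i=1..n. g i)) + alpha\<^sup>2 * (\<Sum>i=1..n. (norm (g i))\<^sup>2)"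
    by (simp add: sum.distrib sum_subtractf inner_sum_right sum_distrib_left)
  also have "\<dots> \<le> real n * (norm (x - z))\<^sup>2 - 2 * alpha * ((x - z) \<bullet> (\<Sum>i=1..n. g i))
      + alpha\<^sup>2 * (real n * ((norm (r + e))\<^sup>2 + M\<^sup>2 * (norm (x - x_start))\<^sup>2))"
    using var by (intro add_left_mono mult_left_mono) auto
  also have "\<dots> = real n * ((norm (x - z))\<^sup>2 - 2 * alpha * ((x - z) \<bullet> (r + e))
      + alpha\<^sup>2 * ((norm (r + e))\<^sup>2 + M\<^sup>2 * (norm (x - x_start))\<^sup>2))"
    unfolding g_sum inner_scaleR_right by (simp add: algebra_simps)
  finally have main: "(\<Sum>i=1..n. (norm (next_point mu xhat x i - z))\<^sup>2) / real n \<le> (norm (x - z))\<^sup>2 - 2 * alpha * ((x - z) \<bullet> (r + e))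
      + alpha\<^sup>2 * ((norm (r + e))\<^sup>2 + M\<^sup>2 * (norm (x - x_start))\<^sup>2)"
    using n by (simp add: field_simps)
  have s: "0 < sigma" by (rule W.s_pos)
  have "alpha * sigma \<le> alpha * (4 * (M + 2 * sigma))"
    using alpha_pos s W.M_nonneg by (intro mult_left_mono) auto
  then have as: "alpha * sigma \<le> 1" using step_small by (simp add: algebra_simps)
  have inner_r: "D + sigma / 2 * (norm (x - z))\<^sup>2 \<le> (x - z) \<bullet> r"
    using W.reg_lower[OF x z, of xhat] by (simp add: D_def r_def inner_diff_left inner_diff_right inner_commute[of _ "W.rgrad xhat x"] norm_minus_commute)
  \<comment> \<open>Young's inequality, weighted so that half of the strong convexity in
    \<open>inner_r\<close> pays for the bias \<open>e\<close>. The bias does not average out over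
    the steps because \<open>mu\<close> is fixed for the whole epoch.\<close>
  have inner_e: "- ((x - z) \<bullet> e) \<le> 1 / sigma * (norm e)\<^sup>2 + sigma / 4 * (norm (x - z))\<^sup>2"
  proof -
    have "0 \<le> (norm ((1 / sigma) *\<^sub>R e + (1 / 2) *\<^sub>R (x - z)))\<^sup>2" by simp
    also have "\<dots> = (1 / sigma)\<^sup>2 * (norm e)\<^sup>2 + (1 / sigma) * ((x - z) \<bullet> e) + 1 / 4 * (norm (x - z))\<^sup>2"
      by (simp only: power2_norm_eq_inner inner_add_left inner_add_right inner_scaleR_left inner_scaleR_right inner_commute[of e "x - z"])
         (simp add: power2_eq_square add_divide_distrib)
    finally have "0 \<le> sigma * ((1 / sigma)\<^sup>2 * (norm e)\<^sup>2 + (1 / sigma) * ((x - z) \<bullet> e) + 1 / 4 * (norm (x - z))\<^sup>2)"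
      using s by simp
    also have "\<dots> = 1 / sigma * (norm e)\<^sup>2 + (x - z) \<bullet> e + sigma / 4 * (norm (x - z))\<^sup>2"
      using s by (simp add: distrib_left power2_eq_square)
    finally show ?thesis by simp
  qed
  have r_sq: "(norm r)\<^sup>2 \<le> 2 * (M + 2 * sigma) * D"
    unfolding r_def D_def z_def by (rule W.rgrad_sq_le[OF x xhat])
  have "alpha\<^sup>2 * (norm (r + e))\<^sup>2 \<le> alpha\<^sup>2 * (2 * (2 * (M + 2 * sigma) * D) + 2 * (norm e)\<^sup>2)"
    using norm_add_sq_le[of r e] r_sq by (intro mult_left_mono) auto
  also have "\<dots> = alpha * (4 * alpha * (M + 2 * sigma)) * D + 2 * alpha / sigma * (alpha * sigma) * (norm e)\<^sup>2"
    using s by (simp add: power2_eq_square algebra_simps)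
  also have "\<dots> \<le> alpha * 1 * D + 2 * alpha / sigma * 1 * (norm e)\<^sup>2"
    using step_small as alpha_pos D s by (intro add_mono mult_right_mono mult_left_mono) auto
  finally have sq: "alpha\<^sup>2 * (norm (r + e))\<^sup>2 \<le> alpha * D + 2 * alpha / sigma * (norm e)\<^sup>2" by simp
  have "- ((x - z) \<bullet> (r + e)) \<le> - D - sigma / 4 * (norm (x - z))\<^sup>2 + 1 / sigma * (norm e)\<^sup>2"
    using inner_r inner_e by (simp add: inner_add_right)
  then have "2 * alpha * (- ((x - z) \<bullet> (r + e))) \<le> 2 * alpha * (- D - sigma / 4 * (norm (x - z))\<^sup>2 + 1 / sigma * (norm e)\<^sup>2)"
    using alpha_pos by (intro mult_left_mono) auto
  then show ?thesis using main sq unfolding D_def[symmetric] by (simp add: algebra_simps)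
qed

lemma inner_loop_support:
  assumes "mu \<in> euclid d" "xhat \<in> euclid d"
  shows "finite (set_pmf (inner_loop mu xhat t))"
    and "x \<in> set_pmf (inner_loop mu xhat t) \<Longrightarrow> k \<le> t \<Longrightarrow> x k \<in> euclid d"
proof (induction t arbitrary: x k)
  case 0
  { case 1 then show ?case by simp }
  { case 2 then show ?case using assms by simp }
next
  case (Suc t)
  { case 1 then show ?case using Suc.IH(1) n_pos by (auto intro!: finite_UN_I simp: set_pmf_of_set) }
  { case 2
    then obtain x' i where x': "x' \<in> set_pmf (inner_loop mu xhat t)" and i: "i \<in> {1..n}"
      and x: "x = x'(Suc t := next_point mu xhat (x' t) i)"
      using n_pos by (auto simp: set_pmf_of_set)
    show ?case
    proof (cases "k = Suc t")
      case True
      then show ?thesis using x Suc.IH(2)[OF x', of t] i assms by (simp add: next_point_euclid)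
    next
      case False
      then show ?thesis using x Suc.IH(2)[OF x', of k] 2 by simp
    qed }
qed

lemma expect_inner_loop_Suc:
  assumes "mu \<in> euclid d" "xhat \<in> euclid d"
  shows "expect (inner_loop mu xhat (Suc t)) h =
    expect (inner_loop mu xhat t) (\<lambda>x. (\<Sum>i=1..n. h (x(Suc t := next_point mu xhat (x t) i))) / real n)"
  using inner_loop_support(1)[OF assms] n_pos
  by (simp add: expect_bind set_pmf_of_set expect_of_set set_bind_pmf)

lemma expect_inner_loop_prefix:
  assumes "mu \<in> euclid d" "xhat \<in> euclid d" "t \<le> t'"
  shows "expect (inner_loop mu xhat t') (\<lambda>x. h (x t)) = expect (inner_loop mu xhat t) (\<lambda>x. h (x t))"
  using assms(3)
proof (induction t' rule: dec_induct)
  case (step k)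
  then show ?case using n_pos by (simp only: expect_inner_loop_Suc[OF assms(1,2)]) simp
qed simp

section \<open>Descent over one sub-epoch\<close>

definition sub_step :: "rvec \<Rightarrow> rvec \<Rightarrow> rvec pmf"
  where "sub_step mu xhat = do {x \<leftarrow> inner_loop mu xhat m; t \<leftarrow> pmf_of_set {..<m}; return_pmf (x t)}"

lemma lessThan_m: "{..<m} \<noteq> {}" "finite {..<m}"
  using m_pos by (auto simp: lessThan_empty_iff)

lemma sub_step_support:
  assumes "mu \<in> euclid d" "xhat \<in> euclid d"
  shows "finite (set_pmf (sub_step mu xhat))" "set_pmf (sub_step mu xhat) \<subseteq> euclid d"
  using inner_loop_support[OF assms] lessThan_m
  by (auto simp: sub_step_def set_pmf_of_set)

lemma expect_sub_step:
  assumes "mu \<in> euclid d" "xhat \<in> euclid d"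
  shows "expect (sub_step mu xhat) h = (\<Sum>t<m. expect (inner_loop mu xhat t) (\<lambda>x. h (x t))) / real m"
proof -
  have "expect (sub_step mu xhat) h = expect (inner_loop mu xhat m) (\<lambda>x. (\<Sum>t<m. h (x t)) / real m)"
    unfolding sub_step_def using inner_loop_support(1)[OF assms] lessThan_m
    by (simp add: expect_bind set_pmf_of_set expect_of_set set_bind_pmf)
  also have "\<dots> = (\<Sum>t<m. expect (inner_loop mu xhat m) (\<lambda>x. h (x t))) / real m"
    using inner_loop_support(1)[OF assms] by (simp add: integrable_measure_pmf_finite)
  also have "\<dots> = (\<Sum>t<m. expect (inner_loop mu xhat t) (\<lambda>x. h (x t))) / real m"
    by (intro arg_cong2[where f = "(/)"] sum.cong refl expect_inner_loop_prefix assms) auto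
  finally show ?thesis .
qed

text \<open>Summed over the inner steps, \<open>one_step\<close> telescopes, and the sum of the
  \<open>D t\<close> divided by \<open>m\<close> is the expected suboptimality of the random
  iterate. The distance to the snapshot is split at \<open>xhat\<close> and \<open>z\<close>. By
  \<open>sub_long\<close> and \<open>step_small_sub\<close> the multiples of \<open>Z\<close> stay
  below sigma / 4, while strong convexity puts \<open>xhat\<close> at least sigma / 2 times
  \<open>Z\<close> above the minimum.\<close>

lemma sub_step_descent:
  assumes mu: "mu \<in> euclid d" and xhat: "xhat \<in> euclid d"
  defines "e \<equiv> mu - W.grad x_start"
  shows "expect (sub_step mu xhat) (\<lambda>x. Fa x + sigma * (norm (x - xhat))\<^sup>2) \<le>
    Fa xhat - sigma / 4 * (dist_prox xhat)\<^sup>2 + 4 / sigma * (norm e)\<^sup>2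
      + 2 * alpha * M\<^sup>2 * (norm (xhat - x_start))\<^sup>2"
proof -
  define z where "z = W.prox xhat"
  have z: "z \<in> euclid d" using xhat by (auto simp: z_def)
  have s: "0 < sigma" by (rule W.s_pos)
  define I where "I t = inner_loop mu xhat t" for t
  have fin: "finite (set_pmf (I t))" for t unfolding I_def by (rule inner_loop_support(1)[OF mu xhat])
  define a where "a t = expect (I t) (\<lambda>x. (norm (x t - z))\<^sup>2)" for t
  define D where "D t = expect (I t) (\<lambda>x. W.reg xhat (x t) - W.reg xhat z)" for t
  define Z where "Z = (norm (xhat - z))\<^sup>2"
  define C where "C = 4 * alpha / sigma * (norm e)\<^sup>2 + alpha\<^sup>2 * M\<^sup>2 * (4 * Z + 2 * (norm (xhat - x_start))\<^sup>2)"
  have step: "a (Suc t) \<le> a t - alpha * D t - (alpha * sigma / 2 - 4 * alpha\<^sup>2 * M\<^sup>2) * a t + C" for t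
  proof -
    have "a (Suc t) = expect (I t) (\<lambda>x. (\<Sum>i=1..n. (norm (next_point mu xhat (x t) i - z))\<^sup>2) / real n)"
      unfolding a_def I_def by (subst expect_inner_loop_Suc[OF mu xhat]) simp
    also have "\<dots> \<le> expect (I t) (\<lambda>x. (norm (x t - z))\<^sup>2 - alpha * (W.reg xhat (x t) - W.reg xhat z)
        - (alpha * sigma / 2 - 4 * alpha\<^sup>2 * M\<^sup>2) * (norm (x t - z))\<^sup>2 + C)"
    proof (rule expect_mono[OF fin])
      fix x assume "x \<in> set_pmf (I t)"
      then have x: "x t \<in> euclid d" unfolding I_def using inner_loop_support(2)[OF mu xhat] by auto
      have "(norm (x t - x_start))\<^sup>2 \<le> 2 * (norm (x t - xhat))\<^sup>2 + 2 * (norm (xhat - x_start))\<^sup>2"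
        using norm_add_sq_le[of "x t - xhat" "xhat - x_start"] by simp
      moreover have "(norm (x t - xhat))\<^sup>2 \<le> 2 * (norm (x t - z))\<^sup>2 + 2 * Z"
        using norm_add_sq_le[of "x t - z" "z - xhat"] by (simp add: Z_def norm_minus_commute)
      ultimately have "(norm (x t - x_start))\<^sup>2 \<le> 4 * (norm (x t - z))\<^sup>2 + (4 * Z + 2 * (norm (xhat - x_start))\<^sup>2)"
        by linarith
      then have "alpha\<^sup>2 * M\<^sup>2 * (norm (x t - x_start))\<^sup>2 \<le>
          alpha\<^sup>2 * M\<^sup>2 * (4 * (norm (x t - z))\<^sup>2 + (4 * Z + 2 * (norm (xhat - x_start))\<^sup>2))"
        by (intro mult_left_mono) auto
      then show "(\<Sum>i=1..n. (norm (next_point mu xhat (x t) i - z))\<^sup>2) / real n \<le>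
          (norm (x t - z))\<^sup>2 - alpha * (W.reg xhat (x t) - W.reg xhat z)
          - (alpha * sigma / 2 - 4 * alpha\<^sup>2 * M\<^sup>2) * (norm (x t - z))\<^sup>2 + C"
        using one_step[OF mu xhat x] unfolding C_def e_def[symmetric] z_def[symmetric]
        by (simp add: algebra_simps)
    qed
    also have "\<dots> = a t - alpha * D t - (alpha * sigma / 2 - 4 * alpha\<^sup>2 * M\<^sup>2) * a t + C"
      unfolding a_def D_def using fin[of t] by (simp only: expect_add expect_diff expect_cmult) simp
    finally show ?thesis .
  qed
  have a0: "a 0 = Z" by (simp add: a_def I_def Z_def)
  have a_nonneg: "0 \<le> a t" for t
    unfolding a_def by (simp add: expect_sum[OF fin] sum_nonneg)
  have tele: "a k + alpha * (\<Sum>t<k. D t) + (alpha * sigma / 2 - 4 * alpha\<^sup>2 * M\<^sup>2) * (\<Sum>t<k. a t) \<le> Z + real k * C" for k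
  proof (induction k)
    case (Suc k)
    then show ?case using step[of k] by (simp add: algebra_simps add_divide_distrib)
  qed (simp add: a0)
  have coef: "0 \<le> alpha * sigma / 2 - 4 * alpha\<^sup>2 * M\<^sup>2"
  proof -
    have "alpha * (64 * alpha * M\<^sup>2) \<le> alpha * sigma" using step_small_sub alpha_pos by (intro mult_left_mono) auto
    moreover have "0 \<le> alpha * sigma" using alpha_pos s by simp
    ultimately show ?thesis by (simp add: power2_eq_square algebra_simps)
  qed
  have "alpha * (\<Sum>t<m. D t) \<le> Z + real m * C"
    using tele[of m] a_nonneg mult_nonneg_nonneg[OF coef sum_nonneg[of "{..<m}" a]] by (smt (verit))
  then have "(\<Sum>t<m. D t) / real m \<le> Z / (alpha * real m) + C / alpha"
    using alpha_pos m_pos by (simp add: field_simps)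
  also have "Z / (alpha * real m) \<le> sigma / 16 * Z"
  proof -
    have "0 < alpha * real m" using alpha_pos m_pos by simp
    moreover have "16 * Z \<le> alpha * real m * sigma * Z"
      using sub_long by (intro mult_right_mono) (auto simp: Z_def)
    ultimately show ?thesis by (simp add: field_simps)
  qed
  also have "C / alpha = 4 / sigma * (norm e)\<^sup>2 + (4 * alpha * M\<^sup>2) * Z + 2 * alpha * M\<^sup>2 * (norm (xhat - x_start))\<^sup>2"
    using alpha_pos by (simp add: C_def add_divide_distrib power2_eq_square algebra_simps)
  also have "(4 * alpha * M\<^sup>2) * Z \<le> (sigma / 16) * Z"
    using step_small_sub by (intro mult_right_mono) (auto simp: Z_def)
  finally have Dbar': "(\<Sum>t<m. D t) / real m \<le> sigma / 16 * Z + (4 / sigma * (norm e)\<^sup>2 + sigma / 16 * Z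
      + 2 * alpha * M\<^sup>2 * (norm (xhat - x_start))\<^sup>2)" by simp
  have "0 \<le> sigma * Z" using s by (simp add: Z_def)
  then have Dbar: "(\<Sum>t<m. D t) / real m \<le> sigma / 4 * Z + 4 / sigma * (norm e)\<^sup>2
      + 2 * alpha * M\<^sup>2 * (norm (xhat - x_start))\<^sup>2"
    using Dbar' by (simp add: algebra_simps)
  have "expect (sub_step mu xhat) (\<lambda>x. Fa x + sigma * (norm (x - xhat))\<^sup>2)
      = expect (sub_step mu xhat) (\<lambda>x. (W.reg xhat x - W.reg xhat z) + W.reg xhat z)"
    by (simp add: W.reg_def)
  also have "\<dots> = (\<Sum>t<m. D t) / real m + W.reg xhat z"
    unfolding expect_add[OF sub_step_support(1)[OF mu xhat]]
    using m_pos by (simp only: expect_sub_step[OF mu xhat] D_def I_def) simp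
  also have "W.reg xhat z \<le> Fa xhat - sigma / 2 * Z"
    using W.reg_prox_growth[OF xhat xhat] by (simp add: z_def Z_def W.reg_def)
  finally show ?thesis using Dbar by (simp add: Z_def z_def)
qed

section \<open>Descent over the successive sub-epochs\<close>

lemma sub_epochs_Suc:
  "sub_epochs mu (Suc s) = sub_epochs mu s \<bind> (\<lambda>xh. map_pmf (\<lambda>x. xh(Suc s := x)) (sub_step mu (xh s)))"
  by (simp add: sub_step_def map_bind_pmf)

lemma sub_epochs_support:
  assumes mu: "mu \<in> euclid d"
  shows "finite (set_pmf (sub_epochs mu s))"
    and "xh \<in> set_pmf (sub_epochs mu s) \<Longrightarrow> xh 0 = x_start"
    and "xh \<in> set_pmf (sub_epochs mu s) \<Longrightarrow> k \<le> s \<Longrightarrow> xh k \<in> euclid d"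
proof (induction s arbitrary: xh k)
  case 0
  { case 1 then show ?case by simp }
  { case 2 then show ?case by simp }
  { case 3 then show ?case using x_start by simp }
next
  case (Suc s)
  have sub: "finite (set_pmf (sub_step mu (xh s)))" "set_pmf (sub_step mu (xh s)) \<subseteq> euclid d"
    if "xh \<in> set_pmf (sub_epochs mu s)" for xh
    using sub_step_support[OF mu Suc.IH(3)[OF that]] by auto
  have ex: "\<exists>xh' x. xh' \<in> set_pmf (sub_epochs mu s) \<and> x \<in> euclid d \<and> xh = xh'(Suc s := x)"
    if *: "xh \<in> set_pmf (sub_epochs mu (Suc s))" for xh
  proof -
    obtain xh' x where "xh' \<in> set_pmf (sub_epochs mu s)" "x \<in> set_pmf (sub_step mu (xh' s))" "xh = xh'(Suc s := x)"
      using * unfolding sub_epochs_Suc by auto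
    then show ?thesis using sub(2) by blast
  qed
  { case 1 then show ?case unfolding sub_epochs_Suc using Suc.IH(1) sub by auto }
  { case 2 then show ?case using ex Suc.IH(2) by auto }
  { case 3
    then obtain xh' x where "xh' \<in> set_pmf (sub_epochs mu s)" "x \<in> euclid d" "xh = xh'(Suc s := x)" using ex[OF 3(1)] by blast
    then show ?case using Suc.IH(3)[of xh' k] 3 by (cases "k = Suc s") auto }
qed

text \<open>The weight of the squared lengths of the moves decreases from \<open>sigma\<close> to \<open>sigma / 2\<close>; the
  difference pays for the variance that every later sub-epoch incurs.\<close>

lemma sub_epochs_descent:
  assumes mu: "mu \<in> euclid d" and s: "s \<le> p"
  defines "e \<equiv> mu - W.grad x_start"
  defines "P \<equiv> \<lambda>s xh. Fa (xh s) + (\<Sum>j<s. sigma / 4 * (dist_prox (xh j))\<^sup>2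
      + (sigma - real s * (sigma / (2 * real p))) * (norm (xh (Suc j) - xh j))\<^sup>2)"
  shows "expect (sub_epochs mu s) (P s) \<le> Fa x_start + real s * (4 / sigma * (norm e)\<^sup>2)"
  using s
proof (induction s)
  case (Suc s)
  have sg: "0 < sigma" by (rule W.s_pos)
  have pp: "0 < real p" using p_pos by simp
  have "expect (sub_epochs mu (Suc s)) (P (Suc s))
      = expect (sub_epochs mu s) (\<lambda>xh. expect (sub_step mu (xh s)) (\<lambda>x. P (Suc s) (xh(Suc s := x))))"
    unfolding sub_epochs_Suc using sub_epochs_support[OF mu] sub_step_support[OF mu]
    by (subst expect_bind) auto
  also have "\<dots> \<le> expect (sub_epochs mu s) (\<lambda>xh. P s xh + 4 / sigma * (norm e)\<^sup>2)"
  proof (rule expect_mono)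
    fix xh assume xh: "xh \<in> set_pmf (sub_epochs mu s)"
    let ?c = "sigma - real (Suc s) * (sigma / (2 * real p))"
    define A where "A = (\<Sum>j<s. (norm (xh (Suc j) - xh j))\<^sup>2)"
    have A: "0 \<le> A" by (simp add: A_def sum_nonneg)
    have xs: "xh s \<in> euclid d" using sub_epochs_support(3)[OF mu xh] by simp
    have c: "?c \<le> sigma" using sg pp by simp
    have fin: "finite (set_pmf (sub_step mu (xh s)))" using sub_step_support(1)[OF mu xs] .
    have sumeq: "(\<Sum>j<s. sigma / 4 * (dist_prox (xh j))\<^sup>2 + c * (norm (xh (Suc j) - xh j))\<^sup>2)
        = (\<Sum>j<s. sigma / 4 * (dist_prox (xh j))\<^sup>2) + c * A" for c
      by (simp add: A_def sum.distrib sum_distrib_left)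
    have "expect (sub_step mu (xh s)) (\<lambda>x. P (Suc s) (xh(Suc s := x)))
        \<le> expect (sub_step mu (xh s)) (\<lambda>x. (Fa x + sigma * (norm (x - xh s))\<^sup>2)
            + (sigma / 4 * (dist_prox (xh s))\<^sup>2 + ((\<Sum>j<s. sigma / 4 * (dist_prox (xh j))\<^sup>2) + ?c * A)))"
    proof (rule expect_mono[OF fin])
      fix x
      have "(\<Sum>j<s. sigma / 4 * (dist_prox ((xh(Suc s := x)) j))\<^sup>2 + ?c * (norm ((xh(Suc s := x)) (Suc j) - (xh(Suc s := x)) j))\<^sup>2)
          = (\<Sum>j<s. sigma / 4 * (dist_prox (xh j))\<^sup>2) + ?c * A"
        unfolding sumeq[symmetric] by (intro sum.cong) auto
      moreover have "?c * (norm (x - xh s))\<^sup>2 \<le> sigma * (norm (x - xh s))\<^sup>2"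
        using c by (intro mult_right_mono) auto
      ultimately show "P (Suc s) (xh(Suc s := x)) \<le> (Fa x + sigma * (norm (x - xh s))\<^sup>2)
            + (sigma / 4 * (dist_prox (xh s))\<^sup>2 + ((\<Sum>j<s. sigma / 4 * (dist_prox (xh j))\<^sup>2) + ?c * A))"
        unfolding P_def sum.lessThan_Suc by simp
    qed
    also have "\<dots> = expect (sub_step mu (xh s)) (\<lambda>x. Fa x + sigma * (norm (x - xh s))\<^sup>2)
            + (sigma / 4 * (dist_prox (xh s))\<^sup>2 + ((\<Sum>j<s. sigma / 4 * (dist_prox (xh j))\<^sup>2) + ?c * A))"
      by (subst expect_add[OF fin]) simp
    also have "\<dots> \<le> Fa (xh s) + 4 / sigma * (norm e)\<^sup>2 + 2 * alpha * M\<^sup>2 * (norm (xh s - x_start))\<^sup>2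
        + ((\<Sum>j<s. sigma / 4 * (dist_prox (xh j))\<^sup>2) + ?c * A)"
      using sub_step_descent[OF mu xs] by (simp add: e_def)
    \<comment> \<open>Cauchy-Schwarz over at most p moves costs a factor p, and
      \<open>step_small_epoch\<close> turns 2 alpha M^2 p into sigma / (2 p), exactly the loss of
      weight per sub-epoch.\<close>
    also have "2 * alpha * M\<^sup>2 * (norm (xh s - x_start))\<^sup>2 \<le> sigma / (2 * real p) * A"
    proof -
      have "(norm (xh s - x_start))\<^sup>2 \<le> real s * A"
        using norm_diff_sq_le_path[of xh s] sub_epochs_support(2)[OF mu xh] by (simp add: A_def)
      also have "\<dots> \<le> real p * A" using Suc.prems A by (intro mult_right_mono) auto
      finally have "2 * alpha * M\<^sup>2 * (norm (xh s - x_start))\<^sup>2 \<le> 2 * alpha * M\<^sup>2 * (real p * A)"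
        using alpha_pos by (intro mult_left_mono) auto
      also have "\<dots> = (4 * (real p)\<^sup>2 * alpha * M\<^sup>2) * (A / (2 * real p))"
        using pp by (simp add: power2_eq_square)
      also have "\<dots> \<le> sigma * (A / (2 * real p))"
        using step_small_epoch A pp by (intro mult_right_mono) auto
      finally show ?thesis by (simp add: mult.commute)
    qed
    finally have bound: "expect (sub_step mu (xh s)) (\<lambda>x. P (Suc s) (xh(Suc s := x)))
        \<le> Fa (xh s) + 4 / sigma * (norm e)\<^sup>2 + sigma / (2 * real p) * A
          + ((\<Sum>j<s. sigma / 4 * (dist_prox (xh j))\<^sup>2) + ?c * A)" by simp
    have "sigma / (2 * real p) * A + ((\<Sum>j<s. sigma / 4 * (dist_prox (xh j))\<^sup>2) + ?c * A)
        = (\<Sum>j<s. sigma / 4 * (dist_prox (xh j))\<^sup>2) + (sigma - real s * (sigma / (2 * real p))) * A"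
      by (simp add: algebra_simps add_divide_distrib)
    moreover have "P s xh = Fa (xh s) + ((\<Sum>j<s. sigma / 4 * (dist_prox (xh j))\<^sup>2)
        + (sigma - real s * (sigma / (2 * real p))) * A)"
      unfolding P_def sumeq by simp
    ultimately show "expect (sub_step mu (xh s)) (\<lambda>x. P (Suc s) (xh(Suc s := x))) \<le> P s xh + 4 / sigma * (norm e)\<^sup>2"
      using bound by linarith
  qed (rule sub_epochs_support(1)[OF mu])
  also have "\<dots> \<le> Fa x_start + real (Suc s) * (4 / sigma * (norm e)\<^sup>2)"
    unfolding expect_add[OF sub_epochs_support(1)[OF mu]] using Suc by (simp add: algebra_simps add_divide_distrib)
  finally show ?case .
qed (simp add: P_def)

section \<open>Averaging over the minibatch and over the returned sub-epoch\<close>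

definition batches :: "nat set set"
  where "batches = {S. S \<subseteq> {1..n} \<and> card S = B}"

definition batch_mean :: "nat set \<Rightarrow> rvec"
  where "batch_mean S = (1 / real B) *\<^sub>R (\<Sum>i\<in>S. G i x_start)"

lemma batches: "finite batches" "batches \<noteq> {}" "card batches = n choose B"
proof -
  show "finite batches" by (simp add: batches_def)
  show "card batches = n choose B" unfolding batches_def using n_subsets[of "{1..n}" B] by simp
  moreover have "0 < n choose B" using B_range by simp
  ultimately show "batches \<noteq> {}" by auto
qed

lemma batch_mean_euclid: "S \<in> batches \<Longrightarrow> batch_mean S \<in> euclid d"
  unfolding batch_mean_def batches_def using x_start by (intro euclid_scaleR euclid_sum G_euclid) auto

lemma batch_variance:
  "expect (pmf_of_set batches) (\<lambda>S. (norm (batch_mean S - W.grad x_start))\<^sup>2) \<le> V / real B"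
proof -
  define \<xi> where "\<xi> i = G i x_start - W.grad x_start" for i
  have n: "0 < real n" and B: "0 < real B" using n_pos B_range by auto
  have "(\<Sum>i=1..n. \<xi> i) = 0"
    using grad_Fa[OF x_start] n by (simp add: \<xi>_def sum_subtractf sum_constant_scaleR)
  then have "(\<Sum>S\<in>batches. (norm (\<Sum>i\<in>S. \<xi> i))\<^sup>2) \<le> real (n choose B) * real B / real n * (\<Sum>i=1..n. (norm (\<xi> i))\<^sup>2)"
    using sum_subsets_norm_sq_le[of "{1..n}" \<xi> B] B_range by (simp add: batches_def)
  also have "\<dots> \<le> real (n choose B) * real B / real n * (real n * V)"
  proof (intro mult_left_mono)
    have "(\<Sum>i=1..n. (norm (W.grad x_start - G i x_start))\<^sup>2) / real n \<le> V"
      using F_var x_start by (simp add: variance_le_def)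
    then show "(\<Sum>i=1..n. (norm (\<xi> i))\<^sup>2) \<le> real n * V"
      using n by (simp add: \<xi>_def norm_minus_commute field_simps)
  qed auto
  finally have le: "(\<Sum>S\<in>batches. (norm (\<Sum>i\<in>S. \<xi> i))\<^sup>2) \<le> real (n choose B) * (real B * V)" using n by simp
  have dev: "(norm (batch_mean S - W.grad x_start))\<^sup>2 = (norm (\<Sum>i\<in>S. \<xi> i))\<^sup>2 / (real B)\<^sup>2" if "S \<in> batches" for S
  proof -
    have "card S = B" using that by (simp add: batches_def)
    then have "batch_mean S - W.grad x_start = (1 / real B) *\<^sub>R (\<Sum>i\<in>S. \<xi> i)"
      using B by (simp add: batch_mean_def \<xi>_def sum_subtractf sum_constant_scaleR scaleR_diff_right)
    then show ?thesis by (simp add: power_divide)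
  qed
  have "expect (pmf_of_set batches) (\<lambda>S. (norm (batch_mean S - W.grad x_start))\<^sup>2)
      = (\<Sum>S\<in>batches. (norm (\<Sum>i\<in>S. \<xi> i))\<^sup>2) / (real B)\<^sup>2 / real (n choose B)"
    using batches by (simp add: expect_of_set dev sum_divide_distrib cong: sum.cong)
  also have "\<dots> \<le> real (n choose B) * (real B * V) / (real B)\<^sup>2 / real (n choose B)"
    using le by (intro divide_right_mono) auto
  also have "\<dots> = V / real B" using B B_range by (simp add: power2_eq_square)
  finally show ?thesis .
qed

lemma full_epoch_eq:
  "full_epoch = do {S \<leftarrow> pmf_of_set batches; xh \<leftarrow> sub_epochs (batch_mean S) p;
     s \<leftarrow> pmf_of_set {..<p}; return_pmf (xh s, xh p)}"
  by (simp add: full_epoch_def batches_def batch_mean_def Let_def)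

lemma lessThan_p: "{..<p} \<noteq> {}" "finite {..<p}"
  using p_pos by (auto simp: lessThan_empty_iff)

lemma full_epoch_support:
  "finite (set_pmf full_epoch)" "set_pmf full_epoch \<subseteq> euclid d \<times> euclid d"
  using batches lessThan_p sub_epochs_support[OF batch_mean_euclid]
  by (auto simp: full_epoch_eq set_pmf_of_set)

text \<open>The uniform choice of \<open>yh\<close> turns sums over sub-epochs into p times an
  expectation, hence the factor p at \<open>dist_prox\<close>. At the end the moves still have
  weight sigma / 2, and Cauchy-Schwarz over at most p of them bounds |yh - x_start|^2, hence sigma /
  (2 p). The error is the variance of the minibatch, incurred once per sub-epoch.\<close>

theorem full_epoch_descent:
  "expect full_epoch (\<lambda>(yh, y). Fa y + (sigma * real p / 4 * (dist_prox yh)\<^sup>2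
      + sigma / (2 * real p) * (norm (yh - x_start))\<^sup>2))
    \<le> Fa x_start + 4 * real p / sigma * (V / real B)"
proof -
  have sg: "0 < sigma" by (rule W.s_pos)
  have pp: "0 < real p" using p_pos by simp
  define \<Phi> where "\<Phi> = (\<lambda>(yh, y). Fa y + (sigma * real p / 4 * (dist_prox yh)\<^sup>2
      + sigma / (2 * real p) * (norm (yh - x_start))\<^sup>2))"
  have "expect full_epoch \<Phi> = expect (pmf_of_set batches) (\<lambda>S. expect (sub_epochs (batch_mean S) p)
      (\<lambda>xh. (\<Sum>s<p. \<Phi> (xh s, xh p)) / real p))"
  proof -
    have eq: "expect (sub_epochs (batch_mean S) p \<bind> (\<lambda>xh. pmf_of_set {..<p} \<bind> (\<lambda>s. return_pmf (xh s, xh p)))) \<Phi>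
        = expect (sub_epochs (batch_mean S) p) (\<lambda>xh. (\<Sum>s<p. \<Phi> (xh s, xh p)) / real p)" if "S \<in> batches" for S
      using sub_epochs_support(1)[OF batch_mean_euclid[OF that]] lessThan_p
      by (simp add: expect_bind set_pmf_of_set expect_of_set set_bind_pmf)
    have "expect full_epoch \<Phi> = expect (pmf_of_set batches) (\<lambda>S. expect (sub_epochs (batch_mean S) p \<bind>
        (\<lambda>xh. pmf_of_set {..<p} \<bind> (\<lambda>s. return_pmf (xh s, xh p)))) \<Phi>)"
      unfolding full_epoch_eq using batches lessThan_p sub_epochs_support(1)[OF batch_mean_euclid]
      by (intro expect_bind) (auto simp: set_pmf_of_set)
    also have "\<dots> = expect (pmf_of_set batches) (\<lambda>S. expect (sub_epochs (batch_mean S) p)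
        (\<lambda>xh. (\<Sum>s<p. \<Phi> (xh s, xh p)) / real p))"
      using batches by (intro expect_cong eq) (simp_all add: set_pmf_of_set)
    finally show ?thesis .
  qed
  also have "\<dots> \<le> expect (pmf_of_set batches) (\<lambda>S. Fa x_start + real p * (4 / sigma * (norm (batch_mean S - W.grad x_start))\<^sup>2))"
  proof (rule expect_mono)
    fix S assume "S \<in> set_pmf (pmf_of_set batches)"
    then have mu: "batch_mean S \<in> euclid d" using batches batch_mean_euclid by (simp add: set_pmf_of_set)
    let ?q = "sub_epochs (batch_mean S) p"
    have "expect ?q (\<lambda>xh. (\<Sum>s<p. \<Phi> (xh s, xh p)) / real p)
      \<le> expect ?q (\<lambda>xh. Fa (xh p) + (\<Sum>j<p. sigma / 4 * (dist_prox (xh j))\<^sup>2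
        + (sigma - real p * (sigma / (2 * real p))) * (norm (xh (Suc j) - xh j))\<^sup>2))"
    proof (rule expect_mono[OF sub_epochs_support(1)[OF mu]])
      fix xh assume xh: "xh \<in> set_pmf ?q"
      define A where "A = (\<Sum>j<p. (norm (xh (Suc j) - xh j))\<^sup>2)"
      have "(\<Sum>s<p. \<Phi> (xh s, xh p)) \<le> (\<Sum>s<p. Fa (xh p) + (sigma * real p / 4 * (dist_prox (xh s))\<^sup>2 + sigma / 2 * A))"
      proof (intro sum_mono)
        fix s assume s: "s \<in> {..<p}"
        have "(norm (xh s - x_start))\<^sup>2 \<le> real s * (\<Sum>j<s. (norm (xh (Suc j) - xh j))\<^sup>2)"
          using norm_diff_sq_le_path[of xh s] sub_epochs_support(2)[OF mu xh] by simp
        also have "\<dots> \<le> real p * A"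
          unfolding A_def using s by (intro mult_mono sum_mono2 sum_nonneg) auto
        finally have "sigma / (2 * real p) * (norm (xh s - x_start))\<^sup>2 \<le> sigma / (2 * real p) * (real p * A)"
          using sg pp by (intro mult_left_mono) auto
        then show "\<Phi> (xh s, xh p) \<le> Fa (xh p) + (sigma * real p / 4 * (dist_prox (xh s))\<^sup>2 + sigma / 2 * A)"
          using pp by (simp add: \<Phi>_def)
      qed
      also have "\<dots> = real p * (Fa (xh p) + (\<Sum>j<p. sigma / 4 * (dist_prox (xh j))\<^sup>2) + sigma / 2 * A)"
        by (simp add: sum.distrib sum_distrib_left algebra_simps)
      finally have "(\<Sum>s<p. \<Phi> (xh s, xh p)) / real p \<le> Fa (xh p) + (\<Sum>j<p. sigma / 4 * (dist_prox (xh j))\<^sup>2) + sigma / 2 * A"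
        using pp by (simp add: field_simps)
      also have "sigma / 2 * A = (\<Sum>j<p. (sigma - real p * (sigma / (2 * real p))) * (norm (xh (Suc j) - xh j))\<^sup>2)"
        using pp by (simp add: A_def sum_distrib_left)
      finally show "(\<Sum>s<p. \<Phi> (xh s, xh p)) / real p \<le> Fa (xh p) + (\<Sum>j<p. sigma / 4 * (dist_prox (xh j))\<^sup>2
        + (sigma - real p * (sigma / (2 * real p))) * (norm (xh (Suc j) - xh j))\<^sup>2)"
        by (simp add: sum.distrib)
    qed
    also have "\<dots> \<le> Fa x_start + real p * (4 / sigma * (norm (batch_mean S - W.grad x_start))\<^sup>2)"
      by (rule sub_epochs_descent[OF mu order_refl])
    finally show "expect ?q (\<lambda>xh. (\<Sum>s<p. \<Phi> (xh s, xh p)) / real p)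
        \<le> Fa x_start + real p * (4 / sigma * (norm (batch_mean S - W.grad x_start))\<^sup>2)" .
  qed (use batches in \<open>simp add: set_pmf_of_set\<close>)
  also have "\<dots> = Fa x_start + real p * (4 / sigma) * expect (pmf_of_set batches) (\<lambda>S. (norm (batch_mean S - W.grad x_start))\<^sup>2)"
    using batches by (subst expect_add) (auto simp: set_pmf_of_set mult.assoc)
  also have "\<dots> \<le> Fa x_start + real p * (4 / sigma) * (V / real B)"
    using batch_variance sg by (intro add_left_mono mult_left_mono) auto
  finally show ?thesis by (simp add: \<Phi>_def mult.commute)
qed

end

section \<open>The parameters of Natasha2\<close>

text \<open>
  As \<open>c_bat * c_sub ^ 3 = 1\<close>, the number \<open>p\<close> of sub-epochs is of order \<open>(\<sigma>\<^sup>2 \<V> / (L\<^sup>2 \<epsilon>\<^sup>2))\<^sup>1\<^sup>/\<^sup>3\<close> whatever \<open>c_bat\<close> is; a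
  large \<open>c_bat\<close> reduces the error caused by the minibatch and makes the sub-epochs long.
\<close>

locale natasha2_setup = natasha2 c n d f L L2 V Delta eps del oja hvp sgd
  for c n d f L L2 V Delta eps del oja hvp sgd +
  fixes C_sgd3 c_sgd3 :: real
  assumes theta: "c_sig1 c = 1" "c_sig2 c = 1" "c_bat c = 128 ^ 3" "c_sub c = 1 / 128"
      "c_step c = 1 / 1000" "c_fst c = 360000" "c_smo c = 5" "c_sgd c = (1440 * C_sgd3)\<^sup>2 + 15"
    and B_range: "B \<in> {1..n}"
    and f_twice: "\<And>i. i \<in> {1..n} \<Longrightarrow> twice_differentiable d (f i)"
    and f_smooth: "\<And>i. i \<in> {1..n} \<Longrightarrow> smooth d L (f i)"
    and f_second: "second_order_smooth d L2 (average n f)"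
    and f_var: "variance_le n d f V"
    and f_bdd: "bdd_below (average n f ` euclid d)"
    and eps_pos: "0 < eps" and del_pos: "0 < del" and del_le: "del \<le> L"
    and V_ge: "eps\<^sup>2 \<le> V"
    and del_small: "del ^ 4 \<le> 1 / 3 * (V * eps * L2 ^ 3 / L\<^sup>2)"
    and C_sgd3_pos: "0 < C_sgd3" and c_sgd3_pos: "0 < c_sgd3"
    and sgd_guarantee: "sgd3_guarantee C_sgd3 c_sgd3 n d V sgd"
begin

definition rho :: real where "rho = del / L2"

lemma L_pos: "0 < L" using del_pos del_le by simp

lemma V_pos: "0 < V" using V_ge eps_pos by (meson less_le_trans zero_less_power)

lemma n_pos: "1 \<le> n" using B_range by simp

lemma eps_le: "eps \<le> sqrt V"
  using V_ge eps_pos by (simp add: real_le_rsqrt)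

text \<open>\<open>del_small\<close> forces this: its right side is nonpositive for nonpositive
  \<open>L2\<close>, while the left side is positive.\<close>

lemma L2_pos: "0 < L2"
proof (rule ccontr)
  assume "\<not> 0 < L2"
  then have "L2 ^ 3 \<le> 0" by (simp add: power_le_zero_eq)
  then have "V * eps * L2 ^ 3 / L\<^sup>2 \<le> 0"
    using V_pos eps_pos by (intro divide_nonpos_nonneg mult_nonneg_nonpos) auto
  then have "1 / 3 * (V * eps * L2 ^ 3 / L\<^sup>2) \<le> 0" by (intro mult_nonneg_nonpos) auto
  from order_trans[OF del_small this] show False using del_pos by simp
qed

lemma rho_pos: "0 < rho" using del_pos L2_pos by (simp add: rho_def)

text \<open>Both cases of \<open>sigma\<close> come from this number: its cube root for large
  \<open>L2\<close>, its quotient by L^2 as one argument of the maximum otherwise. Comparing it with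
  L^3 decides the case.\<close>

definition W_par :: real where "W_par = V * eps / rho ^ 3"

lemma W_par_pos: "0 < W_par" using V_pos eps_pos rho_pos by (simp add: W_par_def)

lemma W_par_eq: "V * eps * L2 ^ 3 / (L\<^sup>2 * del ^ 3) = W_par / L\<^sup>2"
  using L2_pos del_pos by (simp add: W_par_def rho_def power_divide)

text \<open>The constant 1/3 in the assumption on \<open>del\<close> enters here: within distance 2
  rho of \<open>y\<close> the Hessian may sink to -3 del, so \<open>W_par\<close> / L^2 has to be at
  least 3 del.\<close>

lemma W_par_ge: "3 * del * L\<^sup>2 \<le> W_par"
proof -
  have "3 * del ^ 4 * L\<^sup>2 \<le> V * eps * L2 ^ 3"
    using del_small L_pos by (simp add: field_simps)
  then have "(3 * del * L\<^sup>2) * del ^ 3 \<le> V * eps * L2 ^ 3"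
    by (simp add: power_numeral_reduce algebra_simps)
  then show ?thesis using del_pos L2_pos by (simp add: W_par_def rho_def power_divide pos_le_divide_eq)
qed

lemma cube_le_iff: "0 \<le> (a::real) \<Longrightarrow> 0 \<le> b \<Longrightarrow> a ^ 3 \<le> b ^ 3 \<longleftrightarrow> a \<le> b"
  by (rule power_mono_iff) auto

text \<open>Passing to cubes removes the fractional powers from the case distinction and from
  \<open>sigma\<close>.\<close>

lemma large_cube:
  shows "(L * del / (V powr (1/3) * eps powr (1/3))) ^ 3 = L ^ 3 * del ^ 3 / (V * eps)"
    and "(L2 * V powr (1/3) * eps powr (1/3) / del) ^ 3 = W_par"
  using V_pos eps_pos del_pos L2_pos
  by (simp_all add: power_divide power_mult_distrib powr_power W_par_def rho_def)

lemma large_iff: "large_L2 \<longleftrightarrow> L ^ 3 \<le> W_par"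
proof -
  have "large_L2 \<longleftrightarrow> (L * del / (V powr (1/3) * eps powr (1/3))) ^ 3 \<le> L2 ^ 3"
    unfolding large_L2_def using L_pos del_pos V_pos eps_pos L2_pos
    by (intro cube_le_iff[symmetric]) auto
  also have "\<dots> \<longleftrightarrow> L ^ 3 \<le> W_par"
    unfolding large_cube W_par_def rho_def using V_pos eps_pos L2_pos del_pos by (simp add: field_simps)
  finally show ?thesis .
qed

lemma large_sigma:
  assumes large_L2
  shows "L_tilde = sigma" "sigma ^ 3 = W_par" "L \<le> sigma" "0 < sigma"
proof -
  show "L_tilde = sigma" using assms by (simp add: L_tilde_def)
  have eq: "sigma = L2 * V powr (1/3) * eps powr (1/3) / del" using assms by (simp add: sigma_def theta)
  show "sigma ^ 3 = W_par" unfolding eq by (rule large_cube)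
  show pos: "0 < sigma" unfolding eq using L2_pos V_pos eps_pos del_pos by simp
  show "L \<le> sigma"
    using assms pos L_pos \<open>sigma ^ 3 = W_par\<close> by (subst cube_le_iff[symmetric]) (auto simp: large_iff)
qed

lemma small_sigma:
  assumes "\<not> large_L2"
  shows "L_tilde = L" "sigma = max (W_par / L\<^sup>2) (eps * L / sqrt V)" "3 * del \<le> sigma" "sigma \<le> L" "0 < sigma"
proof -
  show "L_tilde = L" using assms by (simp add: L_tilde_def)
  show eq: "sigma = max (W_par / L\<^sup>2) (eps * L / sqrt V)"
    using assms by (simp add: sigma_def theta W_par_eq)
  have "3 * del \<le> W_par / L\<^sup>2" using W_par_ge L_pos by (simp add: field_simps)
  then show "3 * del \<le> sigma" unfolding eq by simp
  then show "0 < sigma" using del_pos by simp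
  have "W_par / L\<^sup>2 \<le> L" using assms L_pos by (simp add: large_iff field_simps power3_eq_cube power2_eq_square)
  moreover have "eps * L / sqrt V \<le> L" using eps_le V_pos L_pos by (simp add: field_simps)
  ultimately show "sigma \<le> L" unfolding eq by simp
qed

lemma sigma_pos: "0 < sigma" using large_sigma(4) small_sigma(5) by blast

lemma sigma_le: "sigma \<le> L_tilde" and L_le: "L \<le> L_tilde"
  using large_sigma(1,3) small_sigma(1,4) by (cases large_L2; force)+

text \<open>The two ways in which \<open>sigma\<close> can cover negative curvature: that of any
  L-smooth function, or that of f within distance 2 rho of a point where the Hessian is at least
  -del.\<close>

lemma sigma_curvature: "L \<le> sigma \<or> 3 * del \<le> sigma"
  using large_sigma(3) small_sigma(3) by blast

lemma L_tilde_pos: "0 < L_tilde" using L_pos L_le by simp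

lemma in_range: sigma_in_range
  unfolding sigma_in_range_def using large_sigma(3) small_sigma(3,4) del_pos by auto

text \<open>The purpose of the first argument of the maximum in \<open>sigma\<close>: it yields
  \<open>p_eps_le\<close>.\<close>

lemma sigma_W: "W_par \<le> sigma * L_tilde\<^sup>2"
proof (cases large_L2)
  case True
  then show ?thesis by (simp add: large_sigma power3_eq_cube[symmetric] power2_eq_square)
      (simp add: large_sigma(2)[symmetric] power3_eq_cube)
next
  case False
  then show ?thesis using L_pos by (simp add: small_sigma field_simps max_def)
qed

text \<open>The purpose of the second argument of the maximum: it makes \<open>p_real\<close> at
  least 1, so that rounding at most doubles it, and it bounds the condition number by sqrt V /
  eps.\<close>

lemma sigma_sqrt_V: "eps * L_tilde \<le> sigma * sqrt V"
proof (cases large_L2)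
  case True
  then show ?thesis using eps_le sigma_pos by (simp add: large_sigma mult.commute)
next
  case False
  then have "eps * L / sqrt V \<le> sigma" by (simp add: small_sigma(2))
  then show ?thesis using False V_pos by (simp add: small_sigma(1) field_simps)
qed

section \<open>Batch size, number and length of sub-epochs, step size\<close>

lemma B_ge: "128 ^ 3 * (V / eps\<^sup>2) \<le> real B" and B_le: "real B \<le> 2 * 128 ^ 3 * (V / eps\<^sup>2)"
proof -
  define v where "v = V / eps\<^sup>2"
  have "1 \<le> v" using V_ge eps_pos by (simp add: v_def)
  moreover have "real B = real (nat \<lceil>2097152 * v\<rceil>)" by (simp add: B_def theta v_def)
  ultimately have "2097152 * v \<le> real B" "real B \<le> 4194304 * v" by linarith+
  then show "128 ^ 3 * (V / eps\<^sup>2) \<le> real B" "real B \<le> 2 * 128 ^ 3 * (V / eps\<^sup>2)"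
    by (simp_all add: v_def)
qed

definition p_real :: real where "p_real = 1 / 128 * root 3 (sigma\<^sup>2 / L_tilde\<^sup>2 * real B)"

lemma p_real_cube: "p_real ^ 3 = sigma\<^sup>2 / L_tilde\<^sup>2 * real B / 128 ^ 3"
  unfolding p_real_def power_mult_distrib by (subst real_root_pow_pos2) (auto simp: power_divide)

lemma p_real_cube_ge: "sigma\<^sup>2 * V / (L_tilde\<^sup>2 * eps\<^sup>2) \<le> p_real ^ 3"
proof -
  have "sigma\<^sup>2 / L_tilde\<^sup>2 * (128 ^ 3 * (V / eps\<^sup>2)) \<le> sigma\<^sup>2 / L_tilde\<^sup>2 * real B"
    using B_ge by (intro mult_left_mono) auto
  then have "sigma\<^sup>2 / L_tilde\<^sup>2 * (128 ^ 3 * (V / eps\<^sup>2)) / 128 ^ 3 \<le> p_real ^ 3"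
    unfolding p_real_cube by (intro divide_right_mono) auto
  then show ?thesis by simp
qed

lemma p_real_ge: "1 \<le> p_real"
proof -
  have "(eps * L_tilde)\<^sup>2 \<le> (sigma * sqrt V)\<^sup>2"
    using sigma_sqrt_V eps_pos L_tilde_pos by (intro power_mono) auto
  then have "1 \<le> sigma\<^sup>2 * V / (L_tilde\<^sup>2 * eps\<^sup>2)"
    using V_pos eps_pos L_tilde_pos by (simp add: power_mult_distrib mult.commute)
  then have "1 ^ 3 \<le> p_real ^ 3" using p_real_cube_ge by simp
  moreover have "0 \<le> p_real" using sigma_pos by (simp add: p_real_def)
  ultimately show ?thesis using cube_le_iff[of 1 p_real] by simp
qed

lemma p_bounds: "p_real \<le> real p" "real p \<le> 2 * p_real" "1 \<le> p"
proof -
  have "real p = real (nat \<lceil>p_real\<rceil>)" by (simp add: p_def p_real_def theta)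
  then show "p_real \<le> real p" "real p \<le> 2 * p_real" using p_real_ge by linarith+
  then show "1 \<le> p" using p_real_ge by linarith
qed

lemma p_cube_le: "real p ^ 3 \<le> 8 * (sigma\<^sup>2 / L_tilde\<^sup>2 * real B / 128 ^ 3)"
proof -
  have "real p ^ 3 \<le> (2 * p_real) ^ 3" using p_bounds by (intro power_mono) auto
  then show ?thesis by (simp add: power_mult_distrib p_real_cube)
qed

lemma m_bounds: "real B / real p \<le> real m" "real m \<le> real B / real p + 1" "1 \<le> m"
proof -
  have "0 < real B / real p" using B_range p_bounds by simp
  then show "real B / real p \<le> real m" "real m \<le> real B / real p + 1" "1 \<le> m"
    unfolding m_def by linarith+
qed

text \<open>Obtained on cubes from \<open>p_cube_le\<close> and \<open>sigma_W\<close>; 16 \<le> 27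
  gives the factor 3. It links the accuracy to the radius of the ball: it prices the drift of
  \<open>yh\<close> from \<open>y\<close> and keeps the output inside the ball.\<close>

lemma p_eps_le: "real p * eps \<le> 3 * (sigma * rho)"
proof -
  have "(real p * eps) ^ 3 = real p ^ 3 * eps ^ 3" by (simp add: power_mult_distrib)
  also have "\<dots> \<le> 8 * (sigma\<^sup>2 / L_tilde\<^sup>2 * real B / 128 ^ 3) * eps ^ 3"
    using p_cube_le eps_pos by (intro mult_right_mono) auto
  also have "\<dots> \<le> 8 * (sigma\<^sup>2 / L_tilde\<^sup>2 * (2 * 128 ^ 3 * (V / eps\<^sup>2)) / 128 ^ 3) * eps ^ 3"
    using B_le eps_pos by (intro mult_right_mono mult_left_mono divide_right_mono) auto
  also have "\<dots> = 16 * sigma\<^sup>2 * (V * eps) / L_tilde\<^sup>2"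
    using eps_pos by (simp add: power2_eq_square power3_eq_cube)
  also have "V * eps = W_par * rho ^ 3" using rho_pos by (simp add: W_par_def)
  also have "16 * sigma\<^sup>2 * (W_par * rho ^ 3) / L_tilde\<^sup>2 \<le> 16 * sigma\<^sup>2 * ((sigma * L_tilde\<^sup>2) * rho ^ 3) / L_tilde\<^sup>2"
    using sigma_W rho_pos by (intro divide_right_mono mult_left_mono mult_right_mono) auto
  also have "\<dots> = 16 * (sigma * rho) ^ 3"
    using L_tilde_pos by (simp add: power_mult_distrib power3_eq_cube power2_eq_square)
  also have "\<dots> \<le> (3 * (sigma * rho)) ^ 3"
    using sigma_pos rho_pos by (simp add: power_mult_distrib)
  finally show ?thesis using eps_pos sigma_pos rho_pos by (subst (asm) cube_le_iff) auto
qed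

lemma alpha_eq: "alpha = sigma / (1000 * (real p)\<^sup>2 * L_tilde\<^sup>2)"
  by (simp add: alpha_def theta)

lemma alpha_pos: "0 < alpha"
  using sigma_pos p_bounds(3) L_tilde_pos by (simp add: alpha_eq)

text \<open>\<open>alpha\<close> is of order sigma / (p L_tilde)^2 so that this product is a small
  multiple of \<open>sigma\<close>; both variance conditions of an epoch are consequences.\<close>

lemma alpha_p_le: "(real p)\<^sup>2 * alpha * (3 * L)\<^sup>2 \<le> 9 / 1000 * sigma"
proof -
  have "(real p)\<^sup>2 * alpha * (3 * L)\<^sup>2 = 9 / 1000 * sigma * (L\<^sup>2 / L_tilde\<^sup>2)"
    using p_bounds(3) by (simp add: alpha_eq power_mult_distrib)
  also have "L\<^sup>2 / L_tilde\<^sup>2 \<le> 1" using L_le L_pos by (simp add: power_mono)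
  then have "9 / 1000 * sigma * (L\<^sup>2 / L_tilde\<^sup>2) \<le> 9 / 1000 * sigma * 1"
    using sigma_pos by (intro mult_left_mono) auto
  finally show ?thesis by simp
qed

lemma p_sq_ge: "1 \<le> (real p)\<^sup>2" using p_bounds(3) by (simp add: one_le_power)

lemma step_small: "4 * alpha * (3 * L + 2 * sigma) \<le> 1"
proof -
  have "4 * alpha * (3 * L + 2 * sigma) \<le> 4 * alpha * (5 * L_tilde)"
    using alpha_pos sigma_le L_le by (intro mult_left_mono) auto
  also have "\<dots> = (20 / 1000) * (sigma / L_tilde) * (1 / (real p)\<^sup>2)"
    using L_tilde_pos by (simp add: alpha_eq power2_eq_square)
  also have "\<dots> \<le> (20 / 1000) * 1 * 1"
  proof -
    have "1 / (real p)\<^sup>2 \<le> 1" using p_sq_ge by (simp add: divide_le_eq)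
    then show ?thesis using sigma_le L_tilde_pos sigma_pos by (intro mult_mono) auto
  qed
  finally show ?thesis by simp
qed

text \<open>The product is at least q / (1000 p^3), which is why p is chosen as a cube root: a
  larger order would make the sub-epochs too short. By \<open>p_cube_le\<close> the quotient is at
  least 128^3 / 8000, which exceeds 16.\<close>

lemma sub_long: "16 \<le> alpha * real m * sigma"
proof -
  define q where "q = sigma\<^sup>2 / L_tilde\<^sup>2 * real B"
  have pp: "0 < real p" using p_bounds(3) by simp
  have "16 * real p ^ 3 \<le> q / 1000"
  proof -
    have "0 \<le> q" by (simp add: q_def)
    moreover have "real p ^ 3 \<le> 8 * (q / 2097152)" using p_cube_le by (simp add: q_def)
    ultimately show ?thesis by simp
  qed
  then have "16 \<le> q / (1000 * real p ^ 3)" using pp by (simp add: field_simps)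
  also have "\<dots> = alpha * (real B / real p) * sigma"
    by (simp add: q_def alpha_eq power2_eq_square power3_eq_cube ac_simps)
  also have "\<dots> \<le> alpha * real m * sigma"
    using m_bounds alpha_pos sigma_pos by (intro mult_right_mono mult_left_mono) auto
  finally show ?thesis .
qed

lemma step_small_sub: "64 * alpha * (3 * L)\<^sup>2 \<le> sigma"
proof -
  have "1 * (alpha * (3 * L)\<^sup>2) \<le> (real p)\<^sup>2 * (alpha * (3 * L)\<^sup>2)"
    using p_sq_ge alpha_pos by (intro mult_right_mono) auto
  moreover have "(real p)\<^sup>2 * (alpha * (3 * L)\<^sup>2) \<le> 9 / 1000 * sigma" using alpha_p_le by (simp only: mult.assoc)
  ultimately have "64 * (alpha * (3 * L)\<^sup>2) \<le> sigma" using sigma_pos by linarith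
  then show ?thesis by (simp only: mult.assoc)
qed

lemma step_small_epoch: "4 * (real p)\<^sup>2 * alpha * (3 * L)\<^sup>2 \<le> sigma"
  using alpha_p_le sigma_pos unfolding mult.assoc[of 4] by linarith


section \<open>The penalized functions\<close>

abbreviation "fa \<equiv> average n f"
abbreviation "H \<equiv> hessian d fa"
abbreviation "eig y \<equiv> eigenvalues_ge d (H y) (- del)"
abbreviation "grad_pen y x \<equiv> (2 * L) *\<^sub>R ((x - y) - clip rho (x - y))"
abbreviation "Fy y \<equiv> average n (penalized y)"

lemma f_diff: "i \<in> {1..n} \<Longrightarrow> x \<in> euclid d \<Longrightarrow> f i differentiable (at x within euclid d)"
  using f_twice by (auto simp: twice_differentiable_def)

lemma fa_diff: "x \<in> euclid d \<Longrightarrow> fa differentiable (at x within euclid d)"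
  by (intro average_differentiable f_diff)

lemma grad_fa: "x \<in> euclid d \<Longrightarrow> gradient d fa x = (1 / real n) *\<^sub>R (\<Sum>i=1..n. gradient d (f i) x)"
  by (intro gradient_average f_diff)

lemma fa_twice: "twice_differentiable d fa"
  unfolding twice_differentiable_def
proof (intro ballI conjI fa_diff)
  fix x assume x: "x \<in> euclid d"
  have "(\<lambda>x. (1 / real n) *\<^sub>R (\<Sum>i=1..n. gradient d (f i) x)) differentiable (at x within euclid d)"
    using f_twice x by (intro differentiable_scaleR differentiable_const differentiable_sum)
      (auto simp: twice_differentiable_def)
  then obtain D where D: "((\<lambda>x. (1 / real n) *\<^sub>R (\<Sum>i=1..n. gradient d (f i) x)) has_derivative D) (at x within euclid d)"
    by (auto simp: differentiable_def)
  have "(gradient d fa has_derivative D) (at x within euclid d)"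
    by (rule has_derivative_transform[OF x _ D]) (rule grad_fa)
  then show "gradient d fa differentiable (at x within euclid d)" by (auto simp: differentiable_def)
qed

sublocale hess: hessian_lipschitz d fa L2
  using fa_twice f_second by unfold_locales

lemma grad_fa_lipschitz:
  assumes "x \<in> euclid d" "y \<in> euclid d"
  shows "norm (gradient d fa x - gradient d fa y) \<le> L * norm (x - y)"
proof -
  have n: "0 < real n" using n_pos by simp
  have "gradient d fa x - gradient d fa y = (1 / real n) *\<^sub>R (\<Sum>i=1..n. gradient d (f i) x - gradient d (f i) y)"
    using assms by (simp add: grad_fa sum_subtractf scaleR_diff_right)
  also have "norm \<dots> \<le> (1 / real n) * (\<Sum>i=1..n. L * norm (x - y))"
  proof -
    have "norm (\<Sum>i=1..n. gradient d (f i) x - gradient d (f i) y) \<le> (\<Sum>i=1..n. L * norm (x - y))"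
      by (rule sum_norm_le) (use f_smooth assms in \<open>auto simp: smooth_def\<close>)
    then show ?thesis using n by (simp add: field_simps)
  qed
  finally show ?thesis using n by simp
qed

lemma has_derivative_pen:
  "((\<lambda>x. L * (max 0 (norm (x - y) - del / L2))\<^sup>2) has_derivative (\<lambda>h. grad_pen y x \<bullet> h)) (at x within euclid d)"
  unfolding rho_def[symmetric] using rho_pos L_pos by (intro has_derivative_penalty) auto

lemma penalized_diff: "i \<in> {1..n} \<Longrightarrow> x \<in> euclid d \<Longrightarrow> penalized y i differentiable (at x within euclid d)"
  unfolding penalized_def[abs_def] using has_derivative_pen
  by (intro differentiable_add f_diff) (auto simp only: differentiable_def)

lemma gradient_penalized:
  assumes "i \<in> {1..n}" "x \<in> euclid d" "y \<in> euclid d"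
  shows "gradient d (penalized y i) x = gradient d (f i) x + grad_pen y x"
proof -
  have "(\<lambda>x. L * (max 0 (norm (x - y) - del / L2))\<^sup>2) differentiable (at x within euclid d)"
    using has_derivative_pen by (auto simp only: differentiable_def)
  moreover have "gradient d (\<lambda>x. L * (max 0 (norm (x - y) - del / L2))\<^sup>2) x = grad_pen y x"
    using assms by (intro gradient_eqI has_derivative_pen euclid_scaleR euclid_diff clip_euclid)
  ultimately show ?thesis
    unfolding penalized_def[abs_def] using assms by (simp add: gradient_add f_diff)
qed

lemma Fy_eq: "Fy y x = fa x + L * (max 0 (norm (x - y) - rho))\<^sup>2"
  using n_pos by (simp add: average_def penalized_def rho_def sum.distrib add_divide_distrib)

lemma Fy_ge: "fa x \<le> Fy y x" using L_pos by (simp add: Fy_eq)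

lemma Fy_self: "Fy y y = fa y" using rho_pos by (simp add: Fy_eq)

lemma Fy_diff: "x \<in> euclid d \<Longrightarrow> Fy y differentiable (at x within euclid d)"
  by (intro average_differentiable penalized_diff)

lemma gradient_Fy:
  assumes "x \<in> euclid d" "y \<in> euclid d"
  shows "gradient d (Fy y) x = gradient d fa x + grad_pen y x"
proof -
  have "gradient d (Fy y) x = (1 / real n) *\<^sub>R (\<Sum>i=1..n. gradient d (f i) x + grad_pen y x)"
    using assms by (subst gradient_average[OF penalized_diff]) (auto simp: gradient_penalized)
  also have "\<dots> = (1 / real n) *\<^sub>R (\<Sum>i=1..n. gradient d (f i) x) + grad_pen y x"
    unfolding sum.distrib scaleR_add_right using n_pos by (simp add: sum_constant_scaleR del: scaleR_right_diff_distrib)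
  finally show ?thesis using assms by (simp add: grad_fa)
qed

lemma grad_pen_lipschitz: "norm (grad_pen y x - grad_pen y' x') \<le> 2 * L * norm ((x - y) - (x' - y'))"
proof -
  have "norm (grad_pen y x - grad_pen y' x')
      = 2 * L * norm (((x - y) - clip rho (x - y)) - ((x' - y') - clip rho (x' - y')))"
    unfolding scaleR_diff_right[symmetric] using L_pos by simp
  also have "\<dots> \<le> 2 * L * norm ((x - y) - (x' - y'))"
    using clip_residual_nonexpansive[of rho "x - y" "x' - y'"] rho_pos L_pos by (intro mult_left_mono) auto
  finally show ?thesis .
qed

text \<open>The residual of the projection is nonexpansive, so the penalty adds 2 L. The part
  \<open>g\<close> stays abstract because the lemma serves the average and every single
  summand.\<close>

lemma smooth_of_grad_pen:
  assumes g: "\<And>x. x \<in> euclid d \<Longrightarrow> gradient d F x = g x + grad_pen y x"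
    and lip: "\<And>x x'. x \<in> euclid d \<Longrightarrow> x' \<in> euclid d \<Longrightarrow> norm (g x - g x') \<le> L * norm (x - x')"
  shows "smooth d (3 * L) F"
  unfolding smooth_def
proof (intro ballI)
  fix x x' assume x: "x \<in> euclid d" "x' \<in> euclid d"
  have "norm (gradient d F x - gradient d F x') = norm ((g x - g x') + (grad_pen y x - grad_pen y x'))"
    unfolding g[OF x(1)] g[OF x(2)] by (simp only: add_diff_add)
  also have "\<dots> \<le> norm (g x - g x') + norm (grad_pen y x - grad_pen y x')" by (rule norm_triangle_ineq)
  also have "\<dots> \<le> L * norm (x - x') + 2 * L * norm ((x - y) - (x' - y))"
    using lip[OF x] grad_pen_lipschitz by (intro add_mono)
  finally show "norm (gradient d F x - gradient d F x') \<le> 3 * L * norm (x - x')" by simp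
qed

text \<open>The penalty is the same in every summand, so its gradient cancels in all deviations from
  the mean.\<close>

lemma variance_penalized: "y \<in> euclid d \<Longrightarrow> variance_le n d (penalized y) V"
  using f_var by (auto simp: variance_le_def gradient_penalized gradient_Fy)

lemma Fy_weakly_convex:
  assumes y: "y \<in> euclid d" and eig: "eig y"
  shows "weakly_convex d (Fy y) (3 * L) sigma"
proof
  show "smooth d (3 * L) (Fy y)"
    using y by (intro smooth_of_grad_pen[where g = "gradient d fa" and y = y] gradient_Fy grad_fa_lipschitz)
  fix a b assume ab: "a \<in> euclid d" "b \<in> euclid d"
  have near: "- sigma * (norm (u - v))\<^sup>2 \<le> (gradient d fa u - gradient d fa v) \<bullet> (u - v)"
    if uv: "u \<in> euclid d" "v \<in> euclid d" "norm (u - y) \<le> 2 * rho" "norm (v - y) \<le> 2 * rho" for u v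
    using sigma_curvature
  proof
    assume "L \<le> sigma"
    have "- ((gradient d fa u - gradient d fa v) \<bullet> (u - v)) \<le> norm (gradient d fa u - gradient d fa v) * norm (u - v)"
      using norm_cauchy_schwarz[of "- (gradient d fa u - gradient d fa v)" "u - v"]
      by (simp only: inner_minus_left norm_minus_cancel)
    also have "\<dots> \<le> sigma * norm (u - v) * norm (u - v)"
      using grad_fa_lipschitz[OF uv(1,2)] mult_right_mono[OF \<open>L \<le> sigma\<close>, of "norm (u - v)"]
      by (intro mult_right_mono) auto
    finally show ?thesis by (simp add: power2_eq_square)
  next
    assume *: "3 * del \<le> sigma"
    show ?thesis
    proof (rule hess.grad_mono_of_hessian[OF uv(1,2)])
      fix t :: real assume t: "0 < t" "t < 1"
      let ?x = "v + t *\<^sub>R (u - v)"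
      have x: "?x \<in> euclid d" using uv by auto
      have "?x - y = (1 - t) *\<^sub>R (v - y) + t *\<^sub>R (u - y)" by (simp add: algebra_simps)
      then have "norm (?x - y) \<le> (1 - t) * norm (v - y) + t * norm (u - y)"
        using norm_triangle_ineq[of "(1 - t) *\<^sub>R (v - y)" "t *\<^sub>R (u - y)"] t by simp
      also have "\<dots> \<le> (1 - t) * (2 * rho) + t * (2 * rho)"
        using uv t by (intro add_mono mult_left_mono) auto
      finally have "norm (?x - y) \<le> 2 * rho" by (simp add: algebra_simps)
      then have "L2 * norm (?x - y) \<le> L2 * (2 * rho)" using L2_pos by (intro mult_left_mono) auto
      then have "L2 * norm (?x - y) \<le> 2 * del" using L2_pos by (simp add: rho_def)
      from hess.eigenvalues_ge_transport[OF x y eig this]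
      have "- 3 * del * (norm (u - v))\<^sup>2 \<le> (u - v) \<bullet> H ?x (u - v)"
        using uv by (auto simp: hess.eigenvalues_ge_iff[OF x])
      moreover have "- sigma * (norm (u - v))\<^sup>2 \<le> - 3 * del * (norm (u - v))\<^sup>2"
        using * by (intro mult_right_mono) auto
      ultimately show "- sigma * (norm (u - v))\<^sup>2 \<le> (u - v) \<bullet> H ?x (u - v)" by linarith
    qed
  qed
  show "- sigma * (norm (a - b))\<^sup>2 \<le> (gradient d (Fy y) a - gradient d (Fy y) b) \<bullet> (a - b)"
    unfolding gradient_Fy[OF ab(1) y] gradient_Fy[OF ab(2) y]
    using rho_pos L_pos sigma_pos y ab grad_fa_lipschitz near by (intro penalized_weak_mono) auto
qed (use Fy_diff sigma_pos L_pos in auto)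

lemma epoch_penalized:
  assumes y: "y \<in> euclid d" and eig: "eig y"
  shows "epoch n d (penalized y) y B p m alpha sigma (3 * L) V"
proof -
  interpret W: weakly_convex d "Fy y" "3 * L" sigma by (rule Fy_weakly_convex[OF assms])
  have "smooth d (3 * L) (penalized y i)" if "i \<in> {1..n}" for i
    using that y f_smooth
    by (intro smooth_of_grad_pen[where g = "gradient d (f i)" and y = y] gradient_penalized)
       (auto simp: smooth_def)
  then show ?thesis
    using y B_range n_pos p_bounds(3) m_bounds penalized_diff variance_penalized[OF y] alpha_pos step_small sub_long
      step_small_sub step_small_epoch
    by unfold_locales auto
qed

section \<open>First-order steps, second-order steps, output\<close>

definition prox_dist :: "rvec \<Rightarrow> rvec \<Rightarrow> real"
  where "prox_dist y yh = norm (yh - weakly_convex.prox d (Fy y) sigma yh)"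

text \<open>Bounds, up to \<open>1 / 10\<close>, the probability that SGD3 started from the pair \<open>(y, yh)\<close> fails.\<close>

definition Psi :: "rvec \<Rightarrow> rvec \<Rightarrow> real"
  where "Psi y yh = 900 * (sigma * prox_dist y yh / eps)\<^sup>2 + 4 * (norm (yh - y) / rho)\<^sup>2"

text \<open>The prices in the potential: \<open>lam\<close> is the decrease of \<open>fa\<close>
  that a first-order step buys per unit of \<open>Psi\<close>, \<open>incr\<close> the expected
  increase that the minibatch may cause in such a step, \<open>decr\<close> the expected decrease by
  a second-order step.\<close>

definition lam :: real where "lam = real p * eps\<^sup>2 / (3600 * sigma)"
definition incr :: real where "incr = 4 * real p / sigma * (V / real B)"
definition decr :: real where "decr = del ^ 3 / (12 * L2\<^sup>2)"

lemma Psi_nonneg: "0 \<le> Psi y yh" by (simp add: Psi_def)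

lemma lam_pos: "0 < lam" using p_bounds(3) eps_pos sigma_pos by (simp add: lam_def)

lemma incr_nonneg: "0 \<le> incr" using sigma_pos V_pos by (simp add: incr_def)

lemma decr_pos: "0 < decr" using del_pos L2_pos by (simp add: decr_def)

abbreviation "natasha15_epoch y \<equiv> natasha15.full_epoch n d (penalized y) y B p m alpha sigma"

lemma natasha15_support:
  assumes "y \<in> euclid d" "eig y"
  shows "finite (set_pmf (natasha15_epoch y))" "set_pmf (natasha15_epoch y) \<subseteq> euclid d \<times> euclid d"
proof -
  interpret epoch n d "penalized y" y B p m alpha sigma "3 * L" V by (rule epoch_penalized[OF assms])
  show "finite (set_pmf (natasha15_epoch y))" "set_pmf (natasha15_epoch y) \<subseteq> euclid d \<times> euclid d"
    by (rule full_epoch_support)+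
qed

text \<open>\<open>lam\<close> is fitted to the proximal term, and for the term in |yh - y|^2 the
  bound lam * 4 / rho^2 \<le> sigma / (2 p) follows from \<open>p_eps_le\<close>. The penalty is
  nonnegative and vanishes at \<open>y\<close>, so descent of \<open>Fy y\<close> is descent of
  \<open>fa\<close>.\<close>

lemma first_order_step:
  assumes y: "y \<in> euclid d" and eig: "eig y"
  shows "expect (natasha15_epoch y) (\<lambda>(yh, y'). fa y' + lam * Psi y yh) \<le> fa y + incr"
proof -
  interpret epoch n d "penalized y" y B p m alpha sigma "3 * L" V by (rule epoch_penalized[OF assms])
  have pp: "0 < real p" using p_bounds(3) by simp
  have "expect full_epoch (\<lambda>(yh, y'). fa y' + lam * Psi y yh)
    \<le> expect full_epoch (\<lambda>(yh, y'). Fy y y' + (sigma * real p / 4 * (dist_prox yh)\<^sup>2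
      + sigma / (2 * real p) * (norm (yh - y))\<^sup>2))"
  proof (rule expect_mono[OF full_epoch_support(1)], clarify)
    fix yh y' :: rvec
    have "lam * (900 * (sigma * prox_dist y yh / eps)\<^sup>2) = sigma * real p / 4 * (dist_prox yh)\<^sup>2"
      using sigma_pos eps_pos by (simp add: lam_def prox_dist_def power_divide power_mult_distrib power2_eq_square)
    moreover have "lam * (4 * (norm (yh - y) / rho)\<^sup>2) \<le> sigma / (2 * real p) * (norm (yh - y))\<^sup>2"
    proof -
      have "(real p * eps)\<^sup>2 \<le> (3 * (sigma * rho))\<^sup>2" using p_eps_le eps_pos by (intro power_mono) auto
      moreover have "(3 * (sigma * rho))\<^sup>2 = 9 * (sigma * rho)\<^sup>2" by (simp add: power_mult_distrib)
      ultimately have "(real p * eps)\<^sup>2 \<le> 450 * (sigma * rho)\<^sup>2"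
        using zero_le_power2[of "sigma * rho"] by linarith
      then have "lam * 4 / rho\<^sup>2 \<le> sigma / (2 * real p)"
        using pp sigma_pos rho_pos by (simp add: lam_def field_simps power2_eq_square)
      then have "lam * 4 / rho\<^sup>2 * (norm (yh - y))\<^sup>2 \<le> sigma / (2 * real p) * (norm (yh - y))\<^sup>2"
        by (intro mult_right_mono) auto
      then show ?thesis by (simp add: power_divide)
    qed
    ultimately show "fa y' + lam * Psi y yh \<le> Fy y y' + (sigma * real p / 4 * (dist_prox yh)\<^sup>2
      + sigma / (2 * real p) * (norm (yh - y))\<^sup>2)"
      using Fy_ge[of y' y] by (simp add: Psi_def distrib_left)
  qed
  also have "\<dots> \<le> Fy y y + 4 * real p / sigma * (V / real B)" by (rule full_epoch_descent)
  finally show ?thesis by (simp add: Fy_self incr_def)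
qed

lemma second_order_step:
  assumes "y \<in> euclid d" "v \<in> euclid d" "oja_correct d fa del y (Some v)"
  shows "(fa (y + rho *\<^sub>R v) + fa (y - rho *\<^sub>R v)) / 2 \<le> fa y - decr"
  using hess.negative_curvature_step[of y v del] assms del_pos L2_pos by (simp add: rho_def decr_def)

section \<open>Quality of the output of SGD3\<close>

definition good :: "rvec \<Rightarrow> bool"
  where "good x \<longleftrightarrow> norm (gradient d fa x) \<le> eps \<and> eigenvalues_ge d (H x) (- 3 * del)"

text \<open>Strong convexity gives sigma |x - yh| \<le> eps / 6, and \<open>p_eps_le\<close> with p
  \<ge> 1 turns this into |x - yh| \<le> rho / 2. So the gradient of the penalty vanishes at
  \<open>x\<close>, and the gradient of f differs from the regularized one by 2 sigma (x - yh), of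
  norm at most eps / 3.\<close>

lemma goodI:
  assumes y: "y \<in> euclid d" and eig: "eig y" and yh: "yh \<in> euclid d" and x: "x \<in> euclid d"
    and near: "norm (yh - y) \<le> rho / 2" and pd: "sigma * prox_dist y yh \<le> eps / 12"
    and gr: "norm (gradient d (average n (regularized y yh)) x) \<le> eps / 12"
  shows "good x"
proof -
  interpret W: weakly_convex d "Fy y" "3 * L" sigma by (rule Fy_weakly_convex[OF y eig])
  have reg: "average n (regularized y yh) = W.reg yh"
    using n_pos by (simp add: fun_eq_iff average_def regularized_def W.reg_def sum.distrib add_divide_distrib)
  have gr': "norm (W.rgrad yh x) \<le> eps / 12" using gr x yh by (simp add: reg W.gradient_reg)
  have "norm (x - yh) \<le> norm (x - W.prox yh) + norm (yh - W.prox yh)"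
    using norm_triangle_ineq[of "x - W.prox yh" "W.prox yh - yh"] by (simp add: norm_minus_commute)
  then have "sigma * norm (x - yh) \<le> sigma * norm (x - W.prox yh) + sigma * prox_dist y yh"
    using sigma_pos by (simp add: prox_dist_def distrib_left[symmetric])
  also have "\<dots> \<le> eps / 12 + eps / 12"
    using W.norm_prox_diff_le[OF yh x] gr' pd by linarith
  finally have xyh: "sigma * norm (x - yh) \<le> eps / 6" by simp
  have "1 * eps \<le> real p * eps" using p_bounds(3) eps_pos by (intro mult_right_mono) auto
  then have "sigma * norm (x - yh) \<le> sigma * (rho / 2)" using xyh p_eps_le by simp
  then have "norm (x - yh) \<le> rho / 2" using sigma_pos by (rule mult_left_le_imp_le)
  then have xy: "norm (x - y) \<le> rho"
    using near norm_triangle_ineq[of "x - yh" "yh - y"] by simp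
  then have "grad_pen y x = 0" by (simp add: clip_def)
  then have "gradient d fa x = W.rgrad yh x - (2 * sigma) *\<^sub>R (x - yh)" using gradient_Fy[OF x y] by simp
  then have "norm (gradient d fa x) \<le> norm (W.rgrad yh x) + norm ((2 * sigma) *\<^sub>R (x - yh))"
    using norm_triangle_ineq4 by metis
  also have "norm ((2 * sigma) *\<^sub>R (x - yh)) = 2 * (sigma * norm (x - yh))" using sigma_pos by simp
  finally have "norm (gradient d fa x) \<le> eps" using gr' xyh eps_pos by linarith
  moreover have "L2 * norm (x - y) \<le> L2 * rho" using xy L2_pos by (intro mult_left_mono) auto
  then have "L2 * norm (x - y) \<le> 2 * del" using L2_pos del_pos by (simp add: rho_def)
  from hess.eigenvalues_ge_transport[OF x y eig this] have "eigenvalues_ge d (H x) (- 3 * del)" by simp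
  ultimately show ?thesis by (simp add: good_def)
qed

text \<open>Up to the factor 5, the condition number of the problem handed to SGD3.\<close>

definition q_ratio :: real where "q_ratio = L_tilde / sigma"

lemma q_ratio: "1 \<le> q_ratio" "q_ratio \<le> sqrt V / eps" "q_ratio \<le> V / eps\<^sup>2"
proof -
  show "1 \<le> q_ratio" using sigma_le sigma_pos by (simp add: q_ratio_def)
  show *: "q_ratio \<le> sqrt V / eps" using sigma_sqrt_V sigma_pos eps_pos by (simp add: q_ratio_def field_simps)
  have "1 \<le> sqrt V / eps" using eps_le eps_pos by simp
  then have "sqrt V / eps * 1 \<le> sqrt V / eps * (sqrt V / eps)" by (intro mult_left_mono) auto
  then show "q_ratio \<le> V / eps\<^sup>2" using * V_pos by (simp add: power2_eq_square)
qed

lemma lg_ge: "1 \<le> lg r" by (simp add: lg_def)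

lemma lg_5_le: "lg (5 * q_ratio) \<le> 3 * lg q_ratio"
proof -
  have "ln (5 * q_ratio) = ln 5 + ln q_ratio" using q_ratio by (simp add: ln_mult)
  moreover have "ln (5::real) \<le> 2"
  proof -
    have "(5::real) \<le> (5 / 2)\<^sup>2" by (simp add: power2_eq_square)
    also have "\<dots> \<le> (exp 1)\<^sup>2" using exp_ge_add_one_self[of 1] exp_lower_Taylor_quadratic[of 1] by (intro power_mono) auto
    finally have "5 \<le> exp (2::real)" by (simp add: exp_double[symmetric])
    then have "ln 5 \<le> ln (exp (2::real))" by (subst ln_le_cancel_iff) auto
    then show ?thesis by simp
  qed
  ultimately show ?thesis by (auto simp: lg_def max_def)
qed

lemma T_sgd_ge: "((1440 * C_sgd3)\<^sup>2 + 15) * (V / eps\<^sup>2 * lg q_ratio ^ 3) \<le> real T_sgd"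
  unfolding T_sgd_def theta q_ratio_def by linarith

text \<open>The summand 15 = 5 * 3 of \<open>c_sgd\<close> provides the required lower bound on
  \<open>T_sgd\<close>. The square makes the statistical error at most eps / 240, as 1440 = 6 * 240
  and 3 powr (3/2) \<le> 6.\<close>

lemma sgd_regularized:
  assumes y: "y \<in> euclid d" and eig: "eig y" and yh: "yh \<in> euclid d"
  defines "q \<equiv> sgd (regularized y yh) yh sigma (c_smo c * L_tilde) T_sgd"
  shows "set_pmf q \<subseteq> euclid d"
    and "(\<integral>\<^sup>+x. ennreal (norm (gradient d (average n (regularized y yh)) x)) \<partial>measure_pmf q)
      \<le> ennreal (eps / 240 + sigma * prox_dist y yh)"
proof -
  interpret W: weakly_convex d "Fy y" "3 * L" sigma by (rule Fy_weakly_convex[OF y eig])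
  have reg: "average n (regularized y yh) = W.reg yh"
    using n_pos by (simp add: fun_eq_iff average_def regularized_def W.reg_def sum.distrib add_divide_distrib)
  have reg_diff: "regularized y yh i differentiable (at x within euclid d)" if "i \<in> {1..n}" "x \<in> euclid d" for i x
    unfolding regularized_def[abs_def] by (intro differentiable_add penalized_diff sq_dist_differentiable that)
  have grad_reg: "gradient d (regularized y yh i) x = gradient d (penalized y i) x + (2 * sigma) *\<^sub>R (x - yh)"
    if "i \<in> {1..n}" "x \<in> euclid d" for i x
    unfolding regularized_def[abs_def] using that yh
    by (subst gradient_add) (auto simp: gradient_sq_dist intro: penalized_diff sq_dist_differentiable)
  have var: "variance_le n d (regularized y yh) V"
    using variance_penalized[OF y] yh
    by (auto simp: variance_le_def reg W.gradient_reg grad_reg)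
  have "3 * L + 2 * sigma \<le> 5 * L_tilde" using sigma_le L_le by simp
  then have smooth: "smooth d (5 * L_tilde) (average n (regularized y yh))"
    unfolding reg using W.smooth_reg[OF yh] unfolding smooth_def
    by (meson mult_right_mono norm_ge_zero order_trans)
  define l where "l = lg q_ratio"
  have l: "1 \<le> l" by (simp add: l_def lg_ge)
  have ratio: "5 * L_tilde / sigma = 5 * q_ratio" by (simp add: q_ratio_def)
  have l5: "lg (5 * q_ratio) \<le> 3 * l" using lg_5_le by (simp add: l_def)
  have vpos: "1 \<le> V / eps\<^sup>2" using V_ge eps_pos by simp
  have l3: "l \<le> l ^ 3" using l self_le_power[of l 3] by simp
  have "5 * q_ratio * lg (5 * q_ratio) \<le> 5 * (V / eps\<^sup>2) * (3 * l ^ 3)"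
    using q_ratio l5 l3 lg_ge[of "5 * q_ratio"] vpos by (intro mult_mono) auto
  also have "\<dots> \<le> ((1440 * C_sgd3)\<^sup>2 + 15) * (V / eps\<^sup>2 * l ^ 3)"
  proof -
    have "15 * (V / eps\<^sup>2 * l ^ 3) \<le> ((1440 * C_sgd3)\<^sup>2 + 15) * (V / eps\<^sup>2 * l ^ 3)"
      using vpos l by (intro mult_right_mono mult_nonneg_nonneg) auto
    then show ?thesis by simp
  qed
  also have "\<dots> \<le> real T_sgd" using T_sgd_ge by (simp add: l_def)
  finally have T_cond: "5 * L_tilde / sigma * lg (5 * L_tilde / sigma) \<le> real T_sgd" by (simp add: ratio)
  let ?I = "\<integral>\<^sup>+x. ennreal (norm (gradient d (average n (regularized y yh)) x)) \<partial>measure_pmf q"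
  let ?l = "lg (5 * q_ratio)"
  have "set_pmf q \<subseteq> euclid d \<and>
    ?I
        \<le> ennreal (C_sgd3 * (sqrt V * lg (5 * L_tilde / sigma) powr (3/2) / sqrt (real T_sgd)) +
            (1 - sigma / (5 * L_tilde)) powr (c_sgd3 * (real T_sgd / lg (5 * L_tilde / sigma))) * (sigma * norm (yh - W.prox yh)))"
    unfolding q_def theta
    by (rule sgd_guarantee[unfolded sgd3_guarantee_def, THEN spec, of "regularized y yh", THEN spec, of yh,
          THEN spec, of sigma, THEN spec, of "5 * L_tilde", THEN spec, of T_sgd, THEN spec, of "W.prox yh", THEN mp])
       (use reg_diff sigma_pos W.strongly_convex_reg smooth var yh W.prox_le[OF yh] W.prox_euclid[OF yh] T_cond
        in \<open>simp add: reg\<close>)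
  then have subset: "set_pmf q \<subseteq> euclid d" and bound: "?I
        \<le> ennreal (C_sgd3 * (sqrt V * ?l powr (3/2) / sqrt (real T_sgd)) +
            (1 - sigma / (5 * L_tilde)) powr (c_sgd3 * (real T_sgd / ?l)) * (sigma * norm (yh - W.prox yh)))"
    unfolding ratio by auto
  \<comment> \<open>Bounding the contraction by 1 suffices: SGD3 starts at \<open>yh\<close>, whose
    distance to the minimizer is \<open>prox_dist\<close>, and \<open>Psi\<close> already charges
    for that.\<close>
  have "(1 - sigma / (5 * L_tilde)) powr (c_sgd3 * (real T_sgd / ?l)) \<le> 1"
    using sigma_pos sigma_le L_tilde_pos c_sgd3_pos lg_ge[of "5 * q_ratio"]
    by (intro powr_le1) (auto simp: field_simps)
  then have second: "(1 - sigma / (5 * L_tilde)) powr (c_sgd3 * (real T_sgd / ?l)) * (sigma * norm (yh - W.prox yh))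
      \<le> 1 * (sigma * prox_dist y yh)"
    unfolding prox_dist_def using sigma_pos by (intro mult_right_mono) auto
  have first: "C_sgd3 * (sqrt V * ?l powr (3/2) / sqrt (real T_sgd)) \<le> eps / 240"
  proof -
    have sqrt_cube: "sqrt (x ^ 3) = x powr (3/2)" if "0 < x" for x :: real
    proof -
      have "x powr (3/2) = (x powr 3) powr (1/2)" by (simp add: powr_powr)
      also have "\<dots> = sqrt (x ^ 3)" using that by (simp add: powr_half_sqrt)
      finally show ?thesis by simp
    qed
    have lp: "sqrt (l ^ 3) = l powr (3/2)" using l by (intro sqrt_cube) simp
    have "(1440 * C_sgd3)\<^sup>2 * (V / eps\<^sup>2 * l ^ 3) \<le> real T_sgd"
    proof -
      have "(1440 * C_sgd3)\<^sup>2 * (V / eps\<^sup>2 * l ^ 3) \<le> ((1440 * C_sgd3)\<^sup>2 + 15) * (V / eps\<^sup>2 * l ^ 3)"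
        using vpos l by (intro mult_right_mono mult_nonneg_nonneg) auto
      then show ?thesis using T_sgd_ge by (simp add: l_def)
    qed
    then have "sqrt ((1440 * C_sgd3)\<^sup>2 * (V / eps\<^sup>2 * l ^ 3)) \<le> sqrt (real T_sgd)" by simp
    then have sqT: "1440 * C_sgd3 * (sqrt V / eps * l powr (3/2)) \<le> sqrt (real T_sgd)"
      using C_sgd3_pos eps_pos by (simp add: real_sqrt_mult real_sqrt_divide lp)
    have "?l powr (3/2) \<le> (3 * l) powr (3/2)"
      using l5 lg_ge[of "5 * q_ratio"] by (intro powr_mono2) auto
    also have "\<dots> = 3 powr (3/2) * l powr (3/2)" using l by (simp add: powr_mult)
    also have "\<dots> \<le> 6 * l powr (3/2)"
    proof (intro mult_right_mono)
      have "(3::real) powr (3/2) = sqrt (3 ^ 3)"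
        using sqrt_cube[of 3] by simp
      also have "\<dots> \<le> 6" by (rule real_le_lsqrt) auto
      finally show "(3::real) powr (3/2) \<le> 6" .
    qed auto
    finally have "?l powr (3/2) \<le> 6 * l powr (3/2)" .
    then have "C_sgd3 * (sqrt V * ?l powr (3/2)) \<le> C_sgd3 * (sqrt V * (6 * l powr (3/2)))"
      using C_sgd3_pos V_pos by (intro mult_left_mono) auto
    also have "\<dots> = eps / 240 * (1440 * C_sgd3 * (sqrt V / eps * l powr (3/2)))" using eps_pos by simp
    also have "\<dots> \<le> eps / 240 * sqrt (real T_sgd)" using sqT eps_pos by (intro mult_left_mono) auto
    finally have "C_sgd3 * (sqrt V * ?l powr (3/2)) \<le> eps / 240 * sqrt (real T_sgd)" .
    moreover have "0 < 1440 * C_sgd3 * (sqrt V / eps * l powr (3/2))" using C_sgd3_pos V_pos eps_pos l by simp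
    then have "0 < sqrt (real T_sgd)" using sqT by linarith
    ultimately show ?thesis by (simp add: pos_divide_le_eq mult.commute)
  qed
  show "set_pmf q \<subseteq> euclid d" by (rule subset)
  show "?I
      \<le> ennreal (eps / 240 + sigma * prox_dist y yh)"
    by (rule order_trans[OF bound ennreal_leI]) (use first second in linarith)
qed

text \<open>If one of the two distances is too large for \<open>goodI\<close>, then
  \<open>Psi\<close> is at least 1 and the left side is 0. Otherwise Markov's inequality at the
  threshold eps / 12 applies to the expected gradient norm.\<close>

lemma output_success:
  assumes y: "y \<in> euclid d" and eig: "eig y" and yh: "yh \<in> euclid d"
  shows "ennreal (9 / 10 - Psi y yh)
    \<le> emeasure (measure_pmf (sgd (regularized y yh) yh sigma (c_smo c * L_tilde) T_sgd)) {x. good x}"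
proof -
  let ?q = "sgd (regularized y yh) yh sigma (c_smo c * L_tilde) T_sgd"
  let ?g = "\<lambda>x. norm (gradient d (average n (regularized y yh)) x)"
  define t where "t = sigma * prox_dist y yh / eps"
  have t: "0 \<le> t" using sigma_pos eps_pos by (simp add: t_def prox_dist_def)
  have Psi: "Psi y yh = 900 * t\<^sup>2 + 4 * (norm (yh - y) / rho)\<^sup>2" by (simp add: Psi_def t_def)
  show ?thesis
  proof (cases "norm (yh - y) \<le> rho / 2 \<and> t \<le> 1 / 12")
    case False
    then consider "1 / 2 < norm (yh - y) / rho" | "1 / 12 < t" using rho_pos by (fastforce simp: field_simps)
    then have "1 \<le> Psi y yh"
    proof cases
      case 1
      then have "(1 / 2)\<^sup>2 \<le> (norm (yh - y) / rho)\<^sup>2" by (intro power_mono) auto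
      moreover have "(1 / 2 :: real)\<^sup>2 = 1 / 4" by (simp add: power2_eq_square)
      ultimately show ?thesis unfolding Psi using zero_le_power2[of t] by linarith
    next
      case 2
      then have "(1 / 12)\<^sup>2 \<le> t\<^sup>2" by (intro power_mono) auto
      moreover have "(1 / 12 :: real)\<^sup>2 = 1 / 144" by (simp add: power2_eq_square)
      ultimately show ?thesis unfolding Psi using zero_le_power2[of "norm (yh - y) / rho"] by linarith
    qed
    then show ?thesis by (simp add: ennreal_neg)
  next
    case True
    then have pd: "sigma * prox_dist y yh \<le> eps / 12" using eps_pos by (simp add: t_def field_simps)
    define bad where "bad = {x. 1 \<le> ennreal (12 / eps) * ennreal (?g x)}"
    have "emeasure ?q bad \<le> ennreal (12 / eps) * (\<integral>\<^sup>+x. ennreal (?g x) \<partial>?q)"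
      using nn_integral_Markov_inequality[of "\<lambda>x. ennreal (?g x)" UNIV "measure_pmf ?q" "ennreal (12 / eps)"]
      by (simp add: bad_def)
    also have "\<dots> \<le> ennreal (12 / eps) * ennreal (eps / 240 + sigma * prox_dist y yh)"
      using sgd_regularized(2)[OF assms] by (intro mult_left_mono) auto
    also have "\<dots> = ennreal (1 / 20 + 12 * t)"
      using eps_pos t by (simp add: ennreal_mult'[symmetric] t_def field_simps)
    also have "\<dots> \<le> ennreal (1 / 10 + 900 * t\<^sup>2)"
    proof (intro ennreal_leI)
      \<comment> \<open>The term 12 t from Markov's inequality is traded for the quadratic quantity
        that an epoch controls; the coefficient 900 of \<open>Psi\<close> comes from here.\<close>
      have "0 \<le> (30 * t - 1 / 5)\<^sup>2" by simp
      then show "1 / 20 + 12 * t \<le> 1 / 10 + 900 * t\<^sup>2" by (simp add: power2_eq_square algebra_simps)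
    qed
    also have "\<dots> \<le> ennreal (1 / 10 + Psi y yh)" by (intro ennreal_leI) (simp add: Psi)
    finally have bad: "emeasure ?q bad \<le> ennreal (1 / 10 + Psi y yh)" .
    have "measure ?q (- {x. good x}) \<le> measure ?q bad"
    proof (rule measure_pmf.finite_measure_mono_AE)
      show "AE x in measure_pmf ?q. x \<in> - {x. good x} \<longrightarrow> x \<in> bad"
      proof (rule AE_pmfI, rule impI)
        fix x assume x: "x \<in> set_pmf ?q" and "x \<in> - {x. good x}"
        then have "\<not> ?g x \<le> eps / 12"
          using goodI[OF assms, of x] True pd sgd_regularized(1)[OF assms] by auto
        then have "1 \<le> 12 / eps * ?g x" using eps_pos by (simp add: field_simps)
        then show "x \<in> bad"
          using eps_pos by (simp add: bad_def ennreal_mult'[symmetric] ennreal_leI flip: ennreal_1)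
      qed
    qed auto
    also have "\<dots> \<le> 1 / 10 + Psi y yh"
      using bad Psi_nonneg[of y yh] unfolding measure_pmf.emeasure_eq_measure
      by (subst (asm) ennreal_le_iff) auto
    finally have "9 / 10 - Psi y yh \<le> measure ?q {x. good x}"
      using measure_pmf.prob_compl[of "{x. good x}" ?q] by (simp add: Compl_eq_Diff_UNIV)
    then show ?thesis by (simp add: measure_pmf.emeasure_eq_measure ennreal_leI)
  qed
qed

end

section \<open>Measurable families of finite distributions\<close>

text \<open>A \<open>pmf\<close> lives on the discrete sigma-algebra, while parameters and points
  need the Borel one. Measurable dependence is therefore expressed by test functions: integrals of
  jointly measurable functions are measurable in the parameter. The support condition keeps the
  integrand where \<open>h\<close> is controlled.\<close>

definition kernel :: "'z measure \<Rightarrow> 'w measure \<Rightarrow> ('z \<Rightarrow> 'w pmf) \<Rightarrow> bool"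
  where "kernel Z W q \<longleftrightarrow> (\<forall>z\<in>space Z. set_pmf (q z) \<subseteq> space W) \<and>
    (\<forall>h :: 'z \<times> 'w \<Rightarrow> ennreal. h \<in> borel_measurable (Z \<Otimes>\<^sub>M W) \<longrightarrow>
      (\<lambda>z. \<integral>\<^sup>+w. h (z, w) \<partial>measure_pmf (q z)) \<in> borel_measurable Z)"

lemma kernel_measurable:
  assumes "kernel Z W q" "(\<lambda>(z, w). h z w) \<in> borel_measurable (Z \<Otimes>\<^sub>M W)"
  shows "(\<lambda>z. \<integral>\<^sup>+w. h z w \<partial>measure_pmf (q z) :: ennreal) \<in> borel_measurable Z"
  using assms unfolding kernel_def by fastforce

lemma kernel_return:
  assumes g: "g \<in> measurable Z W"
  shows "kernel Z W (\<lambda>z. return_pmf (g z))"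
  unfolding kernel_def
proof (intro conjI ballI allI impI)
  fix h :: "'a \<times> 'b \<Rightarrow> ennreal" assume h: "h \<in> borel_measurable (Z \<Otimes>\<^sub>M W)"
  have "(\<lambda>z. h (z, g z)) \<in> borel_measurable Z"
    by (rule measurable_compose[OF _ h]) (use g in measurable)
  then show "(\<lambda>z. \<integral>\<^sup>+w. h (z, w) \<partial>measure_pmf (return_pmf (g z))) \<in> borel_measurable Z" by simp
qed (use measurable_space[OF g] in auto)

lemma kernel_bind:
  assumes q: "kernel Z W q" and q': "kernel (Z \<Otimes>\<^sub>M W) W' (\<lambda>(z, w). q' z w)"
  shows "kernel Z W' (\<lambda>z. q z \<bind> q' z)"
  unfolding kernel_def
proof (intro conjI ballI allI impI)
  fix z assume z: "z \<in> space Z"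
  have "set_pmf (q' z w) \<subseteq> space W'" if "w \<in> set_pmf (q z)" for w
  proof -
    have "(z, w) \<in> space (Z \<Otimes>\<^sub>M W)" using q z that by (auto simp: kernel_def space_pair_measure)
    then show ?thesis using q' by (force simp: kernel_def)
  qed
  then show "set_pmf (q z \<bind> q' z) \<subseteq> space W'" by auto
next
  fix h :: "'a \<times> 'c \<Rightarrow> ennreal" assume h: "h \<in> borel_measurable (Z \<Otimes>\<^sub>M W')"
  have "(\<lambda>((z, w), w'). h (z, w')) \<in> borel_measurable ((Z \<Otimes>\<^sub>M W) \<Otimes>\<^sub>M W')"
    unfolding split_def by (rule measurable_compose[OF _ h]) measurable
  then have "(\<lambda>(zw, w'). h (fst zw, w')) \<in> borel_measurable ((Z \<Otimes>\<^sub>M W) \<Otimes>\<^sub>M W')"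
    by (simp add: split_def)
  from kernel_measurable[OF q' this]
  have "(\<lambda>(z, w). \<integral>\<^sup>+w'. h (z, w') \<partial>measure_pmf (q' z w)) \<in> borel_measurable (Z \<Otimes>\<^sub>M W)"
    by (simp add: split_def)
  from kernel_measurable[OF q this]
  show "(\<lambda>z. \<integral>\<^sup>+w'. h (z, w') \<partial>measure_pmf (q z \<bind> q' z)) \<in> borel_measurable Z" by simp
qed

lemma kernel_of_set:
  assumes A: "finite A" "A \<noteq> {}" and q: "\<And>a. a \<in> A \<Longrightarrow> kernel Z W (q a)"
  shows "kernel Z W (\<lambda>z. pmf_of_set A \<bind> (\<lambda>a. q a z))"
  unfolding kernel_def
proof (intro conjI ballI allI impI)
  fix z assume "z \<in> space Z"
  then show "set_pmf (pmf_of_set A \<bind> (\<lambda>a. q a z)) \<subseteq> space W"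
    using A q by (auto simp: kernel_def set_pmf_of_set)
next
  fix h :: "'b \<times> 'c \<Rightarrow> ennreal" assume h: "h \<in> borel_measurable (Z \<Otimes>\<^sub>M W)"
  have "(\<lambda>z. (\<Sum>a\<in>A. \<integral>\<^sup>+w. h (z, w) \<partial>measure_pmf (q a z)) / card A) \<in> borel_measurable Z"
    using q h by (intro borel_measurable_divide_ennreal borel_measurable_sum) (auto simp: kernel_def)
  then show "(\<lambda>z. \<integral>\<^sup>+w. h (z, w) \<partial>measure_pmf (pmf_of_set A \<bind> (\<lambda>a. q a z))) \<in> borel_measurable Z"
    using A by (simp add: nn_integral_pmf_of_set)
qed

section \<open>Measurability on \<open>euclid d\<close>\<close>

abbreviation borel_euclid :: "nat \<Rightarrow> rvec measure"
  where "borel_euclid d \<equiv> restrict_space borel (euclid d)"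

lemma space_borel_euclid [simp]: "space (borel_euclid d) = euclid d"
  by (simp add: space_restrict_space)

lemma measurable_borel_euclid_iff:
  "f \<in> measurable Z (borel_euclid d) \<longleftrightarrow> f \<in> borel_measurable Z \<and> (\<forall>z\<in>space Z. f z \<in> euclid d)"
  by (auto simp: measurable_restrict_space2_iff)

lemma measurable_borel_euclidD:
  assumes "f \<in> measurable Z (borel_euclid d)"
  shows "f \<in> borel_measurable Z" "\<And>z. z \<in> space Z \<Longrightarrow> f z \<in> euclid d"
  using assms by (auto simp: measurable_borel_euclid_iff)

text \<open>Extended by 0 off the closed product set, \<open>\<phi>\<close> is Borel on the whole
  space.\<close>

lemma measurable_continuous_pair:
  fixes \<phi> :: "rvec \<times> rvec \<Rightarrow> 'b::{real_normed_vector, second_countable_topology}"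
  assumes cont: "continuous_on (A \<times> A') \<phi>" and A: "closed A" "closed A'"
    and g: "g \<in> borel_measurable Z" "g' \<in> borel_measurable Z"
    and gA: "\<And>z. z \<in> space Z \<Longrightarrow> g z \<in> A" "\<And>z. z \<in> space Z \<Longrightarrow> g' z \<in> A'"
  shows "(\<lambda>z. \<phi> (g z, g' z)) \<in> borel_measurable Z"
proof -
  have "(\<lambda>x. indicator (A \<times> A') x *\<^sub>R \<phi> x) \<in> borel_measurable borel"
    using A by (intro borel_measurable_continuous_on_indicator cont borel_closed closed_Times)
  moreover have "(\<lambda>z. (g z, g' z)) \<in> measurable Z borel" using g by measurable
  ultimately have "(\<lambda>z. indicator (A \<times> A') (g z, g' z) *\<^sub>R \<phi> (g z, g' z)) \<in> borel_measurable Z"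
    by (rule measurable_compose[rotated])
  then show ?thesis by (rule measurable_cong[THEN iffD1, rotated]) (use gA in auto)
qed

lemma continuous_on_lipschitz_pair:
  fixes \<phi> :: "'a::real_normed_vector \<times> 'b::real_normed_vector \<Rightarrow> 'c::real_normed_vector"
  assumes "\<And>x y x' y'. (x, y) \<in> S \<Longrightarrow> (x', y') \<in> S \<Longrightarrow>
    norm (\<phi> (x, y) - \<phi> (x', y')) \<le> C * (norm (x - x') + norm (y - y'))" and C: "0 \<le> C"
  shows "continuous_on S \<phi>"
proof (rule lipschitz_on_continuous_on[of "2 * C"], rule lipschitz_onI)
  fix p q assume pq: "p \<in> S" "q \<in> S"
  have "norm (fst p - fst q) + norm (snd p - snd q) \<le> 2 * dist p q"
    using dist_fst_le[of p q] dist_snd_le[of p q] by (simp add: dist_norm)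
  then have "C * (norm (fst p - fst q) + norm (snd p - snd q)) \<le> C * (2 * dist p q)"
    using C by (intro mult_left_mono)
  then show "dist (\<phi> p) (\<phi> q) \<le> 2 * C * dist p q"
    using assms(1)[of "fst p" "snd p" "fst q" "snd q"] pq by (simp add: dist_norm)
qed (use C in simp)

section \<open>Measurability of the epochs of Natasha1.5\<close>

context natasha2_setup
begin

abbreviation "ME \<equiv> borel_euclid d"
abbreviation "MT \<equiv> \<Pi>\<^sub>M t\<in>(UNIV::nat set). ME"

lemma MT_component: "x \<in> measurable Z MT \<Longrightarrow> (\<lambda>z. x z t) \<in> measurable Z ME"
  by (rule measurable_compose[OF _ measurable_component_singleton]) auto

lemma MT_update:
  "x \<in> measurable Z MT \<Longrightarrow> g \<in> measurable Z ME \<Longrightarrow> (\<lambda>z. (x z)(t := g z)) \<in> measurable Z MT"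
  by (rule measurable_fun_upd[where J = UNIV]) auto

lemma ME_lin:
  assumes "g \<in> measurable Z ME" "g' \<in> measurable Z ME"
  shows "(\<lambda>z. g z + g' z) \<in> measurable Z ME" "(\<lambda>z. g z - g' z) \<in> measurable Z ME"
  using assms by (auto simp: measurable_borel_euclid_iff)

lemma ME_scaleR: "g \<in> measurable Z ME \<Longrightarrow> (\<lambda>z. r *\<^sub>R g z) \<in> measurable Z ME"
  by (auto simp: measurable_borel_euclid_iff)

lemma ME_sum: "(\<And>i. i \<in> S \<Longrightarrow> g i \<in> measurable Z ME) \<Longrightarrow> (\<lambda>z. \<Sum>i\<in>S. g i z) \<in> measurable Z ME"
  by (auto simp: measurable_borel_euclid_iff intro!: borel_measurable_sum euclid_sum)

text \<open>Both summands are Lipschitz in the point and the center together: the gradient of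
  \<open>f i\<close> by smoothness, the penalty because the residual of the projection is
  nonexpansive.\<close>

lemma ME_gradient_penalized:
  assumes i: "i \<in> {1..n}" and x: "x \<in> measurable Z ME" and y: "y \<in> measurable Z ME"
  shows "(\<lambda>z. gradient d (penalized (y z) i) (x z)) \<in> measurable Z ME"
proof -
  have "continuous_on (euclid d \<times> euclid d) (\<lambda>(x, y). gradient d (f i) x + grad_pen y x)"
  proof (rule continuous_on_lipschitz_pair[where C = "3 * L"], unfold prod.case)
    fix x y x' y' assume "(x, y) \<in> euclid d \<times> euclid d" "(x', y') \<in> euclid d \<times> euclid d"
    then have E: "x \<in> euclid d" "x' \<in> euclid d" by auto
    have "norm ((gradient d (f i) x + grad_pen y x) - (gradient d (f i) x' + grad_pen y' x'))
      \<le> norm (gradient d (f i) x - gradient d (f i) x') + norm (grad_pen y x - grad_pen y' x')"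
      unfolding add_diff_add by (rule norm_triangle_ineq)
    also have "\<dots> \<le> L * norm (x - x') + 2 * L * norm ((x - y) - (x' - y'))"
      using f_smooth[OF i] E by (intro add_mono grad_pen_lipschitz) (auto simp: smooth_def)
    also have "norm ((x - y) - (x' - y')) \<le> norm (x - x') + norm (y - y')"
      using norm_triangle_ineq4[of "x - x'" "y - y'"] by (simp add: algebra_simps)
    then have "2 * L * norm ((x - y) - (x' - y')) \<le> 2 * L * (norm (x - x') + norm (y - y'))"
      using L_pos by (intro mult_left_mono) auto
    then have "L * norm (x - x') + 2 * L * norm ((x - y) - (x' - y'))
        \<le> L * norm (x - x') + 2 * L * (norm (x - x') + norm (y - y'))" by simp
    also have "\<dots> \<le> 3 * L * (norm (x - x') + norm (y - y'))" using L_pos by (simp add: algebra_simps)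
    finally show "norm ((gradient d (f i) x + grad_pen y x) - (gradient d (f i) x' + grad_pen y' x'))
      \<le> 3 * L * (norm (x - x') + norm (y - y'))" .
  qed (use L_pos in simp)
  from measurable_continuous_pair[OF this closed_euclid closed_euclid, of x Z y]
  have "(\<lambda>z. gradient d (f i) (x z) + grad_pen (y z) (x z)) \<in> borel_measurable Z"
    using x y by (simp add: measurable_borel_euclid_iff)
  then have "(\<lambda>z. gradient d (penalized (y z) i) (x z)) \<in> borel_measurable Z"
    by (rule measurable_cong[THEN iffD2, rotated])
       (use gradient_penalized[OF i] measurable_borel_euclidD(2)[OF x] measurable_borel_euclidD(2)[OF y] in auto)
  then show ?thesis
    unfolding measurable_borel_euclid_iff
    using gradient_euclid[OF penalized_diff[OF i]] measurable_borel_euclidD(2)[OF x] by auto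
qed

lemma kernel_inner_loop:
  assumes y: "y \<in> measurable Z ME" and mu: "mu \<in> measurable Z ME" and xh: "xh \<in> measurable Z ME"
  shows "kernel Z MT (\<lambda>z. natasha15.inner_loop n d (penalized (y z)) (y z) alpha sigma (mu z) (xh z) t)"
proof (induction t)
  case 0
  show ?case unfolding natasha15.inner_loop.simps
    using xh by (intro kernel_return measurable_PiM_single') (auto simp: measurable_borel_euclidD)
next
  case (Suc t)
  have fst: "(\<lambda>w. g (fst w)) \<in> measurable (Z \<Otimes>\<^sub>M MT) ME" if "g \<in> measurable Z ME" for g
    using that by (rule measurable_compose[OF measurable_fst])
  have snd: "snd \<in> measurable (Z \<Otimes>\<^sub>M MT) MT" by (rule measurable_snd)
  note xt = MT_component[OF snd, of t]
  show ?case unfolding natasha15.inner_loop.simps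
  proof (rule kernel_bind[OF Suc], unfold split_def, rule kernel_of_set)
    fix i assume i: "i \<in> {1..n}"
    show "kernel (Z \<Otimes>\<^sub>M MT) MT (\<lambda>p. return_pmf ((snd p)(Suc t := snd p t - alpha *\<^sub>R
       (gradient d (penalized (y (fst p)) i) (snd p t) - gradient d (penalized (y (fst p)) i) (y (fst p)) + mu (fst p) +
        (2 * sigma) *\<^sub>R (snd p t - xh (fst p))))))"
      by (intro kernel_return MT_update snd ME_lin ME_scaleR ME_gradient_penalized i xt fst y mu xh)
  qed (use n_pos in auto)
qed

lemma kernel_sub_epochs:
  assumes y: "y \<in> measurable Z ME" and mu: "mu \<in> measurable Z ME"
  shows "kernel Z MT (\<lambda>z. natasha15.sub_epochs n d (penalized (y z)) (y z) m alpha sigma (mu z) s)"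
proof (induction s)
  case 0
  show ?case unfolding natasha15.sub_epochs.simps
    using y by (intro kernel_return measurable_PiM_single') (auto simp: measurable_borel_euclidD)
next
  case (Suc s)
  show ?case unfolding natasha15.sub_epochs.simps
  proof (rule kernel_bind[OF Suc], unfold split_def, rule kernel_bind)
    show "kernel (Z \<Otimes>\<^sub>M MT) MT (\<lambda>p. natasha15.inner_loop n d (penalized (y (fst p))) (y (fst p)) alpha sigma
        (mu (fst p)) (snd p s) m)"
      by (intro kernel_inner_loop MT_component measurable_snd measurable_compose[OF measurable_fst y]
          measurable_compose[OF measurable_fst mu])
    show "kernel ((Z \<Otimes>\<^sub>M MT) \<Otimes>\<^sub>M MT) MT
        (\<lambda>(p, x). pmf_of_set {..<m} \<bind> (\<lambda>t. return_pmf ((snd p)(Suc s := x t))))"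
      unfolding split_def using m_bounds(3)
      by (intro kernel_of_set kernel_return MT_update MT_component measurable_snd
          measurable_compose[OF measurable_fst measurable_snd]) (auto simp: lessThan_empty_iff)
  qed
qed

lemma kernel_natasha15:
  assumes y: "y \<in> measurable Z ME"
  shows "kernel Z (ME \<Otimes>\<^sub>M ME) (\<lambda>z. natasha15_epoch (y z))"
  unfolding natasha15.full_epoch_def Let_def
proof (rule kernel_of_set)
  show "{S. S \<subseteq> {1..n} \<and> card S = B} \<noteq> {}"
  proof -
    have "0 < card {S. S \<subseteq> {1..n} \<and> card S = B}"
      using n_subsets[of "{1..n}" B] B_range by simp
    then show ?thesis by (metis card.empty less_irrefl)
  qed
  fix S assume "S \<in> {S. S \<subseteq> {1..n} \<and> card S = B}"
  then have S: "i \<in> S \<Longrightarrow> i \<in> {1..n}" for i by auto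
  show "kernel Z (ME \<Otimes>\<^sub>M ME) (\<lambda>z. natasha15.sub_epochs n d (penalized (y z)) (y z) m alpha sigma
       ((1 / real B) *\<^sub>R (\<Sum>i\<in>S. gradient d (penalized (y z) i) (y z))) p \<bind>
      (\<lambda>xhat. pmf_of_set {..<p} \<bind> (\<lambda>s. return_pmf (xhat s, xhat p))))"
  proof (rule kernel_bind[OF kernel_sub_epochs])
    show "y \<in> measurable Z ME" by (rule y)
    have "(\<lambda>z. \<Sum>i\<in>S. gradient d (penalized (y z) i) (y z)) \<in> measurable Z ME"
      by (intro ME_sum ME_gradient_penalized S y)
    then show "(\<lambda>z. (1 / real B) *\<^sub>R (\<Sum>i\<in>S. gradient d (penalized (y z) i) (y z))) \<in> measurable Z ME"
      by (rule ME_scaleR)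
    show "kernel (Z \<Otimes>\<^sub>M MT) (ME \<Otimes>\<^sub>M ME) (\<lambda>(z, xhat). pmf_of_set {..<p} \<bind> (\<lambda>s. return_pmf (xhat s, xhat p)))"
      unfolding split_def using p_bounds(3)
      by (intro kernel_of_set kernel_return measurable_Pair MT_component measurable_snd)
         (auto simp: lessThan_empty_iff)
  qed
qed auto

section \<open>Measurability of the curvature condition and of \<open>Psi\<close>\<close>

definition good_set :: "rvec set"
  where "good_set = {y \<in> euclid d. eig y}"

text \<open>The change of \<open>H\<close> splits into a change of the base point, bounded by L2
  times its distance times |v|, and a change of direction, for which \<open>H\<close> is bounded
  linear.\<close>

lemma continuous_hessian_form: "continuous_on (euclid d \<times> euclid d) (\<lambda>(y, v). v \<bullet> H y v)"
proof -
  have "continuous_on (euclid d \<times> euclid d) (\<lambda>p. H (fst p) (snd p))"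
    unfolding continuous_on_def
  proof
    fix p assume p: "p \<in> euclid d \<times> euclid d"
    obtain y v where yv: "p = (y, v)" "y \<in> euclid d" "v \<in> euclid d" using p by auto
    let ?F = "at p within euclid d \<times> euclid d"
    have lim: "((\<lambda>q. H y (snd q)) \<longlongrightarrow> H y v) ?F"
      by (rule bounded_linear.tendsto[OF hess.bounded_linear_H[OF yv(2)]])
         (use yv in \<open>auto intro!: tendsto_eq_intros\<close>)
    have "((\<lambda>q. L2 * norm (fst q - y) * norm (snd q)) \<longlongrightarrow> L2 * norm (y - y) * norm v) ?F"
      unfolding yv(1) by (intro tendsto_intros) (auto intro!: tendsto_eq_intros)
    then have "((\<lambda>q. L2 * norm (fst q - y) * norm (snd q)) \<longlongrightarrow> 0) ?F" by simp
    then have "((\<lambda>q. H (fst q) (snd q) - H y (snd q)) \<longlongrightarrow> 0) ?F"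
    proof (rule Lim_null_comparison[rotated])
      have "norm (H (fst q) (snd q) - H y (snd q)) \<le> L2 * norm (fst q - y) * norm (snd q)"
        if "q \<in> euclid d \<times> euclid d" for q
        using that yv by (intro hess.H_lipschitz) auto
      then show "\<forall>\<^sub>F q in ?F. norm (H (fst q) (snd q) - H y (snd q)) \<le> L2 * norm (fst q - y) * norm (snd q)"
        by (auto simp: eventually_at_filter)
    qed
    from tendsto_add[OF this lim] show "((\<lambda>q. H (fst q) (snd q)) \<longlongrightarrow> H (fst p) (snd p)) ?F"
      by (simp add: yv)
  qed
  then show ?thesis unfolding split_def by (intro continuous_intros)
qed

text \<open>In terms of the quadratic form the condition is a family of inequalities, one for each
  direction, and each defines a closed set by continuity in the base point.\<close>

lemma closed_good_set: "closed good_set"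
proof -
  have "closed {y \<in> euclid d. - del * (norm v)\<^sup>2 \<le> v \<bullet> H y v}" if v: "v \<in> euclid d" for v
  proof -
    have "continuous_on (euclid d) (\<lambda>y. v \<bullet> H y v)"
    proof -
      have "continuous_on (euclid d) (\<lambda>y. (y, v))" by (intro continuous_intros)
      from continuous_on_compose2[OF continuous_hessian_form this] v show ?thesis by auto
    qed
    then have "closed (euclid d \<inter> (\<lambda>y. v \<bullet> H y v) -` {- del * (norm v)\<^sup>2..})"
      by (intro continuous_closed_preimage closed_euclid) auto
    also have "euclid d \<inter> (\<lambda>y. v \<bullet> H y v) -` {- del * (norm v)\<^sup>2..}
        = {y \<in> euclid d. - del * (norm v)\<^sup>2 \<le> v \<bullet> H y v}" by auto
    finally show ?thesis .
  qed
  then have "closed (euclid d \<inter> (\<Inter>v\<in>euclid d. {y \<in> euclid d. - del * (norm v)\<^sup>2 \<le> v \<bullet> H y v}))"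
    by (intro closed_Int closed_euclid closed_INT) auto
  also have "euclid d \<inter> (\<Inter>v\<in>euclid d. {y \<in> euclid d. - del * (norm v)\<^sup>2 \<le> v \<bullet> H y v}) = good_set"
    by (auto simp: good_set_def hess.eigenvalues_ge_iff)
  finally show ?thesis .
qed

text \<open>By \<open>prox_perturbation\<close> the proximal point is Lipschitz in \<open>y\<close>
  and \<open>yh\<close> together, as long as \<open>y\<close> stays in \<open>good_set\<close>,
  where weak convexity holds with the same \<open>sigma\<close>.\<close>

lemma continuous_Psi: "continuous_on (good_set \<times> euclid d) (\<lambda>(y, yh). Psi y yh)"
proof -
  have "continuous_on (good_set \<times> euclid d) (\<lambda>(y, yh). weakly_convex.prox d (Fy y) sigma yh)"
  proof (rule continuous_on_lipschitz_pair[where C = "2 * (L + sigma) / sigma"], unfold prod.case)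
    fix y c y' c' assume "(y, c) \<in> good_set \<times> euclid d" "(y', c') \<in> good_set \<times> euclid d"
    then have *: "y \<in> euclid d" "eig y" "y' \<in> euclid d" "eig y'" "c \<in> euclid d" "c' \<in> euclid d"
      by (auto simp: good_set_def)
    have "sigma * norm (weakly_convex.prox d (Fy y) sigma c - weakly_convex.prox d (Fy y') sigma c')
        \<le> 2 * L * norm (y - y') + 2 * sigma * norm (c - c')"
    proof (rule prox_perturbation[OF Fy_weakly_convex Fy_weakly_convex])
      fix x assume x: "x \<in> euclid d"
      have "gradient d (Fy y') x - gradient d (Fy y) x = grad_pen y' x - grad_pen y x"
        using x * by (simp add: gradient_Fy)
      then show "norm (gradient d (Fy y') x - gradient d (Fy y) x) \<le> 2 * L * norm (y - y')"
        using grad_pen_lipschitz[of x y' x y] by (simp add: norm_minus_commute)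
    qed (use * in auto)
    also have "\<dots> \<le> 2 * (L + sigma) * (norm (y - y') + norm (c - c'))"
      using L_pos sigma_pos by (simp add: algebra_simps)
    finally show "norm (weakly_convex.prox d (Fy y) sigma c - weakly_convex.prox d (Fy y') sigma c')
        \<le> 2 * (L + sigma) / sigma * (norm (y - y') + norm (c - c'))"
      using sigma_pos by (simp add: field_simps)
  qed (use L_pos sigma_pos in simp)
  then show ?thesis
    unfolding Psi_def prox_dist_def split_def divide_inverse by (intro continuous_intros)
qed

text \<open>Off \<open>good_set\<close> the proximal point is an arbitrary choice without any
  regularity, so \<open>Psi\<close> is cut off there.\<close>

definition Psi_good :: "rvec \<Rightarrow> rvec \<Rightarrow> real"
  where "Psi_good y yh = (if y \<in> good_set then Psi y yh else 0)"

lemma Psi_good_measurable: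
  assumes y: "y \<in> measurable Z ME" and yh: "yh \<in> measurable Z ME"
  shows "(\<lambda>z. Psi_good (y z) (yh z)) \<in> borel_measurable Z"
proof -
  have "(\<lambda>x. indicator (good_set \<times> euclid d) x *\<^sub>R (\<lambda>(y, yh). Psi y yh) x) \<in> borel_measurable borel"
    by (intro borel_measurable_continuous_on_indicator continuous_Psi borel_closed closed_Times closed_good_set closed_euclid)
  moreover have "(\<lambda>z. (y z, yh z)) \<in> measurable Z borel"
    using measurable_borel_euclidD(1)[OF y] measurable_borel_euclidD(1)[OF yh] by measurable
  ultimately have "(\<lambda>z. indicator (good_set \<times> euclid d) (y z, yh z) *\<^sub>R (\<lambda>(y, yh). Psi y yh) (y z, yh z)) \<in> borel_measurable Z"
    by (rule measurable_compose[rotated])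
  then show ?thesis
    by (rule measurable_cong[THEN iffD1, rotated])
       (use measurable_borel_euclidD(2)[OF yh] in \<open>auto simp: Psi_good_def indicator_def\<close>)
qed

end

section \<open>A measurable minorant of the success probability\<close>

abbreviation "seeds \<equiv> \<Pi>\<^sub>M k\<in>(UNIV::nat set). seed"

lemma sets_seed [simp, measurable_cong]: "sets seed = sets borel"
  and space_seed [simp]: "space seed = UNIV"
  by (simp_all add: seed_def)

lemma prob_space_seed: "prob_space seed"
  unfolding seed_def by (rule prob_space_uniform_measure) auto

lemma prob_space_seeds: "prob_space seeds"
  by (intro prob_space_PiM prob_space_seed)

lemma space_seeds [simp]: "space seeds = UNIV"
  by (simp add: space_PiM)

text \<open>Seeds are independent, so redrawing one of them preserves the joint distribution. This
  isolates the seed that a single iteration consumes.\<close>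

lemma nn_integral_seeds_resample:
  assumes F: "F \<in> borel_measurable seeds"
  shows "(\<integral>\<^sup>+u. F u \<partial>seeds) = (\<integral>\<^sup>+r. \<integral>\<^sup>+u. F (u(k := r)) \<partial>seeds \<partial>seed)"
proof -
  interpret S: prob_space seeds by (rule prob_space_seeds)
  have upd: "(\<lambda>(x, X). X(k := x)) \<in> measurable (seed \<Otimes>\<^sub>M seeds) seeds"
    unfolding split_def by (rule measurable_fun_upd[where J = UNIV]) auto
  have "distr (seed \<Otimes>\<^sub>M seeds) seeds (\<lambda>(x, X). X(k := x)) = seeds"
    using distr_pair_PiM_eq_PiM[of UNIV "\<lambda>_. seed" k] prob_space_seed by (simp add: insert_absorb)
  then have "(\<integral>\<^sup>+u. F u \<partial>seeds) = (\<integral>\<^sup>+u. F u \<partial>distr (seed \<Otimes>\<^sub>M seeds) seeds (\<lambda>(x, X). X(k := x)))" by simp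
  also have "\<dots> = (\<integral>\<^sup>+p. F ((\<lambda>(x, X). X(k := x)) p) \<partial>(seed \<Otimes>\<^sub>M seeds))"
    using F by (intro nn_integral_distr[OF upd]) simp
  also have "\<dots> = (\<integral>\<^sup>+r. \<integral>\<^sup>+u. F (u(k := r)) \<partial>seeds \<partial>seed)"
    using S.nn_integral_fst[OF measurable_compose[OF upd F], symmetric] by simp
  finally show ?thesis .
qed

text \<open>The right side cuts off the negative values of \<open>h\<close>, hence only an
  inequality.\<close>

lemma ennreal_expect_le:
  assumes "finite (set_pmf q)"
  shows "ennreal (expect q h) \<le> (\<integral>\<^sup>+x. ennreal (h x) \<partial>measure_pmf q)"
proof -
  have "ennreal (expect q h) \<le> ennreal (\<Sum>x\<in>set_pmf q. pmf q x * max 0 (h x))"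
    unfolding expect_sum[OF assms] by (intro ennreal_leI sum_mono mult_left_mono) auto
  also have "\<dots> = (\<Sum>x\<in>set_pmf q. ennreal (h x) * ennreal (pmf q x))"
    by (subst sum_ennreal[symmetric]) (auto simp: ennreal_mult' mult.commute ennreal_max_0 intro!: sum.cong)
  also have "\<dots> = (\<integral>\<^sup>+x. ennreal (h x) \<partial>measure_pmf q)"
    using assms by (simp add: nn_integral_measure_pmf_finite)
  finally show ?thesis .
qed

locale natasha2_run = natasha2_setup +
  fixes cost :: real and y0 :: rvec
  assumes oja: "oja_guarantee d (average n f) del cost oja hvp"
    and y0: "y0 \<in> euclid d"
    and Delta: "average n f y0 - Inf (average n f ` euclid d) \<le> Delta"
begin

lemma oja_measurable: "(\<lambda>(y, r). case oja k y r of None \<Rightarrow> (False, 0) | Some v \<Rightarrow> (True, v))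
    \<in> ME \<Otimes>\<^sub>M borel \<rightarrow>\<^sub>M count_space UNIV \<Otimes>\<^sub>M borel"
  using oja by (simp add: oja_guarantee_def)

lemma oja_euclid: "y \<in> euclid d \<Longrightarrow> oja k y r = Some v \<Longrightarrow> v \<in> euclid d"
  using oja unfolding oja_guarantee_def by (metis option.set_intros subsetD)

lemma oja_prob: "y \<in> euclid d \<Longrightarrow>
    1 - 1 / (20 * (real k + 1)\<^sup>2) \<le> measure seed {r. oja_correct d fa del y (oja k y r)}"
  using oja by (simp add: oja_guarantee_def)

lemma hvp_le: "y \<in> euclid d \<Longrightarrow> real (hvp k y r) \<le> cost"
  using oja by (simp add: oja_guarantee_def)

type_synonym mstate = "rvec \<times> real \<times> nat"

text \<open>Unlike \<open>iteration\<close>, it averages over the sign explicitly and carries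
  neither the list nor the counter, so that only measurable ingredients remain. Membership in
  \<open>good_set\<close> is correctness of the answer \<open>None\<close>.\<close>

definition minor_step :: "nat \<Rightarrow> real \<Rightarrow> (mstate \<Rightarrow> ennreal) \<Rightarrow> rvec \<Rightarrow> real \<Rightarrow> nat \<Rightarrow> ennreal"
  where "minor_step k r g y s N = (case oja k y r of
      Some v \<Rightarrow> (if oja_correct d fa del y (Some v) then (g (y + rho *\<^sub>R v, s, N) + g (y - rho *\<^sub>R v, s, N)) / 2 else 0)
    | None \<Rightarrow> (if y \<in> good_set then \<integral>\<^sup>+(yh, y'). g (y', s + Psi_good y yh, Suc N) \<partial>measure_pmf (natasha15_epoch y) else 0))"

text \<open>In \<open>(y, s, N)\<close>, \<open>s\<close> is the sum of \<open>Psi\<close> over the list \<open>X\<close> and \<open>N\<close> is its length;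
  \<open>j\<close> iterations out of \<open>K\<close> remain. A wrong answer of Oja's algorithm counts as a failure.\<close>

primrec minor :: "nat \<Rightarrow> nat \<Rightarrow> (nat \<Rightarrow> real) \<Rightarrow> mstate \<Rightarrow> ennreal"
  where
    "minor K 0 u st = (case st of (y, s, N) \<Rightarrow> if N = N1 then ennreal (9 / 10 - s / real N1) else 0)"
  | "minor K (Suc j) u st = (case st of (y, s, N) \<Rightarrow>
      if N1 \<le> N then minor K j u st else minor_step (K - Suc j) (u (K - Suc j)) (minor K j u) y s N)"

text \<open>This is the independence of the seeds as the recursion uses it: redrawing the seed of
  one iteration leaves the value of the later ones unchanged.\<close>

lemma minor_cong:
  "j \<le> K \<Longrightarrow> (\<And>i. K - j \<le> i \<Longrightarrow> u i = u' i) \<Longrightarrow> minor K j u = minor K j u'"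
proof (induction j)
  case (Suc j)
  have "minor K j u = minor K j u'" "u (K - Suc j) = u' (K - Suc j)"
    using Suc by auto
  then show ?case by (intro ext) (simp only: minor.simps)
qed (simp add: fun_eq_iff)

abbreviation "MX \<equiv> ME \<Otimes>\<^sub>M (borel :: real measure) \<Otimes>\<^sub>M count_space (UNIV :: nat set)"

lemma minor_step_measurable:
  assumes g: "(\<lambda>(u, st). g u st) \<in> borel_measurable (seeds \<Otimes>\<^sub>M MX)"
  shows "(\<lambda>(u, y, s, N). minor_step k (u k) (g u) y s N) \<in> borel_measurable (seeds \<Otimes>\<^sub>M MX)"
proof -
  let ?Z = "seeds \<Otimes>\<^sub>M MX"
  define y where "y z = fst (snd z)" for z :: "(nat \<Rightarrow> real) \<times> mstate"
  define s where "s z = fst (snd (snd z))" for z :: "(nat \<Rightarrow> real) \<times> mstate"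
  define N where "N z = snd (snd (snd z))" for z :: "(nat \<Rightarrow> real) \<times> mstate"
  define u where "u z = fst z" for z :: "(nat \<Rightarrow> real) \<times> mstate"
  have y: "y \<in> measurable ?Z ME" unfolding y_def[abs_def] by measurable
  have s: "s \<in> borel_measurable ?Z" unfolding s_def[abs_def] by measurable
  have N: "N \<in> measurable ?Z (count_space UNIV)" unfolding N_def[abs_def] by measurable
  have u: "u \<in> measurable ?Z seeds" unfolding u_def[abs_def] by measurable
  have r: "(\<lambda>z. u z k) \<in> borel_measurable ?Z"
    using measurable_compose[OF u measurable_component_singleton[of k UNIV "\<lambda>_. seed"]]
    by (simp add: measurable_def)
  \<comment> \<open>The code 0 for \<open>None\<close> lies in \<open>euclid d\<close>, so the
    vector part maps into \<open>ME\<close> even where no direction is reported.\<close>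
  define c where "c z = (case oja k (y z) (u z k) of None \<Rightarrow> (False, 0) | Some v \<Rightarrow> (True, v))" for z
  have "(\<lambda>z. (y z, u z k)) \<in> measurable ?Z (ME \<Otimes>\<^sub>M borel)" using y r by (rule measurable_Pair)
  from measurable_compose[OF this oja_measurable[of k]]
  have c: "c \<in> measurable ?Z (count_space UNIV \<Otimes>\<^sub>M borel)" by (simp add: c_def[abs_def])
  define b where "b z = fst (c z)" for z
  define w where "w z = snd (c z)" for z
  have b: "b \<in> measurable ?Z (count_space UNIV)" unfolding b_def[abs_def] by (rule measurable_compose[OF c measurable_fst])
  have "w \<in> borel_measurable ?Z" unfolding w_def[abs_def] by (rule measurable_compose[OF c measurable_snd])
  moreover have "w z \<in> euclid d" if "z \<in> space ?Z" for z
    using oja_euclid[OF measurable_borel_euclidD(2)[OF y that]] by (auto simp: w_def c_def split: option.splits)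
  ultimately have w: "w \<in> measurable ?Z ME" by (simp add: measurable_borel_euclid_iff)
  have form: "(\<lambda>z. w z \<bullet> H (y z) (w z)) \<in> borel_measurable ?Z"
    using measurable_continuous_pair[OF continuous_hessian_form closed_euclid closed_euclid,
        of y ?Z w] measurable_borel_euclidD[OF y] measurable_borel_euclidD[OF w] by simp
  note w' = measurable_borel_euclidD(1)[OF w]
  have g_comp: "(\<lambda>z. g (u z) (y' z, s' z, N' z)) \<in> borel_measurable Z'"
    if "u \<in> measurable Z' seeds" "y' \<in> measurable Z' ME" "s' \<in> borel_measurable Z'" "N' \<in> measurable Z' (count_space UNIV)"
    for u y' s' N' and Z' :: "'z measure"
  proof -
    have "(\<lambda>z. (u z, y' z, s' z, N' z)) \<in> measurable Z' ?Z"
      using that by (intro measurable_Pair)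
    from measurable_compose[OF this g] show ?thesis by simp
  qed
  have plus: "(\<lambda>z. g (u z) (y z + rho *\<^sub>R w z, s z, N z)) \<in> borel_measurable ?Z"
    and minus: "(\<lambda>z. g (u z) (y z - rho *\<^sub>R w z, s z, N z)) \<in> borel_measurable ?Z"
    by (intro g_comp u s N ME_lin ME_scaleR y w)+
  have epoch: "(\<lambda>z. \<integral>\<^sup>+p. g (u z) (snd p, s z + Psi_good (y z) (fst p), Suc (N z)) \<partial>measure_pmf (natasha15_epoch (y z))) \<in> borel_measurable ?Z"
  proof (rule kernel_measurable[OF kernel_natasha15[OF y]], unfold split_def)
    have f: "(\<lambda>q. h (fst q)) \<in> measurable (?Z \<Otimes>\<^sub>M (ME \<Otimes>\<^sub>M ME)) W" if "h \<in> measurable ?Z W" for h and W :: "'w measure"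
      using that by (rule measurable_compose[OF measurable_fst])
    have p1: "(\<lambda>q. fst (snd q)) \<in> measurable (?Z \<Otimes>\<^sub>M (ME \<Otimes>\<^sub>M ME)) ME"
      and p2: "(\<lambda>q. snd (snd q)) \<in> measurable (?Z \<Otimes>\<^sub>M (ME \<Otimes>\<^sub>M ME)) ME"
      by measurable
    show "(\<lambda>q. g (u (fst q)) (snd (snd q), s (fst q) + Psi_good (y (fst q)) (fst (snd q)), Suc (N (fst q))))
        \<in> borel_measurable (?Z \<Otimes>\<^sub>M (ME \<Otimes>\<^sub>M ME))"
      by (intro g_comp f u p2 borel_measurable_add s Psi_good_measurable y p1
          measurable_compose[OF f[OF N] measurable_count_space])
  qed
  have goodset: "{z \<in> space ?Z. y z \<in> good_set} \<in> sets ?Z"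
    using measurable_sets[OF measurable_borel_euclidD(1)[OF y] borel_closed[OF closed_good_set]]
    by (simp add: vimage_def Int_def conj_commute)
  have b_set: "{z \<in> space ?Z. b z} \<in> sets ?Z"
    using measurable_sets[OF b, of "{True}"] by (simp add: vimage_def Int_def conj_commute)
  have corr_set: "{z \<in> space ?Z. norm (w z) = 1 \<and> w z \<bullet> H (y z) (w z) \<le> - (del / 2)} \<in> sets ?Z"
    using w' form by measurable
  define step where "step z = (if b z then (if norm (w z) = 1 \<and> w z \<bullet> H (y z) (w z) \<le> - (del / 2)
        then (g (u z) (y z + rho *\<^sub>R w z, s z, N z) + g (u z) (y z - rho *\<^sub>R w z, s z, N z)) / 2 else 0)
      else (if y z \<in> good_set
        then \<integral>\<^sup>+p. g (u z) (snd p, s z + Psi_good (y z) (fst p), Suc (N z)) \<partial>measure_pmf (natasha15_epoch (y z))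
        else 0))" for z
  have "step \<in> borel_measurable ?Z"
    unfolding step_def[abs_def]
    by (intro measurable_If b_set corr_set goodset plus minus epoch borel_measurable_divide_ennreal
        borel_measurable_add measurable_const) auto
  also have "step = (\<lambda>(u, y, s, N). minor_step k (u k) (g u) y s N)"
    by (intro ext)
       (auto simp: step_def minor_step_def b_def w_def c_def u_def y_def s_def N_def split_def split: option.splits)
  finally show ?thesis .
qed

lemma minor_measurable: "(\<lambda>(u, st). minor K j u st) \<in> borel_measurable (seeds \<Otimes>\<^sub>M MX)"
proof (induction j)
  case 0
  have "(\<lambda>z :: (nat \<Rightarrow> real) \<times> mstate. if snd (snd (snd z)) = N1 then ennreal (9 / 10 - fst (snd (snd z)) / real N1) else 0)
      \<in> borel_measurable (seeds \<Otimes>\<^sub>M MX)" by measurable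
  then show ?case by (simp add: split_def)
next
  case (Suc j)
  have "{z \<in> space (seeds \<Otimes>\<^sub>M MX). N1 \<le> snd (snd (snd z))} \<in> sets (seeds \<Otimes>\<^sub>M MX)" by measurable
  from measurable_If[OF Suc minor_step_measurable[OF Suc, of "K - Suc j"] this]
  show ?case by (simp add: split_def cong: if_cong)
qed

lemma minor_measurable_seeds:
  assumes "y \<in> euclid d"
  shows "(\<lambda>u. minor K j u (y, s, N)) \<in> borel_measurable seeds"
proof -
  have "(\<lambda>u. (u, y, s, N)) \<in> measurable seeds (seeds \<Otimes>\<^sub>M MX)"
    using assms by (intro measurable_Pair measurable_const) (auto simp: space_pair_measure)
  from measurable_compose[OF this minor_measurable[of K j]] show ?thesis by simp
qed

section \<open>The potential function\<close>

definition fstar :: real where "fstar = Inf (fa ` euclid d)"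

lemma fstar_le: "y \<in> euclid d \<Longrightarrow> fstar \<le> fa y"
  unfolding fstar_def using f_bdd by (intro cInf_lower) auto

text \<open>The first summand bounds the probability that the loop is not left in time, the second one the
  expected average of \<open>Psi\<close> over the final list. Only the first one ignores the last first-order
  step, which is harmless because the loop is left after it.\<close>

fun Phi :: "nat \<Rightarrow> nat \<Rightarrow> mstate \<Rightarrow> real"
  where "Phi K k (y, s, N) =
    (if N < N1 then (fa y - fstar + decr * (real k - real N) + incr * (real N1 - 1 - real N))
       / (decr * (real K - real N1 + 1)) else 0)
    + (fa y - fstar + lam * s + incr * (real N1 - real N)) / (lam * real N1)"

declare Phi.simps [simp del]

definition q_fail :: "nat \<Rightarrow> nat \<Rightarrow> real"
  where "q_fail K j = (\<Sum>i\<in>{K - j..<K}. 1 / (20 * (real i + 1)\<^sup>2))"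

lemma N1_pos: "0 < real N1" by (simp add: N1_def)

lemma Phi_nonneg:
  assumes "y \<in> euclid d" "0 \<le> s" "N \<le> N1" "N < N1 \<Longrightarrow> N \<le> k" "N1 \<le> K"
  shows "0 \<le> Phi K k (y, s, N)"
proof -
  have "0 \<le> (if N < N1 then (fa y - fstar + decr * (real k - real N) + incr * (real N1 - 1 - real N))
       / (decr * (real K - real N1 + 1)) else 0)"
    using assms fstar_le[of y] decr_pos incr_nonneg by auto
  moreover have "0 \<le> (fa y - fstar + lam * s + incr * (real N1 - real N)) / (lam * real N1)"
    using assms fstar_le[of y] lam_pos incr_nonneg N1_pos by auto
  ultimately show ?thesis by (simp add: Phi.simps)
qed

text \<open>The average decrease by \<open>decr\<close> pays for the increase of k in the first
  summand; in the second summand it is a gain.\<close>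

lemma Phi_second_order:
  assumes y: "y \<in> euclid d" and v: "v \<in> euclid d" and c: "oja_correct d fa del y (Some v)"
    and N: "N < N1" "N1 \<le> K"
  shows "(Phi K (Suc k) (y + rho *\<^sub>R v, s, N) + Phi K (Suc k) (y - rho *\<^sub>R v, s, N)) / 2 \<le> Phi K k (y, s, N)"
proof -
  define D1 where "D1 = decr * (real K - real N1 + 1)"
  define D2 where "D2 = lam * real N1"
  have D: "0 < D1" "0 < D2" using decr_pos lam_pos N N1_pos by (auto simp: D1_def D2_def)
  let ?A = "\<lambda>k y. (fa y - fstar + decr * (real k - real N) + incr * (real N1 - 1 - real N)) / D1"
  let ?B = "\<lambda>y. (fa y - fstar + lam * s + incr * (real N1 - real N)) / D2"
  have Phi: "Phi K k (y, s, N) = ?A k y + ?B y" for k y using N by (simp add: Phi.simps D1_def D2_def)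
  note step = second_order_step[OF y v c]
  have "(?A (Suc k) (y + rho *\<^sub>R v) + ?A (Suc k) (y - rho *\<^sub>R v)) / 2
      = ((fa (y + rho *\<^sub>R v) + fa (y - rho *\<^sub>R v)) / 2 - fstar + decr * (real k + 1 - real N) + incr * (real N1 - 1 - real N)) / D1"
    using D by (simp add: field_simps)
  also have "\<dots> \<le> ?A k y"
    using D step by (intro divide_right_mono) (auto simp: algebra_simps)
  finally have A: "(?A (Suc k) (y + rho *\<^sub>R v) + ?A (Suc k) (y - rho *\<^sub>R v)) / 2 \<le> ?A k y" .
  have "(?B (y + rho *\<^sub>R v) + ?B (y - rho *\<^sub>R v)) / 2
      = ((fa (y + rho *\<^sub>R v) + fa (y - rho *\<^sub>R v)) / 2 - fstar + lam * s + incr * (real N1 - real N)) / D2"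
    using D by (simp add: field_simps)
  also have "\<dots> \<le> ?B y"
    using D step decr_pos by (intro divide_right_mono) auto
  finally have "(?B (y + rho *\<^sub>R v) + ?B (y - rho *\<^sub>R v)) / 2 \<le> ?B y" .
  with A show ?thesis unfolding Phi by (simp add: add_divide_distrib)
qed

text \<open>The increase by \<open>incr\<close> is paid by the step from N to N + 1, k - N stays the
  same, and the gain lam * Psi moves from the function value into \<open>s\<close>. With the last
  first-order step the first summand drops from a nonnegative value to 0.\<close>

lemma Phi_first_order:
  assumes y: "y \<in> good_set" and N: "N < N1" "N1 \<le> K" "N \<le> k"
  shows "expect (natasha15_epoch y) (\<lambda>(yh, y'). Phi K (Suc k) (y', s + Psi_good y yh, Suc N)) \<le> Phi K k (y, s, N)"
proof -
  have yE: "y \<in> euclid d" and eig: "eig y" using y by (auto simp: good_set_def)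
  define q where "q = natasha15_epoch y"
  have fin: "finite (set_pmf q)" and sub: "set_pmf q \<subseteq> euclid d \<times> euclid d"
    unfolding q_def by (rule natasha15_support[OF yE eig])+
  define D1 where "D1 = decr * (real K - real N1 + 1)"
  define D2 where "D2 = lam * real N1"
  have D: "0 < D1" "0 < D2" using decr_pos lam_pos N N1_pos by (auto simp: D1_def D2_def)
  define P where "P x = Psi y (fst x)" for x :: "rvec \<times> rvec"
  have P: "Psi_good y (fst x) = P x" "0 \<le> P x" for x using y by (simp_all add: Psi_good_def P_def Psi_nonneg)
  have step: "expect q (\<lambda>x. fa (snd x) + lam * P x) \<le> fa y + incr"
    using first_order_step[OF yE eig] by (simp add: q_def P_def split_def)
  have step': "expect q (\<lambda>x. fa (snd x)) \<le> fa y + incr"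
  proof -
    have "expect q (\<lambda>x. fa (snd x)) \<le> expect q (\<lambda>x. fa (snd x) + lam * P x)"
      using lam_pos P by (intro expect_mono[OF fin]) auto
    then show ?thesis using step by simp
  qed
  define A where "A x = (if Suc N < N1 then (fa (snd x) - fstar + decr * (real (Suc k) - real (Suc N)) + incr * (real N1 - 1 - real (Suc N))) / D1 else 0)" for x :: "rvec \<times> rvec"
  define A' where "A' x = (fa (snd x) + (- fstar + decr * (real k - real N) + incr * (real N1 - 2 - real N))) * (1 / D1)" for x :: "rvec \<times> rvec"
  define Bx where "Bx x = ((fa (snd x) + lam * P x) + (- fstar + lam * s + incr * (real N1 - 1 - real N))) * (1 / D2)" for x :: "rvec \<times> rvec"
  have eq: "(\<lambda>(yh, y'). Phi K (Suc k) (y', s + Psi_good y yh, Suc N)) = (\<lambda>x. A x + Bx x)"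
  proof -
    have "Phi K (Suc k) (snd x, s + P x, Suc N) = A x + Bx x" for x
    proof -
      have num: "fa (snd x) - fstar + lam * (s + P x) + incr * (real N1 - real (Suc N))
          = (fa (snd x) + lam * P x) + (- fstar + lam * s + incr * (real N1 - 1 - real N))"
        by (simp add: algebra_simps)
      show ?thesis unfolding Phi.simps num A_def Bx_def D1_def D2_def
        by (simp only: mult_1_right times_divide_eq_right)
    qed
    then show ?thesis using P(1) by (auto simp: fun_eq_iff)
  qed
  have EA: "expect q A \<le> (fa y - fstar + decr * (real k - real N) + incr * (real N1 - 1 - real N)) / D1"
  proof (cases "Suc N < N1")
    case True
    then have "expect q A = expect q A'"
      by (intro expect_cong[OF fin]) (use D in \<open>simp add: A_def A'_def field_simps\<close>)
    also have "\<dots> = (expect q (\<lambda>x. fa (snd x)) + (- fstar + decr * (real k - real N) + incr * (real N1 - 2 - real N))) * (1 / D1)"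
      unfolding A'_def by (subst integral_mult_left_zero, subst expect_add[OF fin]) simp
    also have "\<dots> \<le> (fa y + incr + (- fstar + decr * (real k - real N) + incr * (real N1 - 2 - real N))) * (1 / D1)"
      using step' D by (intro mult_right_mono) auto
    also have "\<dots> = (fa y - fstar + decr * (real k - real N) + incr * (real N1 - 1 - real N)) / D1"
      using D by (simp add: field_simps)
    finally show ?thesis .
  next
    case False
    then have "expect q A = 0" by (simp add: A_def[abs_def])
    moreover have "0 \<le> (fa y - fstar + decr * (real k - real N) + incr * (real N1 - 1 - real N)) / D1"
      using fstar_le[OF yE] decr_pos incr_nonneg N D by auto
    ultimately show ?thesis by simp
  qed
  have "expect q Bx = (expect q (\<lambda>x. fa (snd x) + lam * P x) + (- fstar + lam * s + incr * (real N1 - 1 - real N))) * (1 / D2)"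
    unfolding Bx_def by (subst integral_mult_left_zero, subst expect_add[OF fin]) simp
  also have "\<dots> \<le> (fa y + incr + (- fstar + lam * s + incr * (real N1 - 1 - real N))) * (1 / D2)"
    using step D by (intro mult_right_mono) auto
  also have "\<dots> = (fa y - fstar + lam * s + incr * (real N1 - real N)) / D2"
    using D by (simp add: field_simps)
  finally have EB: "expect q Bx \<le> (fa y - fstar + lam * s + incr * (real N1 - real N)) / D2" .
  show ?thesis unfolding eq q_def[symmetric] expect_add[OF fin]
    using EA EB N by (simp add: Phi.simps D1_def D2_def)
qed

text \<open>Backward induction over the remaining iterations. At the end either the loop has been
  left and the second summand of \<open>Phi\<close> dominates s / N1, or K - N exceeds K - N1 and
  the first summand is at least 1, so the bound is trivial. In a step \<open>Phi\<close> does not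
  grow in expectation after a correct answer of Oja's algorithm, and a wrong one costs its
  probability, collected in \<open>q_fail\<close>.\<close>

lemma minor_lower_bound:
  assumes "y \<in> euclid d" "0 \<le> s" "N \<le> N1" "N < N1 \<Longrightarrow> N \<le> K - j" "N1 \<le> K" "j \<le> K"
  shows "ennreal (9 / 10 - q_fail K j - Phi K (K - j) (y, s, N)) \<le> (\<integral>\<^sup>+u. minor K j u (y, s, N) \<partial>seeds)"
  using assms
proof (induction j arbitrary: y s N)
  case 0
  interpret S: prob_space seeds by (rule prob_space_seeds)
  show ?case
  proof (cases "N = N1")
    case True
    have "s / real N1 \<le> (fa y - fstar + lam * s) / (lam * real N1)"
      using fstar_le[OF 0(1)] lam_pos N1_pos by (simp add: field_simps)
    then have "9 / 10 - q_fail K 0 - Phi K K (y, s, N) \<le> 9 / 10 - s / real N1"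
      using True by (simp add: q_fail_def Phi.simps)
    then show ?thesis using True S.emeasure_space_1 by (simp add: ennreal_leI)
  next
    case False
    then have N: "N < N1" using 0 by simp
    have "decr * (real K - real N1 + 1) \<le> fa y - fstar + decr * (real K - real N) + incr * (real N1 - 1 - real N)"
    proof -
      have "decr * (real K - real N1 + 1) \<le> decr * (real K - real N)"
        using N decr_pos by (intro mult_left_mono) auto
      moreover have "0 \<le> incr * (real N1 - 1 - real N)" using N incr_nonneg by (intro mult_nonneg_nonneg) auto
      ultimately show ?thesis using fstar_le[OF 0(1)] by linarith
    qed
    then have "1 \<le> (fa y - fstar + decr * (real K - real N) + incr * (real N1 - 1 - real N)) / (decr * (real K - real N1 + 1))"
      using decr_pos 0 by simp
    moreover have "0 \<le> (fa y - fstar + lam * s + incr * (real N1 - real N)) / (lam * real N1)"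
      using 0 fstar_le[of y] lam_pos incr_nonneg N1_pos by auto
    ultimately have "1 \<le> Phi K K (y, s, N)" using N by (simp add: Phi.simps)
    then show ?thesis by (simp add: q_fail_def ennreal_neg)
  qed
next
  case (Suc j)
  define k where "k = K - Suc j"
  have k: "K - j = Suc k" "K - Suc j = k" "Suc k \<le> K" using Suc.prems by (auto simp: k_def)
  have qS: "q_fail K (Suc j) = 1 / (20 * (real k + 1)\<^sup>2) + q_fail K j"
  proof -
    have "{k..<K} = insert k {Suc k..<K}" using k by auto
    then show ?thesis by (simp add: q_fail_def k)
  qed
  have q0: "0 \<le> q_fail K j" by (simp add: q_fail_def sum_nonneg)
  interpret S: prob_space seeds by (rule prob_space_seeds)
  interpret S1: prob_space seed by (rule prob_space_seed)
  show ?case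
  proof (cases "N1 \<le> N")
    case True
    then have NN: "N = N1" using Suc.prems by simp
    have "Phi K (K - Suc j) (y, s, N) = Phi K (K - j) (y, s, N)" using NN by (simp add: Phi.simps)
    then have "ennreal (9 / 10 - q_fail K (Suc j) - Phi K (K - Suc j) (y, s, N)) \<le> ennreal (9 / 10 - q_fail K j - Phi K (K - j) (y, s, N))"
      unfolding qS by (intro ennreal_leI) simp
    also have "\<dots> \<le> (\<integral>\<^sup>+u. minor K j u (y, s, N) \<partial>seeds)"
      using Suc.prems NN by (intro Suc.IH) auto
    finally show ?thesis using NN by simp
  next
    case False
    then have N: "N < N1" "N \<le> k" using Suc.prems by (auto simp: k)
    define c where "c = 9 / 10 - q_fail K j - Phi K k (y, s, N)"
    have Phi0: "0 \<le> Phi K k (y, s, N)" using Suc.prems N by (intro Phi_nonneg) auto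
    have c1: "c \<le> 1" using q0 Phi0 by (simp add: c_def)
    define C where "C = {r. oja_correct d fa del y (oja k y r)}"
    define I where "I r = (\<integral>\<^sup>+u. minor_step k r (minor K j u) y s N \<partial>seeds)" for r
    have meas: "(\<lambda>u. minor K j u (y', s', N')) \<in> borel_measurable seeds" if "y' \<in> euclid d" for y' s' N'
      using that by (rule minor_measurable_seeds)
    have low: "ennreal c \<le> I r" if r: "r \<in> C" for r
    proof (cases "oja k y r")
      case (Some v)
      have v: "v \<in> euclid d" using oja_euclid[OF Suc.prems(1) Some] .
      have corr: "oja_correct d fa del y (Some v)" using r by (simp add: C_def Some)
      let ?yp = "y + rho *\<^sub>R v" and ?ym = "y - rho *\<^sub>R v"
      have E: "?yp \<in> euclid d" "?ym \<in> euclid d" using v Suc.prems by auto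
      have IH: "ennreal (9 / 10 - q_fail K j - Phi K (Suc k) (y', s, N)) \<le> (\<integral>\<^sup>+u. minor K j u (y', s, N) \<partial>seeds)"
        if "y' \<in> euclid d" for y'
        using Suc.IH[OF that, of s N] Suc.prems N k by auto
      let ?a = "\<lambda>y'. 9 / 10 - q_fail K j - Phi K (Suc k) (y', s, N)"
      have "ennreal c \<le> ennreal ((?a ?yp + ?a ?ym) / 2)"
        using Phi_second_order[OF Suc.prems(1) v corr N(1) Suc.prems(5), of k s]
        by (intro ennreal_leI) (simp add: c_def add_divide_distrib diff_divide_distrib)
      also have "\<dots> \<le> (ennreal (?a ?yp) + ennreal (?a ?ym)) / 2"
      proof -
        have "ennreal ((?a ?yp + ?a ?ym) / 2) \<le> ennreal ((max 0 (?a ?yp) + max 0 (?a ?ym)) / 2)"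
          by (intro ennreal_leI divide_right_mono add_mono) auto
        also have "\<dots> = (ennreal (max 0 (?a ?yp)) + ennreal (max 0 (?a ?ym))) / 2"
          by (subst ennreal_plus[symmetric]) (auto simp: divide_ennreal[symmetric] simp del: ennreal_plus)
        finally show ?thesis by (simp add: ennreal_max_0)
      qed
      also have "\<dots> \<le> ((\<integral>\<^sup>+u. minor K j u (?yp, s, N) \<partial>seeds) + (\<integral>\<^sup>+u. minor K j u (?ym, s, N) \<partial>seeds)) / 2"
        by (intro divide_right_mono_ennreal add_mono IH E)
      also have "\<dots> = I r"
        unfolding I_def minor_step_def Some option.case using corr meas E
        by (simp add: nn_integral_divide nn_integral_add)
      finally show ?thesis .
    next
      case None
      have y: "y \<in> good_set" using r Suc.prems by (simp add: C_def None good_set_def)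
      then have eig: "eig y" by (simp add: good_set_def)
      let ?q = "natasha15_epoch y"
      have fin: "finite (set_pmf ?q)" and sub: "set_pmf ?q \<subseteq> euclid d \<times> euclid d"
        by (rule natasha15_support[OF Suc.prems(1) eig])+
      have "c \<le> expect ?q (\<lambda>x. (9 / 10 - q_fail K j) - (\<lambda>(yh, y'). Phi K (Suc k) (y', s + Psi_good y yh, Suc N)) x)"
        unfolding expect_diff[OF fin] using Phi_first_order[OF y N(1) Suc.prems(5) N(2), of s] by (simp add: c_def)
      then have "ennreal c \<le> (\<integral>\<^sup>+x. ennreal ((9 / 10 - q_fail K j) - (\<lambda>(yh, y'). Phi K (Suc k) (y', s + Psi_good y yh, Suc N)) x) \<partial>?q)"
        by (intro order_trans[OF ennreal_leI ennreal_expect_le[OF fin]])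
      also have "\<dots> \<le> (\<integral>\<^sup>+x. (\<integral>\<^sup>+u. minor K j u (snd x, s + Psi_good y (fst x), Suc N) \<partial>seeds) \<partial>?q)"
      proof (intro nn_integral_mono_AE AE_pmfI)
        fix x assume "x \<in> set_pmf ?q"
        then have x: "snd x \<in> euclid d" using sub by auto
        have "0 \<le> Psi_good y (fst x)" by (simp add: Psi_good_def Psi_nonneg)
        then show "ennreal ((9 / 10 - q_fail K j) - (\<lambda>(yh, y'). Phi K (Suc k) (y', s + Psi_good y yh, Suc N)) x)
            \<le> (\<integral>\<^sup>+u. minor K j u (snd x, s + Psi_good y (fst x), Suc N) \<partial>seeds)"
          using Suc.IH[OF x, of "s + Psi_good y (fst x)" "Suc N"] Suc.prems N k by (auto simp: split_def)
      qed
      also have "\<dots> = (\<integral>\<^sup>+u. (\<integral>\<^sup>+x. minor K j u (snd x, s + Psi_good y (fst x), Suc N) \<partial>?q) \<partial>seeds)"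
      proof -
        have "(\<integral>\<^sup>+u. (\<integral>\<^sup>+x. minor K j u (snd x, s + Psi_good y (fst x), Suc N) \<partial>?q) \<partial>seeds)
            = (\<integral>\<^sup>+u. (\<Sum>x\<in>set_pmf ?q. minor K j u (snd x, s + Psi_good y (fst x), Suc N) * ennreal (pmf ?q x)) \<partial>seeds)"
          using fin by (simp add: nn_integral_measure_pmf_finite)
        also have "\<dots> = (\<Sum>x\<in>set_pmf ?q. (\<integral>\<^sup>+u. minor K j u (snd x, s + Psi_good y (fst x), Suc N) * ennreal (pmf ?q x) \<partial>seeds))"
          using sub by (intro nn_integral_sum borel_measurable_times_ennreal meas) auto
        also have "\<dots> = (\<Sum>x\<in>set_pmf ?q. (\<integral>\<^sup>+u. minor K j u (snd x, s + Psi_good y (fst x), Suc N) \<partial>seeds) * ennreal (pmf ?q x))"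
          using sub by (intro sum.cong refl nn_integral_multc meas) auto
        finally show ?thesis using fin by (simp add: nn_integral_measure_pmf_finite)
      qed
      also have "\<dots> = I r" using y by (simp add: I_def minor_step_def None split_def)
      finally show ?thesis .
    qed
    have C_prob: "1 - 1 / (20 * (real k + 1)\<^sup>2) \<le> measure seed C"
      unfolding C_def by (rule oja_prob[OF Suc.prems(1)])
    have "20 * 1 \<le> 20 * (real k + 1)\<^sup>2" by (intro mult_left_mono one_le_power) auto
    then have "1 / (20 * (real k + 1)\<^sup>2) < 1" by (subst divide_less_eq_1_pos) linarith+
    then have "measure seed C \<noteq> 0" using C_prob by linarith
    \<comment> \<open>A set outside the sigma-algebra has \<open>measure\<close> 0, so the positive
      lower bound shows that \<open>C\<close> is measurable.\<close>
    then have C_sets: "C \<in> sets seed" using measure_notin_sets by blast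
    have "9 / 10 - q_fail K (Suc j) - Phi K k (y, s, N) \<le> c * measure seed C" if "0 \<le> c"
    proof -
      \<comment> \<open>As \<open>c\<close> is at most 1, restricting to \<open>C\<close> loses no
        more than the probability of the complement.\<close>
      have "c * (1 - measure seed C) \<le> 1 * (1 - measure seed C)" using c1 by (intro mult_right_mono) auto
      then have "c - c * measure seed C \<le> 1 - measure seed C" by (simp add: right_diff_distrib)
      moreover have "9 / 10 - q_fail K (Suc j) - Phi K k (y, s, N) = c - 1 / (20 * (real k + 1)\<^sup>2)"
        by (simp add: c_def qS)
      ultimately show ?thesis using C_prob by linarith
    qed
    then have "ennreal (9 / 10 - q_fail K (Suc j) - Phi K k (y, s, N)) \<le> ennreal c * emeasure seed C"
    proof (cases "0 \<le> c")
      case True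
      then show ?thesis using \<open>0 \<le> c \<Longrightarrow> _\<close>
        by (simp add: S1.emeasure_eq_measure ennreal_mult'[symmetric] ennreal_leI)
    next
      case False
      moreover have "9 / 10 - q_fail K (Suc j) - Phi K k (y, s, N) = c - 1 / (20 * (real k + 1)\<^sup>2)"
        by (simp add: c_def qS)
      moreover have "0 \<le> 1 / (20 * (real k + 1)\<^sup>2)" by simp
      ultimately have "9 / 10 - q_fail K (Suc j) - Phi K k (y, s, N) \<le> 0" by linarith
      then show ?thesis by (simp add: ennreal_neg)
    qed
    also have "\<dots> = (\<integral>\<^sup>+r. ennreal c * indicator C r \<partial>seed)" using C_sets by (simp add: nn_integral_cmult_indicator)
    also have "\<dots> \<le> (\<integral>\<^sup>+r. I r \<partial>seed)" using low by (intro nn_integral_mono) (auto simp: indicator_def)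
    also have "\<dots> = (\<integral>\<^sup>+r. \<integral>\<^sup>+u. minor K (Suc j) (u(k := r)) (y, s, N) \<partial>seeds \<partial>seed)"
    proof -
      have "minor K j (u(k := r)) = minor K j u" for u r
        using Suc.prems k by (intro minor_cong) auto
      then show ?thesis using False by (simp add: I_def k)
    qed
    also have "\<dots> = (\<integral>\<^sup>+u. minor K (Suc j) u (y, s, N) \<partial>seeds)"
      by (rule nn_integral_seeds_resample[symmetric]) (rule minor_measurable_seeds[OF Suc.prems(1)])
    finally show ?thesis by (simp add: k)
  qed
qed

end

section \<open>From the minorant to the algorithm\<close>

context natasha2_run
begin

lemma cost_nonneg: "0 \<le> cost"
  using hvp_le[OF y0, of 0 0] by (rule order_trans[rotated]) simp

abbreviation "epoch_cost \<equiv> natasha15.epoch_cost B p m"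

definition psum :: "(rvec \<times> rvec) list \<Rightarrow> real"
  where "psum X = (\<Sum>(y, yh)\<leftarrow>X. Psi y yh)"

fun run_inv :: "nat \<Rightarrow> rvec \<times> (rvec \<times> rvec) list \<times> nat \<Rightarrow> bool"
  where "run_inv k (y, X, T) \<longleftrightarrow> y \<in> euclid d \<and> set X \<subseteq> good_set \<times> euclid d \<and> length X \<le> N1 \<and>
    real T \<le> real k * cost + real (length X) * real epoch_cost"

declare run_inv.simps [simp del]

text \<open>The invariant, including the bound on the gradient count, is folded into the value,
  which is 0 off the invariant. The comparison with the main loop then holds for every state,
  reachable or not.\<close>

fun minor_state :: "nat \<Rightarrow> nat \<Rightarrow> (nat \<Rightarrow> real) \<Rightarrow> rvec \<times> (rvec \<times> rvec) list \<times> nat \<Rightarrow> ennreal"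
  where "minor_state K j u (y, X, T) =
    (if run_inv (K - j) (y, X, T) then minor K j u (y, psum X, length X) else 0)"

declare minor_state.simps [simp del]

definition loop_step :: "(nat \<Rightarrow> real) \<Rightarrow> nat \<Rightarrow> rvec \<times> (rvec \<times> rvec) list \<times> nat \<Rightarrow> (rvec \<times> (rvec \<times> rvec) list \<times> nat) pmf"
  where "loop_step u k st = (if length (fst (snd st)) < N1 then iteration k (u k) st else return_pmf st)"

text \<open>For fixed seeds the integrals are against a \<open>pmf\<close>, so any function may be
  integrated. Where the invariant fails or Oja's answer is wrong the left side is 0; elsewhere the
  two sides agree.\<close>

lemma minor_state_step:
  assumes j: "Suc j \<le> K"
  shows "minor_state K (Suc j) u st \<le> (\<integral>\<^sup>+st'. minor_state K j u st' \<partial>loop_step u (K - Suc j) st)"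
proof -
  obtain y X T where st: "st = (y, X, T)" by (cases st) auto
  define k where "k = K - Suc j"
  have k: "K - Suc j = k" "K - j = Suc k" using j by (auto simp: k_def)
  show ?thesis
  proof (cases "run_inv k st")
    case False
    then show ?thesis by (simp add: st k minor_state.simps)
  next
    case inv: True
    then have y: "y \<in> euclid d" and X: "set X \<subseteq> good_set \<times> euclid d" and len: "length X \<le> N1"
      and T: "real T \<le> real k * cost + real (length X) * real epoch_cost"
      by (auto simp: st run_inv.simps)
    have lhs: "minor_state K (Suc j) u st = minor K (Suc j) u (y, psum X, length X)"
      using inv by (simp add: st k minor_state.simps)
    show ?thesis
    proof (cases "length X < N1")
      case False
      have "run_inv (Suc k) st" using y X len T cost_nonneg by (simp add: st run_inv.simps distrib_right)
      then show ?thesis using False by (simp add: lhs k st loop_step_def minor_state.simps)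
    next
      case active: True
      have step: "loop_step u k st = iteration k (u k) (y, X, T)" using active by (simp add: loop_step_def st)
      have minor: "minor_state K (Suc j) u st = minor_step k (u k) (minor K j u) y (psum X) (length X)"
        using active by (simp add: lhs k)
      show ?thesis
      proof (cases "oja k y (u k)")
        case (Some v)
        have v: "v \<in> euclid d" using oja_euclid[OF y Some] .
        have hv: "real (T + hvp k y (u k)) \<le> real (Suc k) * cost + real (length X) * real epoch_cost"
          using T hvp_le[OF y, of k "u k"] by (simp add: distrib_right)
        have eq: "minor_state K j u (y + s *\<^sub>R v, X, T + hvp k y (u k)) = minor K j u (y + s *\<^sub>R v, psum X, length X)" for s
          using y v X len hv by (auto simp: minor_state.simps run_inv.simps k)
        have "(\<integral>\<^sup>+st'. minor_state K j u st' \<partial>loop_step u k st)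
            = (minor K j u (y + rho *\<^sub>R v, psum X, length X) + minor K j u (y - rho *\<^sub>R v, psum X, length X)) / 2"
          unfolding step iteration.simps Some option.case rho_def
          using eq[of "del / L2"] eq[of "- (del / L2)"]
          by (simp add: nn_integral_pmf_of_set add.commute)
        moreover have "minor_state K (Suc j) u st \<le> (minor K j u (y + rho *\<^sub>R v, psum X, length X) + minor K j u (y - rho *\<^sub>R v, psum X, length X)) / 2"
          unfolding minor minor_step_def Some option.case by auto
        ultimately show ?thesis by (simp add: k)
      next
        case None
        show ?thesis
        proof (cases "y \<in> good_set")
          case False
          then show ?thesis unfolding minor minor_step_def None by simp
        next
          case good: True
          then have eig: "eig y" by (simp add: good_set_def)
          have sub: "set_pmf (natasha15_epoch y) \<subseteq> euclid d \<times> euclid d" by (rule natasha15_support[OF y eig])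
          have hv: "real (T + hvp k y (u k) + epoch_cost) \<le> real (Suc k) * cost + real (Suc (length X)) * real epoch_cost"
            using T hvp_le[OF y, of k "u k"] by (simp add: distrib_right)
          have "(\<integral>\<^sup>+st'. minor_state K j u st' \<partial>loop_step u k st)
              = (\<integral>\<^sup>+x. minor_state K j u (snd x, X @ [(y, fst x)], T + hvp k y (u k) + epoch_cost) \<partial>natasha15_epoch y)"
            unfolding step iteration.simps None option.case by (simp add: split_def)
          also have "\<dots> = (\<integral>\<^sup>+x. minor K j u (snd x, psum X + Psi_good y (fst x), Suc (length X)) \<partial>natasha15_epoch y)"
          proof (intro nn_integral_cong_AE AE_pmfI)
            fix x assume "x \<in> set_pmf (natasha15_epoch y)"
            then have x: "fst x \<in> euclid d" "snd x \<in> euclid d" using sub by auto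
            have "run_inv (Suc k) (snd x, X @ [(y, fst x)], T + hvp k y (u k) + epoch_cost)"
              using x X good active hv by (simp add: run_inv.simps)
            then show "minor_state K j u (snd x, X @ [(y, fst x)], T + hvp k y (u k) + epoch_cost)
                = minor K j u (snd x, psum X + Psi_good y (fst x), Suc (length X))"
              using good by (simp add: minor_state.simps k psum_def Psi_good_def)
          qed
          finally show ?thesis
            unfolding minor minor_step_def None using good by (simp add: split_def k)
        qed
      qed
    qed
  qed
qed

definition final :: "rvec \<times> (rvec \<times> rvec) list \<times> nat \<Rightarrow> (rvec \<times> nat) option pmf"
  where "final = (\<lambda>(y', X, T).
     if length X < N1 then return_pmf None
     else do {
       j \<leftarrow> pmf_of_set {..<length X};
       let (y, yhat) = X ! j;
       x \<leftarrow> sgd (regularized y yhat) yhat sigma (c_smo c * L_tilde) T_sgd;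
       return_pmf (Some (x, T + T_sgd))
     })"

lemma run_eq: "run u y0 K = main_loop u y0 K \<bind> final"
  by (simp add: run_def final_def)

lemma main_loop_Suc: "main_loop u y0 (Suc k) = main_loop u y0 k \<bind> loop_step u k"
  by (simp add: loop_step_def[abs_def])

definition T_bound :: "nat \<Rightarrow> real"
  where "T_bound K = real K * cost + real N1 * real epoch_cost + real T_sgd"

definition success :: "nat \<Rightarrow> (rvec \<times> nat) option set"
  where "success K = {Some (x, T) | x T. good x \<and> real T \<le> T_bound K}"

text \<open>The pair is drawn uniformly from N1 pairs, so averaging \<open>output_success\<close>
  gives 9/10 minus the mean of \<open>Psi\<close>; truncating negative terms at 0 only enlarges the
  right side.\<close>

lemma minor_state_final: "minor_state K 0 u st \<le> emeasure (measure_pmf (final st)) (success K)"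
proof -
  obtain y X T where st: "st = (y, X, T)" by (cases st) auto
  show ?thesis
  proof (cases "run_inv K st \<and> length X = N1")
    case False
    then show ?thesis by (auto simp: st minor_state.simps)
  next
    case True
    then have X: "set X \<subseteq> good_set \<times> euclid d" and len: "length X = N1"
      and T: "real (T + T_sgd) \<le> T_bound K"
      by (auto simp: st run_inv.simps T_bound_def)
    have ne: "{..<N1} \<noteq> {}" using N1_pos by (auto simp: lessThan_empty_iff)
    have psum: "psum X = (\<Sum>j<N1. Psi (fst (X ! j)) (snd (X ! j)))"
      by (simp add: psum_def sum_list_sum_nth len split_def atLeast0LessThan)
    define r where "r j = 9 / 10 - Psi (fst (X ! j)) (snd (X ! j))" for j
    have "minor_state K 0 u st = ennreal (9 / 10 - psum X / real N1)"
      using True by (simp add: st minor_state.simps)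
    also have "9 / 10 - psum X / real N1 = (\<Sum>j<N1. r j) / real N1"
      using N1_pos by (simp add: psum r_def sum_subtractf diff_divide_distrib)
    also have "\<dots> = expect (pmf_of_set {..<N1}) r" using ne by (simp add: expect_of_set)
    also have "ennreal \<dots> \<le> (\<integral>\<^sup>+j. ennreal (r j) \<partial>pmf_of_set {..<N1})"
      using ne by (intro ennreal_expect_le) (simp add: set_pmf_of_set)
    also have "\<dots> \<le> (\<integral>\<^sup>+j. emeasure (measure_pmf (sgd (regularized (fst (X ! j)) (snd (X ! j))) (snd (X ! j)) sigma (c_smo c * L_tilde) T_sgd)) {x. good x} \<partial>pmf_of_set {..<N1})"
    proof (intro nn_integral_mono_AE AE_pmfI)
      fix j assume "j \<in> set_pmf (pmf_of_set {..<N1})"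
      then have "j < length X" using ne len by (simp add: set_pmf_of_set)
      then have "X ! j \<in> good_set \<times> euclid d" using X nth_mem by blast
      then have "fst (X ! j) \<in> euclid d" "eig (fst (X ! j))" "snd (X ! j) \<in> euclid d" by (auto simp: good_set_def mem_Times_iff)
      then show "ennreal (r j) \<le> emeasure (measure_pmf (sgd (regularized (fst (X ! j)) (snd (X ! j))) (snd (X ! j)) sigma (c_smo c * L_tilde) T_sgd)) {x. good x}"
        unfolding r_def by (rule output_success)
    qed
    also have "\<dots> = emeasure (measure_pmf (final st)) (success K)"
    proof -
      have "indicator (success K) (Some (x, T + T_sgd)) = (indicator {x. good x} x :: ennreal)" for x
        using T by (auto simp: success_def indicator_def)
      then have "emeasure (measure_pmf (q \<bind> (\<lambda>x. return_pmf (Some (x, T + T_sgd))))) (success K) = emeasure (measure_pmf q) {x. good x}" for q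
        by simp
      then show ?thesis using len by (simp add: final_def st split_def Let_def)
    qed
    finally show ?thesis .
  qed
qed

lemma minor_state_main_loop:
  assumes "k \<le> K"
  shows "minor K K u (y0, 0, 0) \<le> (\<integral>\<^sup>+st. minor_state K (K - k) u st \<partial>main_loop u y0 k)"
  using assms
proof (induction k)
  case 0
  have "run_inv 0 (y0, [], 0)" using y0 by (simp add: run_inv.simps)
  then show ?case by (simp add: minor_state.simps psum_def)
next
  case (Suc k)
  have "minor K K u (y0, 0, 0) \<le> (\<integral>\<^sup>+st. minor_state K (K - k) u st \<partial>main_loop u y0 k)" using Suc by simp
  also have "\<dots> \<le> (\<integral>\<^sup>+st. (\<integral>\<^sup>+st'. minor_state K (K - Suc k) u st' \<partial>loop_step u k st) \<partial>main_loop u y0 k)"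
    using minor_state_step[of "K - Suc k" K u] Suc.prems
    by (intro nn_integral_mono) (simp add: Suc_diff_Suc)
  also have "\<dots> = (\<integral>\<^sup>+st. minor_state K (K - Suc k) u st \<partial>main_loop u y0 (Suc k))"
    unfolding main_loop_Suc by simp
  finally show ?case .
qed

text \<open>\<open>minor\<close> lies below the run for each choice of seeds, and monotonicity of
  the lower integral asks for no measurability of the larger function.\<close>

lemma success_prob_ge:
  assumes "N1 \<le> K" and Q: "\<And>x T. good x \<Longrightarrow> real T \<le> T_bound K \<Longrightarrow> Q x T"
  shows "ennreal (9 / 10 - q_fail K K - Phi K 0 (y0, 0, 0)) \<le> success_prob y0 K Q"
proof -
  have "ennreal (9 / 10 - q_fail K K - Phi K 0 (y0, 0, 0)) \<le> (\<integral>\<^sup>+u. minor K K u (y0, 0, 0) \<partial>seeds)"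
    using minor_lower_bound[of y0 0 0 K K] y0 assms by simp
  also have "\<dots> \<le> success_prob y0 K Q"
    unfolding success_prob_def
  proof (rule nn_integral_mono)
    fix u
    have "minor K K u (y0, 0, 0) \<le> (\<integral>\<^sup>+st. minor_state K 0 u st \<partial>main_loop u y0 K)"
      using minor_state_main_loop[of K K u] by simp
    also have "\<dots> \<le> (\<integral>\<^sup>+st. emeasure (measure_pmf (final st)) (success K) \<partial>main_loop u y0 K)"
      by (intro nn_integral_mono minor_state_final)
    also have "\<dots> = emeasure (measure_pmf (run u y0 K)) (success K)" by (simp add: run_eq)
    also have "\<dots> \<le> emeasure (measure_pmf (run u y0 K)) {Some (x, T) | x T. Q x T}"
      using Q by (intro emeasure_mono) (auto simp: success_def)
    finally show "minor K K u (y0, 0, 0) \<le> emeasure (measure_pmf (run u y0 K)) {Some (x, T) | x T. Q x T}" .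
  qed
  finally show ?thesis .
qed

section \<open>Number of iterations and probability of failure\<close>

lemma sum_inverse_squares_le: "(\<Sum>i<K. 1 / (real i + 1)\<^sup>2) \<le> 2 - 1 / real K"
proof (induction K)
  case (Suc K)
  show ?case
  proof (cases "K = 0")
    case False
    \<comment> \<open>This telescoping bound is the reason for the term \<open>- 1 / real K\<close>
      in the claim.\<close>
    have "1 / (real K + 1)\<^sup>2 \<le> 1 / real K - 1 / (real K + 1)"
    proof -
      have "1 / (real K + 1)\<^sup>2 \<le> 1 / (real K * (real K + 1))"
        unfolding power2_eq_square using False by (intro divide_left_mono mult_right_mono) auto
      also have "\<dots> = 1 / real K - 1 / (real K + 1)" using False by (simp add: field_simps)
      finally show ?thesis .
    qed
    then show ?thesis using Suc by (simp add: add.commute)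
  qed simp
qed simp

lemma q_fail_le: "q_fail K K \<le> 1 / 10"
proof -
  have "q_fail K K = (\<Sum>i<K. 1 / (real i + 1)\<^sup>2) / 20"
    by (simp add: q_fail_def atLeast0LessThan sum_divide_distrib mult.commute)
  moreover have "0 \<le> 1 / real K" by simp
  ultimately show ?thesis using sum_inverse_squares_le[of K] by linarith
qed

text \<open>A second-order step lowers the value by \<open>decr\<close> on average, so about Delta /
  decr of them are expected, and minibatch errors at most double \<open>Delta\<close>. The factor 40
  brings the first summand of \<open>Phi\<close> down to 1/20.\<close>

definition K_iter :: nat where "K_iter = N1 + nat \<lceil>40 * Delta / decr\<rceil>"

lemma Delta_ge: "fa y0 - fstar \<le> Delta" and Delta_nonneg: "0 \<le> Delta"
  using Delta fstar_le[OF y0] by (auto simp: fstar_def)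

lemma N1_raw_eq: "N1_raw = 360000 * (sigma * Delta / (real p * eps\<^sup>2))"
  by (simp add: N1_raw_def theta)

lemma N1_raw_nonneg: "0 \<le> N1_raw"
  using sigma_pos Delta_nonneg by (simp add: N1_raw_eq)

lemma N1_bounds: "N1_raw \<le> real N1" "real N1 \<le> 1 + N1_raw"
  using N1_raw_nonneg unfolding N1_def by linarith+

lemma incr_le: "incr \<le> 4 * real p * eps\<^sup>2 / (sigma * 128 ^ 3)"
proof -
  have B: "0 < real B" using B_range by simp
  have "V / real B \<le> eps\<^sup>2 / 128 ^ 3" using B_ge B eps_pos by (simp add: field_simps)
  then have "4 * real p / sigma * (V / real B) \<le> 4 * real p / sigma * (eps\<^sup>2 / 128 ^ 3)"
    using sigma_pos by (intro mult_left_mono) auto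
  then show ?thesis by (simp add: incr_def)
qed

text \<open>As \<open>c_fst\<close> is 100 * 3600, lam * N1 is at least 100 Delta, and 100 * 4 *
  3600 \<le> 128^3 gives 100 incr \<le> lam; so the second summand is at most 2/100. The first one
  charges only N1 - 1 steps: N1 - 1 is at most \<open>N1_raw\<close>, which is proportional to
  \<open>Delta\<close>, whereas N1 is at least 1 however small \<open>Delta\<close> is.\<close>

lemma Phi_start_le: "Phi K_iter 0 (y0, 0, 0) \<le> 7 / 100"
proof -
  have pp: "0 < real p" using p_bounds(3) by simp
  note pos = pp sigma_pos eps_pos
  have "incr * (real N1 - 1) \<le> incr * N1_raw" using N1_bounds incr_nonneg by (intro mult_left_mono) auto
  also have "\<dots> \<le> 4 * real p * eps\<^sup>2 / (sigma * 128 ^ 3) * N1_raw" using incr_le N1_raw_nonneg by (intro mult_right_mono)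
  also have "\<dots> = 1440000 / 2097152 * Delta" using pos by (simp add: N1_raw_eq field_simps)
  also have "\<dots> \<le> Delta" using Delta_nonneg by simp
  finally have inc: "incr * (real N1 - 1) \<le> Delta" .
  have Kge: "40 * Delta / decr + 1 \<le> real K_iter - real N1 + 1"
    unfolding K_iter_def using Delta_nonneg decr_pos by (simp add: le_of_int_ceiling)
  have "decr * (40 * Delta / decr + 1) \<le> decr * (real K_iter - real N1 + 1)"
    using Kge decr_pos by (intro mult_left_mono) auto
  then have den: "40 * Delta + decr \<le> decr * (real K_iter - real N1 + 1)" using decr_pos by (simp add: distrib_left)
  have "(fa y0 - fstar + incr * (real N1 - 1)) / (decr * (real K_iter - real N1 + 1)) \<le> 1 / 20"
    using den inc Delta_ge Delta_nonneg decr_pos by (subst pos_divide_le_eq) linarith+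
  moreover have "(fa y0 - fstar + incr * real N1) / (lam * real N1) \<le> 2 / 100"
  proof -
    have "360000 * (sigma * Delta / (real p * eps\<^sup>2)) \<le> real N1" using N1_bounds by (simp add: N1_raw_eq)
    then have "100 * Delta \<le> lam * real N1" using pos by (simp add: lam_def field_simps)
    moreover have "100 * incr \<le> lam"
    proof -
      have "100 * incr \<le> 100 * (4 * real p * eps\<^sup>2 / (sigma * 128 ^ 3))" using incr_le by simp
      also have "\<dots> \<le> lam" using pos by (simp add: lam_def field_simps)
      finally show ?thesis .
    qed
    then have "100 * incr * real N1 \<le> lam * real N1" by (intro mult_right_mono) auto
    moreover have "0 < lam * real N1" using lam_pos N1_pos by simp
    ultimately show ?thesis using Delta_ge by (subst pos_divide_le_eq) linarith+
  qed
  moreover have "Phi K_iter 0 (y0, 0, 0) = (fa y0 - fstar + incr * (real N1 - 1)) / (decr * (real K_iter - real N1 + 1))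
      + (fa y0 - fstar + incr * real N1) / (lam * real N1)"
    using N1_pos by (simp add: Phi.simps)
  ultimately show ?thesis by linarith
qed

lemma success_prob_two_thirds:
  assumes "\<And>x T. good x \<Longrightarrow> real T \<le> T_bound K_iter \<Longrightarrow> Q x T"
  shows "ennreal (2 / 3) \<le> success_prob y0 K_iter Q"
proof -
  have "2 / 3 \<le> 9 / 10 - q_fail K_iter K_iter - Phi K_iter 0 (y0, 0, 0)"
    using q_fail_le[of K_iter] Phi_start_le by simp
  then have "ennreal (2 / 3) \<le> ennreal (9 / 10 - q_fail K_iter K_iter - Phi K_iter 0 (y0, 0, 0))"
    by (rule ennreal_leI)
  also have "\<dots> \<le> success_prob y0 K_iter Q"
    using assms by (intro success_prob_ge) (auto simp: K_iter_def)
  finally show ?thesis .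
qed

section \<open>The gradient complexity\<close>

definition main_rate :: real
  where "main_rate = L2 * Delta / (eps * del) * (L\<^sup>2 / del\<^sup>2 + V / eps\<^sup>2) + L * Delta / (eps * sqrt V) * (L\<^sup>2 / del\<^sup>2)"

lemma sigma_W_upper: "sigma * L_tilde\<^sup>2 \<le> W_par + eps * L ^ 3 / sqrt V"
proof (cases large_L2)
  case True
  have "sigma * L_tilde\<^sup>2 = sigma ^ 3" using large_sigma(1)[OF True] by (simp add: power2_eq_square power3_eq_cube)
  then show ?thesis using large_sigma(2)[OF True] eps_pos L_pos V_pos by simp
next
  case False
  have "sigma \<le> W_par / L\<^sup>2 + eps * L / sqrt V"
    unfolding small_sigma(2)[OF False] using W_par_pos eps_pos L_pos V_pos by simp
  then have "sigma * L\<^sup>2 \<le> (W_par / L\<^sup>2 + eps * L / sqrt V) * L\<^sup>2" by (intro mult_right_mono) auto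
  also have "\<dots> = W_par + eps * L ^ 3 / sqrt V"
    using L_pos by (simp add: distrib_right power2_eq_square power3_eq_cube)
  finally show ?thesis by (simp add: small_sigma(1)[OF False])
qed

text \<open>If the second argument of the maximum determines \<open>sigma\<close>, then del \<le>
  sigma bounds the cost order V / eps^2 of an epoch by the order L^2 / del^2 of a call of Oja's
  algorithm. This is why the rate has no product of L Delta / (eps sqrt V) and V / eps^2.\<close>

lemma sigma_W_or_V: "sigma * L_tilde\<^sup>2 \<le> W_par \<or> V / eps\<^sup>2 \<le> L\<^sup>2 / del\<^sup>2"
proof (cases large_L2)
  case True
  have "sigma * L_tilde\<^sup>2 = sigma ^ 3" using large_sigma(1)[OF True] by (simp add: power2_eq_square power3_eq_cube)
  then show ?thesis using large_sigma(2)[OF True] by simp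
next
  case False
  show ?thesis
  proof (cases "sigma = W_par / L\<^sup>2")
    case True
    then show ?thesis using L_pos by (simp add: small_sigma(1)[OF False])
  next
    case neq: False
    then have "sigma = eps * L / sqrt V" using small_sigma(2)[OF False] by (simp add: max_def split: if_splits)
    then have "del \<le> eps * L / sqrt V" using small_sigma(3)[OF False] del_pos by simp
    then have "sqrt V * del \<le> eps * L" using V_pos by (simp add: field_simps)
    then have "(sqrt V * del)\<^sup>2 \<le> (eps * L)\<^sup>2" using V_pos del_pos by (intro power_mono) auto
    then have "V / eps\<^sup>2 \<le> L\<^sup>2 / del\<^sup>2"
      using V_pos eps_pos del_pos by (simp add: power_mult_distrib field_simps)
    then show ?thesis ..
  qed
qed

text \<open>\<open>N1_raw\<close> depends on \<open>sigma\<close> only through sigma / p, and by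
  \<open>p_real_cube_ge\<close> the cube of that quotient is at most sigma L_tilde^2 eps^2 /
  V.\<close>

lemma sigma_le_of_cube:
  assumes "sigma * L_tilde\<^sup>2 * eps\<^sup>2 / V \<le> r ^ 3" "0 \<le> r"
  shows "sigma \<le> real p * r"
proof -
  have "sigma ^ 3 = sigma\<^sup>2 * V / (L_tilde\<^sup>2 * eps\<^sup>2) * (sigma * L_tilde\<^sup>2 * eps\<^sup>2 / V)"
    using V_pos eps_pos L_tilde_pos by (simp add: power2_eq_square power3_eq_cube)
  also have "\<dots> \<le> p_real ^ 3 * r ^ 3"
    using p_real_cube_ge assms sigma_pos V_pos p_real_ge by (intro mult_mono) auto
  also have "\<dots> \<le> real p ^ 3 * r ^ 3"
    using p_bounds(1) p_real_ge assms by (intro mult_right_mono power_mono) auto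
  also have "\<dots> = (real p * r) ^ 3" by (simp add: power_mult_distrib)
  finally show ?thesis using sigma_pos assms by (subst (asm) cube_le_iff) auto
qed

lemma W_cube: "W_par * eps\<^sup>2 / V = (eps / rho) ^ 3"
  using V_pos by (simp add: W_par_def power_divide power2_eq_square power3_eq_cube)

lemma N1_raw_le_of_sigma:
  assumes "sigma \<le> real p * r" shows "N1_raw \<le> 360000 * (r * Delta / eps\<^sup>2)"
proof -
  have pp: "0 < real p" using p_bounds(3) by simp
  have "sigma * Delta \<le> real p * r * Delta" using assms Delta_nonneg by (intro mult_right_mono)
  then have "sigma * Delta / (real p * eps\<^sup>2) \<le> real p * r * Delta / (real p * eps\<^sup>2)"
    by (intro divide_right_mono) auto
  then show ?thesis using pp by (simp add: N1_raw_eq)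
qed

text \<open>By \<open>sigma_W_upper\<close> the cube of sigma / p is at most a^3 + b^3, hence at
  most (a + b)^3; \<open>a\<close> and \<open>b\<close> come from the two arguments of the maximum
  and give the two summands.\<close>

lemma N1_raw_le: "N1_raw \<le> 360000 * (L2 * Delta / (eps * del) + L * Delta / (eps * sqrt V))"
proof -
  define a where "a = eps / rho"
  define b where "b = eps * L / sqrt V"
  have ab: "0 < a" "0 < b" using eps_pos rho_pos L_pos V_pos by (auto simp: a_def b_def)
  have "sigma * L_tilde\<^sup>2 * eps\<^sup>2 / V \<le> (W_par + eps * L ^ 3 / sqrt V) * eps\<^sup>2 / V"
    using sigma_W_upper V_pos by (intro divide_right_mono mult_right_mono) auto
  also have "\<dots> = a ^ 3 + b ^ 3"
  proof -
    have "eps * L ^ 3 / w * eps\<^sup>2 / (w * w) = (eps * L / w) ^ 3" for w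
      by (simp add: power_divide power_mult_distrib power3_eq_cube power2_eq_square ac_simps)
    from this[of "sqrt V"] have "eps * L ^ 3 / sqrt V * eps\<^sup>2 / V = b ^ 3" using V_pos by (simp add: b_def)
    then show ?thesis using W_cube by (simp only: distrib_right add_divide_distrib a_def)
  qed
  also have "\<dots> \<le> (a + b) ^ 3" using ab by (simp add: power3_eq_cube algebra_simps)
  finally have "sigma \<le> real p * (a + b)" using ab by (intro sigma_le_of_cube) auto
  moreover have "(a + b) * Delta / eps\<^sup>2 = L2 * Delta / (eps * del) + L * Delta / (eps * sqrt V)"
    using eps_pos L2_pos del_pos V_pos by (simp add: a_def b_def rho_def field_simps power2_eq_square)
  ultimately show ?thesis using N1_raw_le_of_sigma[of "a + b"] by simp
qed

lemma rate_terms_nonneg: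
  "0 \<le> L2 * Delta / (eps * del)" "0 \<le> L * Delta / (eps * sqrt V)" "0 \<le> L\<^sup>2 / del\<^sup>2" "0 \<le> V / eps\<^sup>2"
  using L2_pos Delta_nonneg eps_pos del_pos L_pos V_pos by auto

lemma N1_raw_oja: "N1_raw * (L\<^sup>2 / del\<^sup>2) \<le> 360000 * main_rate"
proof -
  have "N1_raw * (L\<^sup>2 / del\<^sup>2) \<le> 360000 * (L2 * Delta / (eps * del) + L * Delta / (eps * sqrt V)) * (L\<^sup>2 / del\<^sup>2)"
    using N1_raw_le by (intro mult_right_mono) auto
  moreover have "0 \<le> L2 * Delta / (eps * del) * (V / eps\<^sup>2)" using rate_terms_nonneg by (intro mult_nonneg_nonneg) auto
  moreover have "x \<le> 360000 * (a * (b + e) + g * b)" if "x \<le> 360000 * (a + g) * b" "0 \<le> a * e" for a b e g x :: real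
    using that by (simp add: algebra_simps)
  ultimately show ?thesis unfolding main_rate_def by blast
qed

lemma N1_raw_epoch: "N1_raw * (V / eps\<^sup>2) \<le> 360000 * main_rate"
  using sigma_W_or_V
proof
  assume "V / eps\<^sup>2 \<le> L\<^sup>2 / del\<^sup>2"
  then have "N1_raw * (V / eps\<^sup>2) \<le> N1_raw * (L\<^sup>2 / del\<^sup>2)" using N1_raw_nonneg by (intro mult_left_mono)
  then show ?thesis using N1_raw_oja by linarith
next
  assume "sigma * L_tilde\<^sup>2 \<le> W_par"
  then have "sigma * L_tilde\<^sup>2 * eps\<^sup>2 / V \<le> W_par * eps\<^sup>2 / V"
    using V_pos by (intro divide_right_mono mult_right_mono) auto
  then have "sigma \<le> real p * (eps / rho)" using eps_pos rho_pos by (intro sigma_le_of_cube) (auto simp: W_cube)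
  from N1_raw_le_of_sigma[OF this] have "N1_raw \<le> 360000 * (L2 * Delta / (eps * del))"
    using eps_pos by (simp add: rho_def power2_eq_square mult.commute)
  then have "N1_raw * (V / eps\<^sup>2) \<le> 360000 * (L2 * Delta / (eps * del)) * (V / eps\<^sup>2)"
    using rate_terms_nonneg by (intro mult_right_mono) auto
  moreover have "0 \<le> L2 * Delta / (eps * del) * (L\<^sup>2 / del\<^sup>2)" "0 \<le> L * Delta / (eps * sqrt V) * (L\<^sup>2 / del\<^sup>2)"
    using rate_terms_nonneg by (auto intro!: mult_nonneg_nonneg simp del: times_divide_eq_left times_divide_eq_right)
  moreover have "x \<le> 360000 * (a * (b + e) + g * b)" if "x \<le> 360000 * a * e" "0 \<le> a * b" "0 \<le> g * b" for a b e g x :: real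
    using that by (simp add: algebra_simps)
  ultimately show ?thesis unfolding main_rate_def by blast
qed

text \<open>Since p is at most B, rounding m up adds at most B to p m, and B + 2 p m stays below 5
  B.\<close>

lemma epoch_cost_le: "real epoch_cost \<le> 5 * (2 * 128 ^ 3) * (V / eps\<^sup>2)"
proof -
  have pp: "0 < real p" using p_bounds(3) by simp
  have "p_real \<le> p_real ^ 3" using p_real_ge self_le_power[of p_real 3] by simp
  also have "\<dots> \<le> 1 * real B / 128 ^ 3"
    unfolding p_real_cube using sigma_le sigma_pos
    by (intro divide_right_mono mult_right_mono) (auto simp: power_mono divide_le_eq_1)
  finally have "real p \<le> real B" using p_bounds(2) by simp
  moreover have "real p * real m \<le> real p * (real B / real p + 1)" using m_bounds(2) by (intro mult_left_mono) auto
  then have "real p * real m \<le> real B + real p" using pp by (simp add: distrib_left)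
  ultimately have "real B + 2 * (real p * real m) \<le> 5 * real B" by linarith
  also have "\<dots> \<le> 5 * (2 * 128 ^ 3 * (V / eps\<^sup>2))" using B_le by linarith
  finally show ?thesis by (simp add: natasha15.epoch_cost_def)
qed

text \<open>Rounding needs care. If \<open>N1_raw\<close> is at least 1, then N1 + 1 is at most 3
  \<open>N1_raw\<close>; otherwise N1 = 1 and the last summand of \<open>rate\<close> pays for Oja's
  calls. One further epoch and the rounding of \<open>T_sgd\<close> are covered by V / eps^2, which
  is at least 1. The exponent grows by 3 through the cubed logarithm in
  \<open>T_sgd\<close>.\<close>

lemma T_bound_le:
  assumes lf: "1 \<le> lf" "lg q_ratio \<le> 3 * lf" and cost: "cost = C_oja * lf ^ a * (L\<^sup>2 / del\<^sup>2)" and C_oja: "0 < C_oja"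
  defines "rate \<equiv> V / eps\<^sup>2 + L2\<^sup>2 * L\<^sup>2 * Delta / del ^ 5 + main_rate + (if N1_raw < 1 then L\<^sup>2 / del\<^sup>2 else 0)"
  shows "T_bound K_iter \<le> (1080000 * C_oja + 5 * (2 * 128 ^ 3) * 360001 + (27 * c_sgd c + 1)) * lf ^ (a + 3) * rate"
proof -
  define A2 where "A2 = L2\<^sup>2 * L\<^sup>2 * Delta / del ^ 5"
  define A5 where "A5 = (if N1_raw < 1 then L\<^sup>2 / del\<^sup>2 else 0)"
  have A2: "0 \<le> A2" using Delta_nonneg del_pos by (simp add: A2_def)
  have A5: "0 \<le> A5" by (simp add: A5_def)
  have V1: "1 \<le> V / eps\<^sup>2" using V_ge eps_pos by simp
  have mr: "0 \<le> main_rate" unfolding main_rate_def using rate_terms_nonneg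
    by (intro add_nonneg_nonneg mult_nonneg_nonneg) auto
  have rate: "rate = V / eps\<^sup>2 + A2 + main_rate + A5" by (simp add: rate_def A2_def A5_def)
  have r0: "0 \<le> rate" using A2 A5 V1 mr by (simp add: rate)
  have "real K_iter \<le> real N1 + (40 * Delta / decr + 1)"
    unfolding K_iter_def using Delta_nonneg decr_pos by (simp add: le_of_int_ceiling)
  also have "40 * Delta / decr = 480 * (L2\<^sup>2 * Delta / del ^ 3)" by (simp add: decr_def)
  finally have K: "real K_iter \<le> real N1 + 1 + 480 * (L2\<^sup>2 * Delta / del ^ 3)" by simp
  have "real K_iter * (L\<^sup>2 / del\<^sup>2) \<le> (real N1 + 1 + 480 * (L2\<^sup>2 * Delta / del ^ 3)) * (L\<^sup>2 / del\<^sup>2)"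
    using K by (intro mult_right_mono) auto
  also have "\<dots> = (real N1 + 1) * (L\<^sup>2 / del\<^sup>2) + 480 * A2"
  proof -
    have "L2\<^sup>2 * Delta / del ^ 3 * (L\<^sup>2 / del\<^sup>2) = A2"
      by (simp add: A2_def power_add[symmetric] ac_simps)
    then show ?thesis by (simp only: distrib_right mult.assoc)
  qed
  also have "(real N1 + 1) * (L\<^sup>2 / del\<^sup>2) \<le> 1080000 * main_rate + 2 * A5"
  proof (cases "N1_raw < 1")
    case True
    then have "N1 = 1" unfolding N1_def by linarith
    then show ?thesis using True mr by (simp add: A5_def)
  next
    case False
    then have "(real N1 + 1) * (L\<^sup>2 / del\<^sup>2) \<le> 3 * N1_raw * (L\<^sup>2 / del\<^sup>2)"
      using N1_bounds(2) by (intro mult_right_mono) auto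
    then show ?thesis using N1_raw_oja A5 by linarith
  qed
  finally have "real K_iter * (L\<^sup>2 / del\<^sup>2) \<le> 1080000 * rate" using A2 A5 V1 mr by (simp add: rate)
  then have "C_oja * lf ^ a * (real K_iter * (L\<^sup>2 / del\<^sup>2)) \<le> C_oja * lf ^ a * (1080000 * rate)"
    using C_oja lf by (intro mult_left_mono) auto
  also have "\<dots> \<le> C_oja * lf ^ (a + 3) * (1080000 * rate)"
    using C_oja lf r0 by (intro mult_right_mono mult_left_mono power_increasing) auto
  finally have 1: "real K_iter * cost \<le> 1080000 * C_oja * lf ^ (a + 3) * rate" by (simp add: cost ac_simps)
  have pow1: "1 \<le> lf ^ (a + 3)" using lf(1) by (rule one_le_power)
  have "real N1 * real epoch_cost \<le> (1 + N1_raw) * (5 * (2 * 128 ^ 3) * (V / eps\<^sup>2))"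
    using N1_bounds epoch_cost_le N1_raw_nonneg by (intro mult_mono) auto
  also have "\<dots> = 5 * (2 * 128 ^ 3) * (V / eps\<^sup>2 + N1_raw * (V / eps\<^sup>2))"
    by (simp add: algebra_simps add_divide_distrib)
  also have "\<dots> \<le> 5 * (2 * 128 ^ 3) * (360001 * rate)"
    using N1_raw_epoch A2 A5 V1 mr by (intro mult_left_mono) (auto simp: rate)
  also have "\<dots> \<le> 5 * (2 * 128 ^ 3) * (360001 * rate) * lf ^ (a + 3)"
    using mult_left_mono[OF pow1, of "5 * (2 * 128 ^ 3) * (360001 * rate)"] r0 by simp
  finally have 2: "real N1 * real epoch_cost \<le> 5 * (2 * 128 ^ 3) * 360001 * lf ^ (a + 3) * rate" by (simp add: ac_simps)
  have "real T_sgd \<le> c_sgd c * (V / eps\<^sup>2 * lg q_ratio ^ 3) + 1"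
  proof -
    have "0 \<le> c_sgd c * (V / eps\<^sup>2 * lg q_ratio ^ 3)"
      unfolding theta using V1 lg_ge[of q_ratio] by (intro mult_nonneg_nonneg) auto
    then show ?thesis unfolding T_sgd_def q_ratio_def by linarith
  qed
  also have "\<dots> \<le> c_sgd c * (V / eps\<^sup>2 * (3 * lf) ^ 3) + V / eps\<^sup>2 * lf ^ 3"
  proof (intro add_mono mult_left_mono power_mono)
    show "1 \<le> V / eps\<^sup>2 * lf ^ 3" using mult_mono[OF V1 one_le_power[OF lf(1), of 3]] V1 by simp
  qed (use lf V1 lg_ge[of q_ratio] in \<open>auto simp: theta\<close>)
  also have "\<dots> = (27 * c_sgd c + 1) * lf ^ 3 * (V / eps\<^sup>2)"
    by (simp add: power_mult_distrib algebra_simps add_divide_distrib)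
  also have "\<dots> \<le> (27 * c_sgd c + 1) * lf ^ (a + 3) * rate"
    using lf V1 A2 A5 mr by (intro mult_mono mult_left_mono power_increasing) (auto simp: rate theta)
  finally have 3: "real T_sgd \<le> (27 * c_sgd c + 1) * lf ^ (a + 3) * rate" .
  have "T_bound K_iter \<le> 1080000 * C_oja * lf ^ (a + 3) * rate + 5 * (2 * 128 ^ 3) * 360001 * lf ^ (a + 3) * rate
      + (27 * c_sgd c + 1) * lf ^ (a + 3) * rate"
    unfolding T_bound_def using 1 2 3 by linarith
  also have "\<dots> = (1080000 * C_oja + 5 * (2 * 128 ^ 3) * 360001 + (27 * c_sgd c + 1)) * lf ^ (a + 3) * rate"
    by (simp only: distrib_right)
  finally show ?thesis .
qed

text \<open>\<open>q_ratio\<close> is at most V / eps^2, whose logarithm is ln V + 2 ln (1 / eps),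
  and each of these two logarithms is at most \<open>lf\<close>.\<close>

lemma log_factor_bounds:
  defines "lf \<equiv> log_factor n d L L2 V eps del"
  shows "1 \<le> lf" "lg q_ratio \<le> 3 * lf"
proof -
  define A where "A = exp 1 + real n + real d + L + L2 + V + 1 / eps + 1 / del"
  have pos: "0 < L" "0 < L2" "0 < V" "0 < 1 / eps" "0 < 1 / del"
    using L_pos L2_pos V_pos eps_pos del_pos by auto
  have lf: "lf = ln A" by (simp add: lf_def log_factor_def A_def)
  have A: "exp 1 \<le> A" "V \<le> A" "1 / eps \<le> A" using pos by (auto simp: A_def)
  have A0: "0 < A" using A(2) V_pos by linarith
  have "ln (exp 1) \<le> ln A" using A A0 by (subst ln_le_cancel_iff) auto
  then show lf1: "1 \<le> lf" by (simp add: lf)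
  have V: "ln V \<le> lf" unfolding lf using A A0 V_pos by (subst ln_le_cancel_iff) auto
  have e: "ln (1 / eps) \<le> lf" unfolding lf using A A0 eps_pos by (subst ln_le_cancel_iff) auto
  have "ln q_ratio \<le> ln (V / eps\<^sup>2)"
    using q_ratio V_pos eps_pos by (subst ln_le_cancel_iff) auto
  also have "\<dots> = ln V + 2 * ln (1 / eps)"
    using V_pos eps_pos by (simp add: ln_div ln_realpow)
  finally show "lg q_ratio \<le> 3 * lf" using V e lf1 by (simp add: lg_def)
qed

end

theorem theorem2:
  fixes C_oja C_sgd3 c_sgd3 :: real and a_oja :: nat
  assumes "0 < C_oja" "0 < C_sgd3" "0 < c_sgd3"
  shows "\<exists>(c :: theta_consts) (c_var :: real) (c_del :: real) (C :: real) (a :: nat).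
    theta_consts_pos c \<and> 0 < c_var \<and> 0 < c_del \<and> 0 < C \<and>
    (\<forall>(n :: nat) (d :: nat) (f :: nat \<Rightarrow> rvec \<Rightarrow> real) (L :: real) (L2 :: real) (V :: real)
      (Delta :: real) (eps :: real) (del :: real) (y0 :: rvec)
      (oja :: oja) (hvp :: nat \<Rightarrow> rvec \<Rightarrow> real \<Rightarrow> nat) (sgd :: sgd3).
      1 \<le> d \<longrightarrow>
      natasha2.B c V eps \<in> {1..n} \<longrightarrow>
      (\<forall>i\<in>{1..n}. twice_differentiable d (f i) \<and> smooth d L (f i)) \<longrightarrow>
      second_order_smooth d L2 (average n f) \<longrightarrow>
      variance_le n d f V \<longrightarrow>
      y0 \<in> euclid d \<longrightarrow>
      bdd_below (average n f ` euclid d) \<longrightarrow>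
      average n f y0 - Inf (average n f ` euclid d) \<le> Delta \<longrightarrow>
      0 < eps \<longrightarrow>
      0 < del \<longrightarrow> del \<le> L \<longrightarrow>
      c_var * eps\<^sup>2 \<le> V \<longrightarrow>
      del ^ 4 \<le> c_del * (V * eps * L2 ^ 3 / L\<^sup>2) \<longrightarrow>
      oja_guarantee d (average n f) del
        (C_oja * log_factor n d L L2 V eps del ^ a_oja * (L\<^sup>2 / del\<^sup>2)) oja hvp \<longrightarrow>
      sgd3_guarantee C_sgd3 c_sgd3 n d V sgd \<longrightarrow>
      natasha2.sigma_in_range c L L2 V eps del \<and>
      (\<exists>K. ennreal (2/3) \<le> natasha2.success_prob c n d f L L2 V Delta eps del oja hvp sgd y0 K
        (\<lambda>x T.
          norm (gradient d (average n f) x) \<le> eps \<and>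
          eigenvalues_ge d (hessian d (average n f) x) (- 3 * del) \<and>
          real T \<le> C * log_factor n d L L2 V eps del ^ a *
            (V / eps\<^sup>2 + L2\<^sup>2 * L\<^sup>2 * Delta / del ^ 5 +
             L2 * Delta / (eps * del) * (L\<^sup>2 / del\<^sup>2 + V / eps\<^sup>2) +
             L * Delta / (eps * sqrt V) * (L\<^sup>2 / del\<^sup>2) +
             (if natasha2.N1_raw c L L2 V Delta eps del < 1 then L\<^sup>2 / del\<^sup>2 else 0)))))"
proof -
  \<comment> \<open>\<open>c_bat\<close> is the cube of 1 / \<open>c_sub\<close>, large enough for
    long sub-epochs and a small minibatch error at the step constant 1/1000. \<open>c_fst\<close> is
    100 times the 3600 in \<open>lam\<close>. \<open>c_smo\<close> = 3 + 2 reflects the smoothness 3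
    L + 2 sigma of the regularized function. In \<open>c_sgd\<close> the 15 meets the minimal number
    of SGD3 steps and the square meets the accuracy eps / 240.\<close>
  define c :: theta_consts where "c = \<lparr>c_sig1 = 1, c_sig2 = 1, c_bat = 128 ^ 3, c_sub = 1 / 128,
    c_step = 1 / 1000, c_fst = 360000, c_smo = 5, c_sgd = (1440 * C_sgd3)\<^sup>2 + 15\<rparr>"
  define C where "C = 1080000 * C_oja + 5 * (2 * 128 ^ 3) * 360001 + (27 * c_sgd c + 1)"
  have c_sgd: "0 < c_sgd c" by (simp add: c_def add_nonneg_pos)
  show ?thesis
  proof (rule exI[of _ c], rule exI[of _ 1], rule exI[of _ "1 / 3"], rule exI[of _ C], rule exI[of _ "a_oja + 3"],
      intro conjI allI impI, goal_cases)
    case 1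
    show ?case using c_sgd by (simp add: theta_consts_pos_def c_def)
  next
    case 4
    show ?case using c_sgd assms by (simp add: C_def)
  next
    case (5 n d f L L2 V Delta eps del y0 oja hvp sgd)
    interpret natasha2_run c n d f L L2 V Delta eps del oja hvp sgd C_sgd3 c_sgd3
      "C_oja * log_factor n d L L2 V eps del ^ a_oja * (L\<^sup>2 / del\<^sup>2)" y0
      by unfold_locales (use 5 assms in \<open>auto simp: c_def\<close>)
    show ?case by (rule in_range)
  next
    case (6 n d f L L2 V Delta eps del y0 oja hvp sgd)
    interpret natasha2_run c n d f L L2 V Delta eps del oja hvp sgd C_sgd3 c_sgd3
      "C_oja * log_factor n d L L2 V eps del ^ a_oja * (L\<^sup>2 / del\<^sup>2)" y0
      by unfold_locales (use 6 assms in \<open>auto simp: c_def\<close>)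
    show ?case
    proof (intro exI[of _ K_iter] success_prob_two_thirds conjI, goal_cases)
      case (1 x T)
      then show ?case by (simp add: good_def)
    next
      case (2 x T)
      then show ?case by (simp add: good_def)
    next
      case (3 x T)
      show ?case
        using order_trans[OF 3(2) T_bound_le[OF log_factor_bounds refl assms(1)]]
        unfolding C_def main_rate_def by (simp only: add.assoc)
    qed
  qed simp_all
qed

end
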